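(* Let $A$ be an expanding $d\times d$ integral matrix and let $f\in L^2(\mu)$ be real-valued with $\int f\,d\mu=0$ and $$\int_0^1\frac{\Omega_{f,2}(t)}{t}\,dt<\infty.$$ Then, with $x$ distributed according to $\mu$, the random variables $\frac{1}{\sqrt n}\sum_{j=0}^{n-1} f(A^j x)$ converge in law as $n\to\infty$ to a Gaussian variable with mean zero and finite variance $$\sigma^2=-\int f^2\,d\mu+2\sum_{n=0}^\infty\int f(x)f(A^nx)\,d\mu(x)$$ (the series being convergent).
   Context: $\mathbb{T}^d=\mathbb{R}^d/\mathbb{Z}^d$, $\mu$ is normalized Haar measure on $\mathbb{T}^d$. An integral matrix $A$ is expanding if all its eigenvalues have absolute value $>1$; it acts on $\mathbb{T}^d$ by $x\mapsto Ax$. $\Omega_{f,2}(\delta)=\sup_{|v|\le\delta}\|f(\cdot+v)-f(\cdot)\|_{L^2(\mu)}$, $|v|$ the Euclidean norm. *)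

theory Defs
  imports "HOL-Analysis.Analysis" "HOL-Probability.Probability"
begin

text \<open>The torus T^d is modelled as the fundamental domain [0,1)^d inside real^'d;
  functions on T^d are Z^d-periodic functions on real^'d.\<close>

definition unit_cube :: "(real ^ 'd) set" where
  "unit_cube = {x. \<forall>i. 0 \<le> x $ i \<and> x $ i < 1}"

definition haar_torus :: "(real ^ 'd) measure" where
  "haar_torus = restrict_space lborel unit_cube"

definition int_vec :: "real ^ 'd \<Rightarrow> bool" where
  "int_vec k \<longleftrightarrow> (\<forall>i. k $ i \<in> \<int>)"

definition periodic_Zd :: "(real ^ 'd \<Rightarrow> real) \<Rightarrow> bool" where
  "periodic_Zd f \<longleftrightarrow> (\<forall>x k. int_vec k \<longrightarrow> f (x + k) = f x)"

definition integral_matrix :: "real ^ 'd ^ 'd \<Rightarrow> bool" where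
  "integral_matrix A \<longleftrightarrow> (\<forall>i j. A $ i $ j \<in> \<int>)"

definition complex_eigenvalue :: "real ^ 'd ^ 'd \<Rightarrow> complex \<Rightarrow> bool" where
  "complex_eigenvalue A c \<longleftrightarrow>
     (\<exists>v :: complex ^ 'd. v \<noteq> 0 \<and>
        (\<chi> i j. complex_of_real (A $ i $ j)) *v v = c *s v)"

definition expanding :: "real ^ 'd ^ 'd \<Rightarrow> bool" where
  "expanding A \<longleftrightarrow> (\<forall>c. complex_eigenvalue A c \<longrightarrow> cmod c > 1)"

definition L2_modulus :: "(real ^ 'd \<Rightarrow> real) \<Rightarrow> real \<Rightarrow> real" where
  "L2_modulus f \<delta> = (SUP v \<in> cball 0 \<delta>.
      sqrt (\<integral>x. (f (x + v) - f x)\<^sup>2 \<partial>haar_torus))"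

definition centered_gaussian :: "real \<Rightarrow> real measure" where
  "centered_gaussian s2 =
     (if s2 = 0 then return borel 0 else density lborel (normal_density 0 (sqrt s2)))"

end

theory Submission
  imports Defs "HOL-Computational_Algebra.Fundamental_Theorem_Algebra"
begin

text \<open>Let \<open>T x = A x\<close> on the torus. Translating the integral of \<open>f (x) \<phi> (A^n x)\<close> by \<open>A^(-n) u\<close> and
  averaging over \<open>u\<close> in the unit cube shows that it is at most \<open>w n\<close> times the norm of \<open>\<phi>\<close>, where
  \<open>w n\<close> is the \<open>L\<^sup>2\<close> modulus of \<open>f\<close> at \<open>C r^n\<close> with \<open>r < 1\<close>; by the Dini condition \<open>w\<close> is summable.
  So the iterates of \<open>f\<close> under the transfer operator (the adjoint of composition with \<open>T\<close>) have
  summable norms, and Gordin's method writes \<open>f\<close>, up to a coboundary and a small error, as a bounded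
  reverse martingale difference \<open>h\<close>. McLeish's product argument gives the Gaussian limit of the
  characteristic functions for \<open>h\<close>, using only mixing for \<open>h\<^sup>2\<close>, which comes from the same
  translation trick and the continuity of translations in \<open>L\<^sup>1\<close>. Levy's theorem concludes.\<close>

subsection \<open>Square-integrable functions\<close>

text \<open>The average over \<open>u\<close> works because
  \<open>A^n (x + A^(-n) u) = A^n x + u\<close>: the shift of \<open>f\<close> is small while the
  argument of the test function moves by the whole of \<open>u\<close>. So for fixed
  \<open>x\<close>, averaging turns \<open>\<phi> (A^n x + u)\<close> into the mean of
  \<open>\<phi>\<close>, and what remains is a product of two means, one of which is zero. As
  \<open>\<phi>\<close> is arbitrary, duality makes this a bound on the norm of the
  \<open>n\<close>-th transfer iterate, which is what Gordin's method needs and is more than decay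
  of the autocorrelations of \<open>f\<close>. Cutting Gordin's series after \<open>N\<close> terms
  leaves a remainder that is small only in its variance growth; this suffices because the difference
  of two characteristic functions is bounded by the \<open>L\<^sup>2\<close> distance. Truncation is
  forced by McLeish's argument, whose products must be bounded uniformly in the number of factors.
  The limiting variance is never computed from the martingale: it is read off from the second
  moments of the Birkhoff sums of \<open>f\<close>. Decay of \<open>A^(-n)\<close> is obtained from
  the eigenvalues alone, by splitting linear factors off an annihilating polynomial.\<close>

definition sq_integrable :: "'a measure \<Rightarrow> ('a \<Rightarrow> real) \<Rightarrow> bool" where
  "sq_integrable M f \<longleftrightarrow> f \<in> borel_measurable M \<and> integrable M (\<lambda>x. (f x)\<^sup>2)"

definition l2norm :: "'a measure \<Rightarrow> ('a \<Rightarrow> real) \<Rightarrow> real" where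
  "l2norm M f = sqrt (\<integral>x. (f x)\<^sup>2 \<partial>M)"

lemma sq_integrable_measurable: "sq_integrable M f \<Longrightarrow> f \<in> borel_measurable M"
  by (simp add: sq_integrable_def)

lemma l2norm_nonneg [simp]: "0 \<le> l2norm M f"
  by (simp add: l2norm_def)

lemma l2norm_power2: "(l2norm M f)\<^sup>2 = (\<integral>x. (f x)\<^sup>2 \<partial>M)"
  by (simp add: l2norm_def)

lemma integrable_mult_sq_integrable:
  assumes "sq_integrable M f" "sq_integrable M g"
  shows "integrable M (\<lambda>x. f x * g x)"
proof (rule Bochner_Integration.integrable_bound)
  show "integrable M (\<lambda>x. (f x)\<^sup>2 + (g x)\<^sup>2)"
    using assms by (simp add: sq_integrable_def)
  show "(\<lambda>x. f x * g x) \<in> borel_measurable M"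
    using assms unfolding sq_integrable_def by (intro borel_measurable_times) auto
  have "\<bar>a * b\<bar> \<le> \<bar>a\<^sup>2 + b\<^sup>2\<bar>" for a b :: real
  proof -
    have "2 * (\<bar>a\<bar> * \<bar>b\<bar>) \<le> a\<^sup>2 + b\<^sup>2"
      using sum_squares_bound[of "\<bar>a\<bar>" "\<bar>b\<bar>"] by (simp add: mult.assoc)
    moreover have "0 \<le> \<bar>a\<bar> * \<bar>b\<bar>" by simp
    ultimately show ?thesis unfolding abs_mult by linarith
  qed
  then show "AE x in M. norm (f x * g x) \<le> norm ((f x)\<^sup>2 + (g x)\<^sup>2)"
    by simp
qed

lemma sq_integrable_add:
  assumes "sq_integrable M f" "sq_integrable M g"
  shows "sq_integrable M (\<lambda>x. f x + g x)"
  using assms integrable_mult_sq_integrable[OF assms]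
  by (auto simp: sq_integrable_def power2_sum mult.assoc)

lemma sq_integrable_cmult: "sq_integrable M f \<Longrightarrow> sq_integrable M (\<lambda>x. c * f x)"
  by (auto simp: sq_integrable_def power_mult_distrib)

lemma sq_integrable_minus: "sq_integrable M f \<Longrightarrow> sq_integrable M (\<lambda>x. - f x)"
  by (auto simp: sq_integrable_def)

lemma sq_integrable_diff:
  assumes "sq_integrable M f" "sq_integrable M g"
  shows "sq_integrable M (\<lambda>x. f x - g x)"
  using sq_integrable_add[OF assms(1) sq_integrable_minus[OF assms(2)]] by simp

lemma sq_integrable_sum:
  "(\<And>i. i \<in> I \<Longrightarrow> sq_integrable M (f i)) \<Longrightarrow> sq_integrable M (\<lambda>x. \<Sum>i\<in>I. f i x)"
proof (induction I rule: infinite_finite_induct)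
  case (insert i I)
  then show ?case by (simp add: sq_integrable_add)
qed (auto simp: sq_integrable_def)

lemma sq_integrable_abs: "sq_integrable M f \<Longrightarrow> sq_integrable M (\<lambda>x. \<bar>f x\<bar>)"
  by (auto simp: sq_integrable_def)

text \<open>Discriminant argument for the nonnegative quadratic form
  \<open>s\<^sup>2 * a + 2 * (s * r) * c + r\<^sup>2 * b\<close>, the integral of
  \<open>(s f + r g)\<^sup>2\<close>. The choice \<open>s = b\<close>, \<open>r = - c\<close> yields
  \<open>b * (a * b - c\<^sup>2)\<close>.\<close>

lemma Cauchy_Schwarz_l2:
  assumes "sq_integrable M f" "sq_integrable M g"
  shows "\<bar>\<integral>x. f x * g x \<partial>M\<bar> \<le> l2norm M f * l2norm M g"
proof -
  define a where "a = (\<integral>x. (f x)\<^sup>2 \<partial>M)"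
  define b where "b = (\<integral>x. (g x)\<^sup>2 \<partial>M)"
  define c where "c = (\<integral>x. f x * g x \<partial>M)"
  have i: "integrable M (\<lambda>x. (f x)\<^sup>2)" "integrable M (\<lambda>x. (g x)\<^sup>2)"
    "integrable M (\<lambda>x. f x * g x)"
    using assms integrable_mult_sq_integrable by (auto simp: sq_integrable_def)
  have q: "0 \<le> s\<^sup>2 * a + 2 * (s * r) * c + r\<^sup>2 * b" for s r
  proof -
    have "0 \<le> (\<integral>x. (s * f x + r * g x)\<^sup>2 \<partial>M)" by simp
    also have "(\<lambda>x. (s * f x + r * g x)\<^sup>2) = (\<lambda>x. s\<^sup>2 * (f x)\<^sup>2 + 2 * (s * r) * (f x * g x) + r\<^sup>2 * (g x)\<^sup>2)"
      by (auto simp: power2_eq_square algebra_simps)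
    also have "(\<integral>x. s\<^sup>2 * (f x)\<^sup>2 + 2 * (s * r) * (f x * g x) + r\<^sup>2 * (g x)\<^sup>2 \<partial>M)
        = s\<^sup>2 * a + 2 * (s * r) * c + r\<^sup>2 * b"
      using i by (simp add: a_def b_def c_def)
    finally show ?thesis .
  qed
  have a0: "a \<ge> 0" and b0: "b \<ge> 0" by (auto simp: a_def b_def)
  have "c\<^sup>2 \<le> a * b"
  proof (cases "b = 0")
    case True
    have "c = 0"
    proof (rule ccontr)
      assume "c \<noteq> 0"
      \<comment> \<open>With \<open>b = 0\<close> and \<open>s = 1\<close> the form is affine in
        \<open>r\<close>; this \<open>r\<close> gives it the value -1.\<close>
      have "2 * c * (-(a+1)/(2*c)) = -(a+1)" using \<open>c \<noteq> 0\<close> by simp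
      then show False using q[of 1 "-(a+1)/(2*c)"] True a0 by (simp add: algebra_simps)
    qed
    then show ?thesis using True by simp
  next
    case False
    then have "b > 0" using b0 by simp
    have "0 \<le> b * (a * b - c\<^sup>2)"
      using q[of b "-c"] by (simp add: power2_eq_square algebra_simps)
    then show ?thesis using \<open>b > 0\<close> by (simp add: zero_le_mult_iff)
  qed
  then have "sqrt (c\<^sup>2) \<le> sqrt (a * b)" by (rule real_sqrt_le_mono)
  then show ?thesis by (simp add: real_sqrt_mult a_def b_def c_def l2norm_def)
qed

lemma l2norm_triangle:
  assumes "sq_integrable M f" "sq_integrable M g"
  shows "l2norm M (\<lambda>x. f x + g x) \<le> l2norm M f + l2norm M g"
proof (rule power2_le_imp_le)
  have i: "integrable M (\<lambda>x. (f x)\<^sup>2)" "integrable M (\<lambda>x. (g x)\<^sup>2)"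
    "integrable M (\<lambda>x. f x * g x)"
    using assms integrable_mult_sq_integrable by (auto simp: sq_integrable_def)
  have "(l2norm M (\<lambda>x. f x + g x))\<^sup>2 = (l2norm M f)\<^sup>2 + (l2norm M g)\<^sup>2 + 2 * (\<integral>x. f x * g x \<partial>M)"
    using i by (simp add: l2norm_power2 power2_sum mult.assoc)
  also have "\<dots> \<le> (l2norm M f + l2norm M g)\<^sup>2"
    using Cauchy_Schwarz_l2[OF assms] by (simp add: power2_sum)
  finally show "(l2norm M (\<lambda>x. f x + g x))\<^sup>2 \<le> (l2norm M f + l2norm M g)\<^sup>2" .
qed auto

lemma l2norm_minus: "l2norm M (\<lambda>x. - f x) = l2norm M f"
  by (simp add: l2norm_def)

lemma l2norm_diff_commute: "l2norm M (\<lambda>x. f x - g x) = l2norm M (\<lambda>x. g x - f x)"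
proof -
  have "(f x - g x)\<^sup>2 = (g x - f x)\<^sup>2" for x by (rule power2_commute)
  then show ?thesis by (simp only: l2norm_def)
qed

lemma l2norm_diff_le:
  assumes "sq_integrable M f" "sq_integrable M g"
  shows "l2norm M (\<lambda>x. f x - g x) \<le> l2norm M f + l2norm M g"
  using l2norm_triangle[OF assms(1) sq_integrable_minus[OF assms(2)]] by (simp add: l2norm_minus)

lemma l2norm_diff_triangle:
  assumes "sq_integrable M f" "sq_integrable M g"
  shows "\<bar>l2norm M f - l2norm M g\<bar> \<le> l2norm M (\<lambda>x. f x - g x)"
proof -
  have "l2norm M f \<le> l2norm M (\<lambda>x. f x - g x) + l2norm M g"
    using l2norm_triangle[OF sq_integrable_diff[OF assms] assms(2)] by simp
  moreover have "l2norm M g \<le> l2norm M (\<lambda>x. g x - f x) + l2norm M f"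
    using l2norm_triangle[OF sq_integrable_diff[OF assms(2,1)] assms(1)] by simp
  ultimately show ?thesis using l2norm_diff_commute[of M f g] by linarith
qed

lemma l2norm_cmult: "l2norm M (\<lambda>x. c * f x) = \<bar>c\<bar> * l2norm M f"
  by (simp add: l2norm_def power_mult_distrib real_sqrt_mult)

text \<open>Serves to bound a norm by duality: testing a transfer iterate against itself gives an
  inequality of exactly this shape.\<close>

lemma le_of_power2_le_mult:
  fixes x a :: real
  assumes "x\<^sup>2 \<le> a * x" "0 \<le> a" shows "x \<le> a"
proof (cases "x > 0")
  case True then show ?thesis using assms(1) by (simp add: power2_eq_square)
next
  case False then show ?thesis using assms(2) by linarith
qed

lemma (in finite_measure) sq_integrable_bounded:
  assumes "f \<in> borel_measurable M" "\<And>x. x \<in> space M \<Longrightarrow> \<bar>f x\<bar> \<le> K"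
  shows "sq_integrable M f"
proof -
  have "(f x)\<^sup>2 \<le> K\<^sup>2" if "x \<in> space M" for x
    using assms(2)[OF that] by (simp add: abs_le_square_iff[symmetric])
  then have "integrable M (\<lambda>x. (f x)\<^sup>2)"
    using assms(1) by (intro integrable_const_bound[of _ "K\<^sup>2"]) (auto intro!: AE_I2)
  then show ?thesis using assms(1) by (simp add: sq_integrable_def)
qed

lemma (in prob_space) sq_integrable_imp_integrable:
  assumes "sq_integrable M f" shows "integrable M f"
  using integrable_mult_sq_integrable[OF assms, of "\<lambda>_. 1"] by (simp add: sq_integrable_def)

lemma (in prob_space) integral_abs_le_l2norm:
  assumes "sq_integrable M f" shows "(\<integral>x. \<bar>f x\<bar> \<partial>M) \<le> l2norm M f"
  using Cauchy_Schwarz_l2[OF sq_integrable_abs[OF assms], of "\<lambda>_. 1"]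
  by (simp add: sq_integrable_def l2norm_def prob_space)

text \<open>Doob-Dynkin factorization. The level sets of a simple approximant are preimages of
  measurable sets, which factors the approximant; the factors converge on the image of
  \<open>T\<close>, and their limit is the factor of \<open>f\<close>.\<close>

lemma measurable_vimage_algebra_factor:
  fixes f :: "'a \<Rightarrow> real"
  assumes f: "f \<in> borel_measurable (vimage_algebra X T N)" and T: "T \<in> X \<rightarrow> space N"
  obtains g where "g \<in> borel_measurable N" "\<And>x. x \<in> X \<Longrightarrow> f x = g (T x)"
proof -
  obtain F where F: "\<And>i. simple_function (vimage_algebra X T N) (F i)"
    and lim: "\<And>x. x \<in> X \<Longrightarrow> (\<lambda>i. F i x) \<longlonglongrightarrow> f x"
    using borel_measurable_implies_sequence_metric[OF f, of 0] by auto
  have "\<exists>h. h \<in> borel_measurable N \<and> (\<forall>x\<in>X. F i x = h (T x))" for i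
  proof -
    have fin: "finite (F i ` X)" and meas: "\<And>y. y \<in> F i ` X \<Longrightarrow> F i -` {y} \<inter> X \<in> sets (vimage_algebra X T N)"
      using F[of i] by (auto simp: simple_function_def)
    have "\<forall>y\<in>F i ` X. \<exists>B\<in>sets N. F i -` {y} \<inter> X = T -` B \<inter> X"
    proof
      fix y assume "y \<in> F i ` X"
      then show "\<exists>B\<in>sets N. F i -` {y} \<inter> X = T -` B \<inter> X"
        using meas[of y] unfolding sets_vimage_algebra2[OF T] by blast
    qed
    then obtain B where B: "\<And>y. y \<in> F i ` X \<Longrightarrow> B y \<in> sets N"
      "\<And>y. y \<in> F i ` X \<Longrightarrow> F i -` {y} \<inter> X = T -` B y \<inter> X" by metis
    define h where "h z = (\<Sum>y\<in>F i ` X. y * indicator (B y) z)" for z :: 'b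
    have "h \<in> borel_measurable N" unfolding h_def using B(1) by measurable
    moreover have "F i x = h (T x)" if x: "x \<in> X" for x
    proof -
      have "indicator (B y) (T x) = (if y = F i x then 1 else 0 :: real)" if "y \<in> F i ` X" for y
        using B(2)[OF that] x by (auto simp: indicator_def)
      then have "h (T x) = (\<Sum>y\<in>F i ` X. if F i x = y then y else 0)"
        unfolding h_def by (intro sum.cong) auto
      then show ?thesis using fin x by (simp add: sum.delta)
    qed
    ultimately show ?thesis by blast
  qed
  then obtain H where H: "\<And>i. H i \<in> borel_measurable N" "\<And>i x. x \<in> X \<Longrightarrow> F i x = H i (T x)" by metis
  \<comment> \<open>The factors \<open>H i\<close> need not converge off the image of
    \<open>X\<close> under \<open>T\<close>; there \<open>lim\<close> has some unspecified value,
    yet the function stays measurable.\<close>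
  have "(\<lambda>z. lim (\<lambda>i. H i z)) \<in> borel_measurable N" using H(1) by measurable
  moreover have "f x = lim (\<lambda>i. H i (T x))" if "x \<in> X" for x
    using lim[OF that] H(2)[OF that] by (simp add: limI)
  ultimately show thesis by (rule that)
qed

lemma Cesaro_mean:
  fixes d :: "nat \<Rightarrow> real"
  assumes "d \<longlonglongrightarrow> L"
  shows "(\<lambda>n. (\<Sum>m<n. d m) / real n) \<longlonglongrightarrow> L"
proof (rule LIMSEQ_I)
  fix r :: real assume "r > 0"
  then obtain N where N: "\<And>n. n \<ge> N \<Longrightarrow> \<bar>d n - L\<bar> < r / 2"
    using LIMSEQ_D[OF assms, of "r/2"] by auto
  define C where "C = (\<Sum>m<N. \<bar>d m - L\<bar>)"
  obtain N2 :: nat where N2: "real N2 > 2 * C / r" using reals_Archimedean2 by blast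
  have "C \<ge> 0" unfolding C_def by (simp add: sum_nonneg)
  have "\<bar>(\<Sum>m<n. d m) / real n - L\<bar> < r" if n: "n \<ge> max (max N N2) 1" for n
  proof -
    have "(\<Sum>m<n. d m) - real n * L = (\<Sum>m<n. d m - L)" by (simp add: sum_subtractf)
    then have "\<bar>(\<Sum>m<n. d m) - real n * L\<bar> \<le> (\<Sum>m<n. \<bar>d m - L\<bar>)"
      by (metis sum_abs)
    also have "(\<Sum>m<n. \<bar>d m - L\<bar>) = (\<Sum>m\<in>{..<N} \<union> {N..<n}. \<bar>d m - L\<bar>)"
      using n by (intro sum.cong) auto
    also have "\<dots> = C + (\<Sum>m\<in>{N..<n}. \<bar>d m - L\<bar>)"
      unfolding C_def by (intro sum.union_disjoint) auto
    also have "(\<Sum>m\<in>{N..<n}. \<bar>d m - L\<bar>) \<le> (\<Sum>m\<in>{N..<n}. r / 2)"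
      using N by (intro sum_mono) (auto intro: less_imp_le)
    also have "\<dots> \<le> real n * (r / 2)" using \<open>r > 0\<close> by (simp add: of_nat_diff mult_right_mono)
    also have "C < real n * (r/2)"
    proof -
      have "2 * C / r < real n" using N2 n by linarith
      then show ?thesis using \<open>r > 0\<close> by (simp add: field_simps)
    qed
    finally have "\<bar>(\<Sum>m<n. d m) - real n * L\<bar> < real n * r" by (simp add: mult.commute)
    moreover have "(\<Sum>m<n. d m) / real n - L = ((\<Sum>m<n. d m) - real n * L) / real n"
      using n by (simp add: field_simps)
    ultimately show ?thesis using n by (simp add: abs_divide pos_divide_less_eq mult.commute)
  qed
  then show "\<exists>no. \<forall>n\<ge>no. norm ((\<Sum>m<n. d m) / real n - L) < r" unfolding real_norm_def by blast
qed

subsection \<open>The transfer operator of a measure-preserving map\<close>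

locale measure_preserving = prob_space M for M :: "'a measure" +
  fixes T :: "'a \<Rightarrow> 'a"
  assumes T_measurable [measurable]: "T \<in> measurable M M"
    and distr_T: "distr M M T = M"
begin

lemma Tn_measurable [measurable]: "(T ^^ n) \<in> measurable M M"
  by (induction n) (auto intro: measurable_comp[OF _ T_measurable])

lemma Tn_space: "x \<in> space M \<Longrightarrow> (T ^^ n) x \<in> space M"
  using measurable_space[OF Tn_measurable] .

lemma distr_Tn: "distr M M (T ^^ n) = M"
proof (induction n)
  case 0
  show ?case using distr_id[of M] by (simp add: id_def)
next
  case (Suc n)
  have "distr M M (T ^^ Suc n) = distr (distr M M (T ^^ n)) M T"
    by (subst distr_distr) auto
  then show ?case by (simp only: Suc distr_T)
qed

lemma integral_Tn:
  fixes g :: "'a \<Rightarrow> 'b::{banach, second_countable_topology}"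
  assumes [measurable]: "g \<in> borel_measurable M"
  shows "(\<integral>x. g ((T ^^ n) x) \<partial>M) = (\<integral>x. g x \<partial>M)"
  using integral_distr[of "T ^^ n" M M g] by (simp add: distr_Tn)

lemma integrable_Tn:
  fixes g :: "'a \<Rightarrow> 'b::{banach, second_countable_topology}"
  assumes "integrable M g"
  shows "integrable M (\<lambda>x. g ((T ^^ n) x))"
  using integrable_distr_eq[of "T ^^ n" M M g] assms by (simp add: distr_Tn)

lemma sq_integrable_Tn: "sq_integrable M g \<Longrightarrow> sq_integrable M (\<lambda>x. g ((T ^^ n) x))"
  using integrable_Tn[of "\<lambda>x. (g x)\<^sup>2" n] by (auto simp: sq_integrable_def)

lemma l2norm_Tn: "g \<in> borel_measurable M \<Longrightarrow> l2norm M (\<lambda>x. g ((T ^^ n) x)) = l2norm M g"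
  using integral_Tn[of "\<lambda>x. (g x)\<^sup>2" n] by (simp add: l2norm_def)

lemma integral_T: "g \<in> borel_measurable M \<Longrightarrow> (\<integral>x. g (T x) \<partial>M) = (\<integral>x. g x \<partial>M)"
  for g :: "'a \<Rightarrow> 'b::{banach, second_countable_topology}"
  using integral_Tn[of g 1] by simp

lemma sq_integrable_T: "sq_integrable M g \<Longrightarrow> sq_integrable M (\<lambda>x. g (T x))"
  using sq_integrable_Tn[of g 1] by simp

lemma l2norm_T: "g \<in> borel_measurable M \<Longrightarrow> l2norm M (\<lambda>x. g (T x)) = l2norm M g"
  using l2norm_Tn[of g 1] by simp

text \<open>The adjoint of composition with \<open>T\<close>, stated as a relation since it
  determines \<open>p\<close> only up to null sets.\<close>

definition is_transfer :: "('a \<Rightarrow> real) \<Rightarrow> ('a \<Rightarrow> real) \<Rightarrow> bool" where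
  "is_transfer f p \<longleftrightarrow> sq_integrable M p \<and>
     (\<forall>\<phi>. sq_integrable M \<phi> \<longrightarrow> (\<integral>x. p x * \<phi> x \<partial>M) = (\<integral>x. f x * \<phi> (T x) \<partial>M))"

text \<open>The conditional expectation \<open>e\<close> of \<open>f\<close> given the sigma-algebra
  pulled back along \<open>T\<close> is a function of \<open>T x\<close>, and any \<open>p\<close>
  with \<open>p (T x) = e x\<close> almost everywhere is an image of \<open>f\<close> under the
  transfer operator. Leaving \<open>p\<close> free allows the factor \<open>g\<close> to be modified
  on a null set, which the bounded version needs.\<close>

lemma transfer_aux:
  assumes f: "sq_integrable M f"
  shows "\<exists>e g. g \<in> borel_measurable M \<and> (\<forall>x\<in>space M. e x = g (T x)) \<and>
    (\<forall>p\<in>borel_measurable M. (AE x in M. p (T x) = e x) \<longrightarrow> is_transfer f p) \<and>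
    (\<forall>K. (\<forall>x\<in>space M. \<bar>f x\<bar> \<le> K) \<longrightarrow> (AE x in M. \<bar>e x\<bar> \<le> K))"
proof -
  define F where "F = vimage_algebra (space M) T M"
  have TX: "T \<in> space M \<rightarrow> space M" using T_measurable by (auto simp: measurable_def)
  interpret F: finite_measure_subalgebra M F
  proof
    show "subalgebra M F"
      unfolding subalgebra_def F_def sets_vimage_algebra2[OF TX]
      using measurable_sets[OF T_measurable] by auto
  qed
  define e where "e = real_cond_exp M F f"
  have [measurable]: "f \<in> borel_measurable M" using f by (simp add: sq_integrable_def)
  have "e \<in> borel_measurable F" by (simp add: e_def)
  then obtain g where g: "g \<in> borel_measurable M" "\<And>x. x \<in> space M \<Longrightarrow> e x = g (T x)"
    using measurable_vimage_algebra_factor[OF _ TX, of e] unfolding F_def by blast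
  have fi: "integrable M f" using sq_integrable_imp_integrable[OF f] .
  have [measurable]: "e \<in> borel_measurable M" by (simp add: e_def)
  \<comment> \<open>Jensen's inequality for the square puts \<open>e\<close> in
    \<open>L\<^sup>2\<close>.\<close>
  have e2: "integrable M (\<lambda>x. (e x)\<^sup>2)" unfolding e_def
  proof (rule F.integrable_convex_cond_exp[of f UNIV])
    show "convex_on UNIV (\<lambda>x::real. x\<^sup>2)" by (rule convex_power2)
  qed (use fi f in \<open>auto simp: sq_integrable_def\<close>)
  have tr: "is_transfer f p" if [measurable]: "p \<in> borel_measurable M" and ae: "AE x in M. p (T x) = e x" for p
    unfolding is_transfer_def
  proof (intro conjI allI impI)
    have "integrable M (\<lambda>x. (p (T x))\<^sup>2)"
    proof -
      have "AE x in M. (p (T x))\<^sup>2 = (e x)\<^sup>2" using ae by eventually_elim simp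
      then show ?thesis using e2 by (subst integrable_cong_AE[where g="\<lambda>x. (e x)\<^sup>2"]) auto
    qed
    then have "integrable (distr M M T) (\<lambda>x. (p x)\<^sup>2)" by (subst integrable_distr_eq) auto
    then show "sq_integrable M p" by (simp add: distr_T sq_integrable_def)
    fix \<phi> assume \<phi>: "sq_integrable M \<phi>"
    then have [measurable]: "\<phi> \<in> borel_measurable M" by (simp add: sq_integrable_def)
    have "(\<integral>x. p x * \<phi> x \<partial>M) = (\<integral>x. p (T x) * \<phi> (T x) \<partial>M)"
      by (rule integral_T[symmetric]) simp
    also have "\<dots> = (\<integral>x. \<phi> (T x) * e x \<partial>M)"
      by (intro integral_cong_AE) (use ae in auto)
    also have "\<dots> = (\<integral>x. \<phi> (T x) * f x \<partial>M)" unfolding e_def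
    proof (rule F.real_cond_exp_intg(2))
      show "integrable M (\<lambda>x. \<phi> (T x) * f x)"
        using integrable_mult_sq_integrable[OF sq_integrable_T[OF \<phi>] f] .
      have "T \<in> measurable F M" unfolding F_def by (rule measurable_vimage_algebra1[OF TX])
      then show "(\<lambda>x. \<phi> (T x)) \<in> borel_measurable F" by measurable
    qed simp
    finally show "(\<integral>x. p x * \<phi> x \<partial>M) = (\<integral>x. f x * \<phi> (T x) \<partial>M)" by (simp add: mult.commute)
  qed
  have bd: "AE x in M. \<bar>e x\<bar> \<le> K" if K: "\<And>x. x \<in> space M \<Longrightarrow> \<bar>f x\<bar> \<le> K" for K
  proof -
    have "AE x in M. e x \<le> K" unfolding e_def
      by (rule F.real_cond_exp_le_c[OF fi]) (use K in \<open>force intro!: AE_I2\<close>)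
    moreover have "AE x in M. e x \<ge> - K" unfolding e_def
      by (rule F.real_cond_exp_ge_c[OF fi]) (use K in \<open>force intro!: AE_I2\<close>)
    ultimately show ?thesis by eventually_elim linarith
  qed
  show ?thesis using g tr bd by (intro exI[of _ e] exI[of _ g]) auto
qed

lemma transfer_exists:
  assumes "sq_integrable M f" obtains p where "is_transfer f p"
proof -
  obtain e g where g: "g \<in> borel_measurable M" "\<forall>x\<in>space M. e x = g (T x)"
    "\<forall>p\<in>borel_measurable M. (AE x in M. p (T x) = e x) \<longrightarrow> is_transfer f p"
    using transfer_aux[OF assms] by (elim exE conjE)
  then have "is_transfer f g" using AE_space by auto
  then show thesis by (rule that)
qed

lemma transfer_exists_bounded:
  assumes "f \<in> borel_measurable M" "\<And>x. x \<in> space M \<Longrightarrow> \<bar>f x\<bar> \<le> K"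
  obtains p where "is_transfer f p" "\<And>x. \<bar>p x\<bar> \<le> K"
proof -
  have f: "sq_integrable M f" using assms by (rule sq_integrable_bounded)
  have K0: "K \<ge> 0" using assms(2) not_empty by fastforce
  obtain e g where g: "g \<in> borel_measurable M" "\<forall>x\<in>space M. e x = g (T x)"
    and tr: "\<forall>p\<in>borel_measurable M. (AE x in M. p (T x) = e x) \<longrightarrow> is_transfer f p"
    and b: "\<forall>K. (\<forall>x\<in>space M. \<bar>f x\<bar> \<le> K) \<longrightarrow> (AE x in M. \<bar>e x\<bar> \<le> K)"
    using transfer_aux[OF f] by (elim exE conjE)
  note [measurable] = g(1)
  \<comment> \<open>The bound passes to \<open>e\<close>, hence to \<open>g\<close>, only almost
    everywhere; clipping \<open>g\<close> makes it hold at every point.\<close>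
  define p where "p x = max (-K) (min K (g x))" for x
  have "AE x in M. \<bar>e x\<bar> \<le> K" using b assms(2) by blast
  then have "AE x in M. p (T x) = e x"
    using AE_space by eventually_elim (auto simp: p_def g(2))
  moreover have "p \<in> borel_measurable M" unfolding p_def by measurable
  ultimately have "is_transfer f p" using tr by blast
  moreover have "\<bar>p x\<bar> \<le> K" for x using K0 by (auto simp: p_def)
  ultimately show thesis by (rule that)
qed

text \<open>The adjoint relation is tested against \<open>p\<close> itself; composition with
  \<open>T\<close> preserves the norm.\<close>

lemma transfer_norm_le:
  assumes f: "sq_integrable M f" and p: "is_transfer f p"
  shows "l2norm M p \<le> l2norm M f"
proof (rule le_of_power2_le_mult)
  have sp: "sq_integrable M p" using p by (simp add: is_transfer_def)
  have "(l2norm M p)\<^sup>2 = (\<integral>x. f x * p (T x) \<partial>M)"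
    using p sp by (simp only: is_transfer_def l2norm_power2) (simp add: power2_eq_square)
  also have "\<dots> \<le> l2norm M f * l2norm M (\<lambda>x. p (T x))"
    using Cauchy_Schwarz_l2[OF f sq_integrable_T[OF sp]] by linarith
  finally show "(l2norm M p)\<^sup>2 \<le> l2norm M f * l2norm M p"
    using sp by (simp add: l2norm_T sq_integrable_def)
qed simp

lemma transfer_diff:
  assumes f: "sq_integrable M f" "sq_integrable M f'" and p: "is_transfer f p" "is_transfer f' p'"
  shows "is_transfer (\<lambda>x. f x - f' x) (\<lambda>x. p x - p' x)"
  unfolding is_transfer_def
proof (intro conjI allI impI)
  have sp: "sq_integrable M p" "sq_integrable M p'" using p by (auto simp: is_transfer_def)
  then show "sq_integrable M (\<lambda>x. p x - p' x)" by (rule sq_integrable_diff)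
  fix \<phi> assume \<phi>: "sq_integrable M \<phi>"
  then show "(\<integral>x. (p x - p' x) * \<phi> x \<partial>M) = (\<integral>x. (f x - f' x) * \<phi> (T x) \<partial>M)"
    using f sp p sq_integrable_T[OF \<phi>]
    by (simp add: left_diff_distrib integrable_mult_sq_integrable is_transfer_def)
qed

lemma transfer_sum:
  assumes "\<And>i. i \<in> I \<Longrightarrow> sq_integrable M (f i)" "\<And>i. i \<in> I \<Longrightarrow> is_transfer (f i) (p i)"
  shows "is_transfer (\<lambda>x. \<Sum>i\<in>I. f i x) (\<lambda>x. \<Sum>i\<in>I. p i x)"
  unfolding is_transfer_def
proof (intro conjI allI impI)
  have sp: "\<And>i. i \<in> I \<Longrightarrow> sq_integrable M (p i)" using assms(2) by (auto simp: is_transfer_def)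
  then show "sq_integrable M (\<lambda>x. \<Sum>i\<in>I. p i x)" by (rule sq_integrable_sum)
  fix \<phi> assume \<phi>: "sq_integrable M \<phi>"
  show "(\<integral>x. (\<Sum>i\<in>I. p i x) * \<phi> x \<partial>M) = (\<integral>x. (\<Sum>i\<in>I. f i x) * \<phi> (T x) \<partial>M)"
    unfolding sum_distrib_right
    using assms sp \<phi> sq_integrable_T[OF \<phi>]
    by (simp add: Bochner_Integration.integral_sum integrable_mult_sq_integrable is_transfer_def)
qed

end

subsection \<open>Birkhoff sums and martingale approximation\<close>

context measure_preserving begin

definition birkhoff :: "('a \<Rightarrow> real) \<Rightarrow> nat \<Rightarrow> 'a \<Rightarrow> real" where
  "birkhoff f n x = (\<Sum>j<n. f ((T ^^ j) x))"

definition correlation :: "('a \<Rightarrow> real) \<Rightarrow> nat \<Rightarrow> real" where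
  "correlation f k = (\<integral>x. f x * f ((T ^^ k) x) \<partial>M)"

text \<open>Orthogonality to every function of \<open>T x\<close> says that \<open>h\<close> has
  conditional expectation zero given the sigma-algebra pulled back along \<open>T\<close>. Hence the
  compositions of \<open>h\<close> with the powers of \<open>T\<close> are martingale differences in
  reversed time.\<close>

definition is_mart_diff :: "('a \<Rightarrow> real) \<Rightarrow> bool" where
  "is_mart_diff h \<longleftrightarrow> sq_integrable M h \<and>
     (\<forall>\<phi>. sq_integrable M \<phi> \<longrightarrow> (\<integral>x. h x * \<phi> (T x) \<partial>M) = 0)"

lemma birkhoff_Suc: "birkhoff f (Suc n) x = f x + birkhoff f n (T x)"
  unfolding birkhoff_def sum.lessThan_Suc_shift by (simp add: funpow_swap1)

lemma sq_integrable_birkhoff: "sq_integrable M f \<Longrightarrow> sq_integrable M (birkhoff f n)"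
  unfolding birkhoff_def by (intro sq_integrable_sum sq_integrable_Tn)

lemma birkhoff_diff: "birkhoff (\<lambda>x. f x - g x) n x = birkhoff f n x - birkhoff g n x"
  by (simp add: birkhoff_def sum_subtractf)

lemma correlation_0: "correlation f 0 = (\<integral>x. (f x)\<^sup>2 \<partial>M)"
  by (simp add: correlation_def power2_eq_square)

text \<open>Peeling off the first term, \<open>f x + birkhoff f n (T x)\<close>, leaves by
  invariance the second moment for \<open>n\<close> terms and a cross term made of the correlations
  at lags 1 to \<open>n\<close>. Written as a sum over \<open>m\<close>, the right-hand side becomes
  a Cesaro mean once divided by \<open>n\<close>.\<close>

lemma birkhoff_second_moment:
  assumes f: "sq_integrable M f"
  shows "(l2norm M (birkhoff f n))\<^sup>2
    = (\<Sum>m<n. (\<integral>x. (f x)\<^sup>2 \<partial>M) + 2 * (\<Sum>k<m. correlation f (Suc k)))"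
proof (induction n)
  case 0
  then show ?case by (simp add: birkhoff_def l2norm_def)
next
  case (Suc n)
  note B = sq_integrable_birkhoff[OF f, of n]
  note BT = sq_integrable_T[OF B]
  have "integrable M (\<lambda>x. f x * f ((T ^^ Suc k) x))" for k
    by (rule integrable_mult_sq_integrable[OF f sq_integrable_Tn[OF f]])
  then have cross: "(\<integral>x. f x * birkhoff f n (T x) \<partial>M) = (\<Sum>k<n. correlation f (Suc k))"
    by (simp add: birkhoff_def sum_distrib_left correlation_def funpow_swap1
        Bochner_Integration.integral_sum)
  have "(l2norm M (birkhoff f (Suc n)))\<^sup>2
     = (\<integral>x. (f x)\<^sup>2 + (birkhoff f n (T x))\<^sup>2 + 2 * (f x * birkhoff f n (T x)) \<partial>M)"
    unfolding l2norm_power2 by (simp add: birkhoff_Suc power2_sum mult.assoc)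
  also have "\<dots> = (\<integral>x. (f x)\<^sup>2 \<partial>M) + (\<integral>x. (birkhoff f n (T x))\<^sup>2 \<partial>M)
      + 2 * (\<integral>x. f x * birkhoff f n (T x) \<partial>M)"
    using f BT integrable_mult_sq_integrable[OF f BT] by (simp add: sq_integrable_def)
  also have "(\<integral>x. (birkhoff f n (T x))\<^sup>2 \<partial>M) = (l2norm M (birkhoff f n))\<^sup>2"
    unfolding l2norm_power2
    using B by (intro integral_T borel_measurable_power) (simp add: sq_integrable_def)
  finally show ?case using Suc cross by simp
qed

lemma birkhoff_second_moment_limit:
  assumes f: "sq_integrable M f" and s: "summable (correlation f)"
  shows "(\<lambda>n. (l2norm M (birkhoff f n))\<^sup>2 / real n)
    \<longlonglongrightarrow> - (\<integral>x. (f x)\<^sup>2 \<partial>M) + 2 * (\<Sum>n. correlation f n)"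
  unfolding birkhoff_second_moment[OF f]
proof (rule Cesaro_mean)
  have "(\<lambda>m. (\<Sum>k<Suc m. correlation f k)) \<longlonglongrightarrow> (\<Sum>n. correlation f n)"
    using summable_LIMSEQ[OF s] by (rule LIMSEQ_Suc)
  \<comment> \<open>Doubling the whole series counts lag zero twice; subtracting the integral of
    \<open>(f x)\<^sup>2\<close> corrects this.\<close>
  then have "(\<lambda>m. - (\<integral>x. (f x)\<^sup>2 \<partial>M) + 2 * (\<Sum>k<Suc m. correlation f k))
      \<longlonglongrightarrow> - (\<integral>x. (f x)\<^sup>2 \<partial>M) + 2 * (\<Sum>n. correlation f n)"
    by (intro tendsto_intros)
  then show "(\<lambda>m. (\<integral>x. (f x)\<^sup>2 \<partial>M) + 2 * (\<Sum>k<m. correlation f (Suc k)))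
      \<longlonglongrightarrow> - (\<integral>x. (f x)\<^sup>2 \<partial>M) + 2 * (\<Sum>n. correlation f n)"
    unfolding sum.lessThan_Suc_shift correlation_0 by (simp add: algebra_simps)
qed

text \<open>Each inner sum of the second moment formula is at most twice the majorant series. So the
  Birkhoff sums grow like the square root of \<open>n\<close> at most, with a factor that is small
  when the majorant is.\<close>

lemma birkhoff_l2norm_le:
  assumes f: "sq_integrable M f" and a: "\<And>k. \<bar>correlation f k\<bar> \<le> a k" "summable a"
  shows "l2norm M (birkhoff f n) \<le> sqrt (real n * (2 * suminf a))"
proof (rule real_le_rsqrt)
  have a0: "a k \<ge> 0" for k using a(1)[of k] by linarith
  have "(\<integral>x. (f x)\<^sup>2 \<partial>M) + 2 * (\<Sum>k<m. correlation f (Suc k)) \<le> 2 * suminf a" for m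
  proof -
    have c0: "correlation f 0 \<ge> 0" by (simp add: correlation_0)
    have "correlation f 0 + 2 * (\<Sum>k<m. correlation f (Suc k)) \<le> 2 * (\<Sum>k<Suc m. correlation f k)"
      unfolding sum.lessThan_Suc_shift using c0 by simp
    also have "\<dots> \<le> 2 * (\<Sum>k<Suc m. a k)"
      using a(1) by (intro mult_left_mono sum_mono) (auto simp: abs_le_iff)
    also have "\<dots> \<le> 2 * suminf a"
      using a0 by (intro mult_left_mono sum_le_suminf a(2)) auto
    finally show ?thesis by (simp add: correlation_0)
  qed
  then have "(\<Sum>m<n. (\<integral>x. (f x)\<^sup>2 \<partial>M) + 2 * (\<Sum>k<m. correlation f (Suc k)))
      \<le> (\<Sum>m<n. 2 * suminf a)" by (intro sum_mono)
  then show "(l2norm M (birkhoff f n))\<^sup>2 \<le> real n * (2 * suminf a)"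
    unfolding birkhoff_second_moment[OF f] by simp
qed

lemma mart_diff_diff:
  assumes "is_mart_diff h" "is_mart_diff h'"
  shows "is_mart_diff (\<lambda>x. h x - h' x)"
  using assms sq_integrable_T
  by (auto simp: is_mart_diff_def sq_integrable_diff left_diff_distrib integrable_mult_sq_integrable)

text \<open>The correlations at positive lags vanish, so the summands are orthogonal and Pythagoras
  applies.\<close>

lemma mart_diff_birkhoff:
  assumes "is_mart_diff h"
  shows "l2norm M (birkhoff h n) = sqrt (real n) * l2norm M h"
proof -
  have h: "sq_integrable M h" using assms by (simp add: is_mart_diff_def)
  have c0: "correlation h (Suc k) = 0" for k
  proof -
    have "(\<integral>x. h x * (\<lambda>x. h ((T ^^ k) x)) (T x) \<partial>M) = 0"
      using assms sq_integrable_Tn[OF h, of k] unfolding is_mart_diff_def by blast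
    then show ?thesis by (simp add: correlation_def funpow_swap1)
  qed
  have "(l2norm M (birkhoff h n))\<^sup>2 = real n * (l2norm M h)\<^sup>2"
    unfolding birkhoff_second_moment[OF h] c0 l2norm_power2[of M h] by simp
  then have "sqrt ((l2norm M (birkhoff h n))\<^sup>2) = sqrt (real n * (l2norm M h)\<^sup>2)" by simp
  then show ?thesis by (simp add: real_sqrt_mult)
qed

text \<open>\<open>q\<close> composed with \<open>T\<close> is the orthogonal projection of
  \<open>g\<close> on the functions of \<open>T x\<close>, so the difference is orthogonal to
  them.\<close>

lemma transfer_mart_diff:
  assumes g: "sq_integrable M g" and q: "is_transfer g q"
  shows "is_mart_diff (\<lambda>x. g x - q (T x))"
  unfolding is_mart_diff_def
proof (intro conjI allI impI)
  have sq: "sq_integrable M q" using q by (simp add: is_transfer_def)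
  show "sq_integrable M (\<lambda>x. g x - q (T x))" by (intro sq_integrable_diff g sq_integrable_T sq)
  fix \<phi> assume \<phi>: "sq_integrable M \<phi>"
  have [measurable]: "q \<in> borel_measurable M" "\<phi> \<in> borel_measurable M"
    using sq \<phi> by (auto simp: sq_integrable_def)
  have "(\<integral>x. (g x - q (T x)) * \<phi> (T x) \<partial>M)
      = (\<integral>x. g x * \<phi> (T x) \<partial>M) - (\<integral>x. q (T x) * \<phi> (T x) \<partial>M)"
    using integrable_mult_sq_integrable[OF g sq_integrable_T[OF \<phi>]]
      integrable_mult_sq_integrable[OF sq_integrable_T[OF sq] sq_integrable_T[OF \<phi>]]
    by (simp add: left_diff_distrib)
  also have "(\<integral>x. q (T x) * \<phi> (T x) \<partial>M) = (\<integral>x. q x * \<phi> x \<partial>M)"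
    by (rule integral_T) simp
  also have "(\<integral>x. g x * \<phi> (T x) \<partial>M) = (\<integral>x. q x * \<phi> x \<partial>M)"
    using q \<phi> by (simp add: is_transfer_def)
  finally show "(\<integral>x. (g x - q (T x)) * \<phi> (T x) \<partial>M) = 0" by simp
qed

end

lemma sq_integrable_truncate:
  assumes g: "sq_integrable M g" and "e > 0"
  shows "\<exists>K g'. g' \<in> borel_measurable M \<and> (\<forall>x. \<bar>g' x\<bar> \<le> K) \<and> l2norm M (\<lambda>x. g x - g' x) < e"
proof -
  define t where "t n x = max (- real n) (min (real n) (g x))" for n x
  have [measurable]: "g \<in> borel_measurable M" using g by (simp add: sq_integrable_def)
  have [measurable]: "t n \<in> borel_measurable M" for n unfolding t_def by measurable
  have "(\<lambda>n. \<integral>x. (g x - t n x)\<^sup>2 \<partial>M) \<longlonglongrightarrow> (\<integral>x. 0 \<partial>M)"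
  proof (rule integral_dominated_convergence)
    show "integrable M (\<lambda>x. (g x)\<^sup>2)" using g by (simp add: sq_integrable_def)
    show "AE x in M. (\<lambda>n. (g x - t n x)\<^sup>2) \<longlonglongrightarrow> 0"
    proof (rule AE_I2)
      fix x
      obtain N :: nat where N: "real N \<ge> \<bar>g x\<bar>" using real_arch_simple by blast
      have "\<forall>\<^sub>F n in sequentially. (g x - t n x)\<^sup>2 = 0"
        using eventually_ge_at_top[of N]
      proof eventually_elim
        case (elim n)
        then have "- real n \<le> g x" "g x \<le> real n" using N by linarith+
        then show ?case by (simp add: t_def)
      qed
      then show "(\<lambda>n. (g x - t n x)\<^sup>2) \<longlonglongrightarrow> 0" by (rule tendsto_eventually)
    qed
    fix n
    have "\<bar>g x - t n x\<bar> \<le> \<bar>g x\<bar>" for x by (auto simp: t_def max_def min_def)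
    then show "AE x in M. norm ((g x - t n x)\<^sup>2) \<le> (g x)\<^sup>2"
      by (intro AE_I2) (simp add: abs_le_square_iff)
  qed auto
  then have "(\<lambda>n. sqrt (\<integral>x. (g x - t n x)\<^sup>2 \<partial>M)) \<longlonglongrightarrow> sqrt 0" by (intro tendsto_real_sqrt) simp
  then have "\<forall>\<^sub>F n in sequentially. sqrt (\<integral>x. (g x - t n x)\<^sup>2 \<partial>M) < e"
    using \<open>e > 0\<close> by (intro order_tendstoD) auto
  then obtain n where "l2norm M (\<lambda>x. g x - t n x) < e"
    unfolding l2norm_def by (auto simp: eventually_sequentially)
  moreover have "\<bar>t n x\<bar> \<le> real n" for x by (auto simp: t_def)
  ultimately show ?thesis by (intro exI[of _ "real n"] exI[of _ "t n"]) auto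
qed

context measure_preserving begin

lemma transfer_iterates_exist:
  assumes f: "sq_integrable M f"
  obtains p where "p 0 = f" "\<And>k. sq_integrable M (p k)" "\<And>k. is_transfer (p k) (p (Suc k))"
proof -
  define p where "p = rec_nat f (\<lambda>_ g. SOME q. is_transfer g q)"
  have Suc: "p (Suc k) = (SOME q. is_transfer (p k) q)" for k by (simp add: p_def)
  have tr: "is_transfer (p k) (p (Suc k))" if pk: "sq_integrable M (p k)" for k
  proof -
    obtain q where "is_transfer (p k) q" by (rule transfer_exists[OF pk])
    then show ?thesis unfolding Suc by (rule someI[of "is_transfer (p k)"])
  qed
  have sq: "sq_integrable M (p k)" for k
  proof (induction k)
    case 0 show ?case using f by (simp add: p_def)
  next
    case (Suc k) then show ?case using tr[of k] by (simp add: is_transfer_def)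
  qed
  show thesis by (rule that[of p]) (use sq tr in \<open>auto simp: p_def\<close>)
qed

text \<open>The adjoint relation, iterated. An arbitrary starting index \<open>N\<close> is allowed
  in order to rewrite the correlations of \<open>p N\<close> itself, not only those of
  \<open>f\<close>.\<close>

lemma transfer_iterates_pairing:
  assumes p: "\<And>k. is_transfer (p k) (p (Suc k))" and \<phi>: "sq_integrable M \<phi>"
  shows "(\<integral>x. p (N + k) x * \<phi> x \<partial>M) = (\<integral>x. p N x * \<phi> ((T ^^ k) x) \<partial>M)"
  using \<phi>
proof (induction k arbitrary: \<phi>)
  case (Suc k)
  have "(\<integral>x. p (N + Suc k) x * \<phi> x \<partial>M) = (\<integral>x. p (N + k) x * \<phi> (T x) \<partial>M)"
    using p[of "N + k"] Suc.prems by (simp add: is_transfer_def)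
  also have "\<dots> = (\<integral>x. p N x * \<phi> (T ((T ^^ k) x)) \<partial>M)"
    using Suc.IH[OF sq_integrable_T[OF Suc.prems]] .
  finally show ?case by simp
qed simp

text \<open>Gordin's decomposition: with \<open>p k\<close> the iterates of \<open>f\<close> under the transfer operator,
  \<open>g = p 0 + \<dots> + p (N - 1)\<close> and \<open>q = p 1 + \<dots> + p N\<close>, one has
  \<open>f = (g - q \<circ> T) + (q \<circ> T - q) + p N\<close>; the first summand is a reverse martingale difference,
  the second a coboundary, the third contributes little to the variance. Truncating \<open>g\<close>
  makes the martingale difference bounded.\<close>

lemma martingale_approximation:
  assumes f: "sq_integrable M f" and w: "summable w"
    and bound: "\<And>n \<phi>. sq_integrable M \<phi> \<Longrightarrow> \<bar>\<integral>x. f x * \<phi> ((T ^^ n) x) \<partial>M\<bar> \<le> w n * l2norm M \<phi>"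
    and w0: "\<And>n. 0 \<le> w n" and "e > 0"
  shows "\<exists>h K C. is_mart_diff h \<and> (\<forall>x\<in>space M. \<bar>h x\<bar> \<le> K) \<and>
     (\<forall>n. l2norm M (\<lambda>x. birkhoff f n x - birkhoff h n x) \<le> C + e * sqrt (real n))"
proof -
  obtain p where p0: "p 0 = f" and sp: "\<And>k. sq_integrable M (p k)"
    and tr: "\<And>k. is_transfer (p k) (p (Suc k))"
    using transfer_iterates_exist[OF f] by metis
  note pairing = transfer_iterates_pairing[of p, OF tr sp]
  \<comment> \<open>Duality: testing the \<open>k\<close>-th iterate against itself turns
    \<open>bound\<close> into a norm estimate.\<close>
  have pw: "l2norm M (p k) \<le> w k" for k
  proof (rule le_of_power2_le_mult)
    have "(l2norm M (p k))\<^sup>2 = (\<integral>x. p (0 + k) x * p k x \<partial>M)"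
      unfolding l2norm_power2 by (simp add: power2_eq_square)
    also have "\<dots> = (\<integral>x. f x * p k ((T ^^ k) x) \<partial>M)"
      using pairing[of 0 k k] by (simp only: p0)
    also have "\<dots> \<le> w k * l2norm M (p k)" using bound[OF sp, of k k] by linarith
    finally show "(l2norm M (p k))\<^sup>2 \<le> w k * l2norm M (p k)" .
  qed (rule w0)
  define W where "W = suminf w"
  have W0: "W \<ge> 0" unfolding W_def by (rule suminf_nonneg[OF w w0])
  \<comment> \<open>The second moments of the Birkhoff sums of \<open>p N\<close> will be at most
    \<open>n * (2 * (w N * W))\<close>; \<open>N\<close> is chosen so that they account for only
    half of \<open>e\<close>.\<close>
  have "(\<lambda>N. 2 * (w N * W)) \<longlonglongrightarrow> 2 * (0 * W)"
    by (intro tendsto_intros summable_LIMSEQ_zero[OF w])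
  from order_tendstoD(2)[OF this, of "(e / 2)\<^sup>2"] \<open>e > 0\<close>
  have "\<forall>\<^sub>F N in sequentially. 2 * (w N * W) < (e / 2)\<^sup>2" by simp
  then obtain N where N: "2 * (w N * W) < (e / 2)\<^sup>2" by (auto simp: eventually_sequentially)
  have pN: "l2norm M (birkhoff (p N) n) \<le> sqrt (real n) * (e / 2)" for n
  proof -
    \<comment> \<open>By the pairing identity the correlation at lag \<open>k\<close> is the
      integral of \<open>f\<close> against \<open>p N\<close> composed with the
      \<open>(N + k)\<close>-th iterate of \<open>T\<close>. This gives a factor
      \<open>w (N + k)\<close>, summable in \<open>k\<close>, and the norm of \<open>p N\<close>
      gives the small factor \<open>w N\<close>.\<close>
    have cor: "\<bar>correlation (p N) k\<bar> \<le> w (k + N) * w N" for k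
    proof -
      have "correlation (p N) k = (\<integral>x. p (0 + (N + k)) x * p N x \<partial>M)"
        unfolding correlation_def add_0 using pairing[of N k N] by simp
      also have "\<dots> = (\<integral>x. f x * p N ((T ^^ (N + k)) x) \<partial>M)"
        using pairing[of 0 "N + k" N] by (simp only: p0)
      finally have "\<bar>correlation (p N) k\<bar> \<le> w (N + k) * l2norm M (p N)" using bound[OF sp] by simp
      also have "\<dots> \<le> w (N + k) * w N" by (intro mult_left_mono pw w0)
      finally show ?thesis by (simp add: add.commute)
    qed
    have sN: "summable (\<lambda>k. w (k + N))" using w by (rule summable_ignore_initial_segment)
    have "(\<Sum>k. w (k + N)) \<le> W"
    proof -
      have "W = (\<Sum>k. w (k + N)) + sum w {..<N}"
        unfolding W_def by (rule suminf_split_initial_segment[OF w])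
      then show ?thesis using sum_nonneg[of "{..<N}" w] w0 by simp
    qed
    then have "(\<Sum>k. w (k + N) * w N) \<le> W * w N"
      using w0 by (simp add: suminf_mult2[OF sN, symmetric] mult_right_mono)
    then have "real n * (2 * (\<Sum>k. w (k + N) * w N)) \<le> real n * (e / 2)\<^sup>2"
      using N by (intro mult_left_mono) (auto simp: mult.commute)
    moreover have "l2norm M (birkhoff (p N) n) \<le> sqrt (real n * (2 * (\<Sum>k. w (k + N) * w N)))"
      by (rule birkhoff_l2norm_le[OF sp cor summable_mult2[OF sN]])
    ultimately have "l2norm M (birkhoff (p N) n) \<le> sqrt (real n * (e / 2)\<^sup>2)"
      using real_sqrt_le_mono order_trans by blast
    then show ?thesis using \<open>e > 0\<close> by (simp add: real_sqrt_mult)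
  qed
  define g where "g x = (\<Sum>k<N. p k x)" for x
  define q where "q x = (\<Sum>k<N. p (Suc k) x)" for x
  have sg: "sq_integrable M g" unfolding g_def by (intro sq_integrable_sum sp)
  have sq: "sq_integrable M q" unfolding q_def by (intro sq_integrable_sum sp)
  have gq: "is_transfer g q" unfolding g_def q_def by (intro transfer_sum sp tr)
  have "q x = g x + p N x - f x" for x
  proof -
    have "(\<Sum>k<N. p (Suc k) x - p k x) = p N x - p 0 x" by (rule sum_lessThan_telescope)
    then show ?thesis by (simp add: g_def q_def sum_subtractf p0)
  qed
  then have fdec: "f x = (g x - q (T x)) + (q (T x) - q x) + p N x" for x by simp
  define h where "h x = g x - q (T x)" for x
  have mh: "is_mart_diff h" unfolding h_def by (rule transfer_mart_diff[OF sg gq])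
  \<comment> \<open>The transfer operator is a contraction, so truncating \<open>g\<close> within
    \<open>e / 4\<close> changes the martingale difference by at most \<open>e / 2\<close>.\<close>
  have "0 < e / 4" using \<open>e > 0\<close> by simp
  from sq_integrable_truncate[OF sg this]
  obtain K g' where g': "g' \<in> borel_measurable M" "\<And>x. \<bar>g' x\<bar> \<le> K"
    "l2norm M (\<lambda>x. g x - g' x) < e / 4"
    by blast
  have sg': "sq_integrable M g'" using g' by (intro sq_integrable_bounded) auto
  obtain q' where q': "is_transfer g' q'" "\<And>x. \<bar>q' x\<bar> \<le> K"
    using transfer_exists_bounded[of g' K] g' by metis
  have sq': "sq_integrable M q'" using q' by (simp add: is_transfer_def)
  define h' where "h' x = g' x - q' (T x)" for x
  have mh': "is_mart_diff h'" unfolding h'_def by (rule transfer_mart_diff[OF sg' q'(1)])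
  have sh: "sq_integrable M h" "sq_integrable M h'" using mh mh' by (auto simp: is_mart_diff_def)
  have "l2norm M (\<lambda>x. h x - h' x) \<le> e / 2"
  proof -
    have "l2norm M (\<lambda>x. h x - h' x) = l2norm M (\<lambda>x. (g x - g' x) - (q (T x) - q' (T x)))"
      by (simp add: h_def h'_def algebra_simps)
    also have "\<dots> \<le> l2norm M (\<lambda>x. g x - g' x) + l2norm M (\<lambda>x. q (T x) - q' (T x))"
      by (intro l2norm_diff_le sq_integrable_diff sg sg' sq_integrable_T sq sq')
    also have "l2norm M (\<lambda>x. q (T x) - q' (T x)) = l2norm M (\<lambda>x. q x - q' x)"
      using sq_integrable_diff[OF sq sq'] l2norm_T[of "\<lambda>x. q x - q' x"] by (simp add: sq_integrable_def)
    also have "\<dots> \<le> l2norm M (\<lambda>x. g x - g' x)"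
      by (intro transfer_norm_le transfer_diff sq_integrable_diff sg sg' gq q')
    finally show ?thesis using g'(3) by linarith
  qed
  then have hh: "l2norm M (\<lambda>x. birkhoff h n x - birkhoff h' n x) \<le> sqrt (real n) * (e / 2)" for n
    using mult_left_mono[of _ "e / 2" "sqrt (real n)"] mart_diff_birkhoff[OF mart_diff_diff[OF mh mh'], of n]
    by (simp only: birkhoff_diff[abs_def] real_sqrt_ge_0_iff of_nat_0_le_iff)
  \<comment> \<open>The coboundary telescopes, so its norm is at most \<open>2 * l2norm M q\<close>
    for every \<open>n\<close>; this is the constant \<open>C\<close> of the claim.\<close>
  have "l2norm M (\<lambda>x. birkhoff f n x - birkhoff h' n x) \<le> 2 * l2norm M q + e * sqrt (real n)" for n
  proof -
    have "birkhoff f n x = birkhoff h n x + (q ((T ^^ n) x) - q x) + birkhoff (p N) n x" for x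
    proof -
      have tel: "(\<Sum>j<n. q ((T ^^ Suc j) x) - q ((T ^^ j) x)) = q ((T ^^ n) x) - q x"
        using sum_lessThan_telescope[of "\<lambda>j. q ((T ^^ j) x)" n] by simp
      have "birkhoff f n x = (\<Sum>j<n. h ((T ^^ j) x) + (q ((T ^^ Suc j) x) - q ((T ^^ j) x)) + p N ((T ^^ j) x))"
        unfolding birkhoff_def by (intro sum.cong refl, subst fdec) (simp add: h_def)
      then show ?thesis by (simp only: sum.distrib tel birkhoff_def)
    qed
    then have "l2norm M (\<lambda>x. birkhoff f n x - birkhoff h' n x)
       = l2norm M (\<lambda>x. ((birkhoff h n x - birkhoff h' n x) + (q ((T ^^ n) x) - q x)) + birkhoff (p N) n x)"
      by (intro arg_cong[where f="l2norm M"] ext) simp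
    also have "\<dots> \<le> (l2norm M (\<lambda>x. birkhoff h n x - birkhoff h' n x)
        + l2norm M (\<lambda>x. q ((T ^^ n) x) - q x)) + l2norm M (birkhoff (p N) n)"
      using sh sq sp
      by (intro order_trans[OF l2norm_triangle] add_right_mono l2norm_triangle
          sq_integrable_add sq_integrable_diff sq_integrable_birkhoff sq_integrable_Tn)
    also have "l2norm M (\<lambda>x. q ((T ^^ n) x) - q x) \<le> 2 * l2norm M q"
      using l2norm_diff_le[OF sq_integrable_Tn[OF sq, of n] sq] l2norm_Tn[OF sq_integrable_measurable[OF sq], of n]
      by linarith
    finally show ?thesis using hh[of n] pN[of n] by (simp add: algebra_simps)
  qed
  moreover have "\<bar>h' x\<bar> \<le> 2 * K" for x
    using g'(2)[of x] q'(2)[of "T x"] unfolding h'_def by linarith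
  ultimately show ?thesis using mh' by blast
qed

end

subsection \<open>The central limit theorem for bounded martingale differences\<close>

lemma abs_exp_minus_diff_le:
  fixes a b :: real
  assumes "0 \<le> a" "0 \<le> b"
  shows "\<bar>exp (- a) - exp (- b)\<bar> \<le> \<bar>a - b\<bar>"
proof -
  have *: "exp (- a) - exp (- b) \<le> b - a" if "0 \<le> a" "a \<le> b" for a b :: real
  proof -
    have "exp (- a) - exp (- b) = exp (- a) * (1 - exp (a - b))"
      by (simp add: right_diff_distrib flip: exp_add)
    also have "\<dots> \<le> 1 * (b - a)"
    proof (rule mult_mono)
      show "1 - exp (a - b) \<le> b - a" using exp_ge_add_one_self[of "a - b"] by linarith
    qed (use that in auto)
    finally show ?thesis by simp
  qed
  show ?thesis
  proof (cases "a \<le> b")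
    case True
    then have "exp (- b) \<le> exp (- a)" by simp
    then show ?thesis using *[OF assms(1) True] True by linarith
  next
    case False
    then have "exp (- a) \<le> exp (- b)" by simp
    then show ?thesis using *[OF assms(2), of a] False by linarith
  qed
qed

text \<open>The upper bound comes from \<open>(1 - y + y\<^sup>2 / 2) * (1 + y + y\<^sup>2 / 2) = 1
  + y ^ 4 / 4 \<ge> 1\<close>, where the second factor is at most \<open>exp y\<close>.\<close>

lemma abs_exp_minus_quadratic:
  fixes y :: real
  assumes "0 \<le> y"
  shows "\<bar>exp (- y) - (1 - y)\<bar> \<le> y\<^sup>2 / 2"
proof -
  have lo: "exp (- y) \<ge> 1 - y" using exp_ge_add_one_self[of "- y"] by simp
  have pos: "0 < 1 + y + y\<^sup>2 / 2" using assms by (simp add: add_pos_nonneg)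
  have "exp (- y) * (1 + y + y\<^sup>2 / 2) \<le> exp (- y) * exp y"
    by (intro mult_left_mono exp_lower_Taylor_quadratic assms) simp
  also have "\<dots> = 1" by (simp flip: exp_add)
  also have "\<dots> \<le> 1 + y ^ 4 / 4" by simp
  also have "\<dots> = (1 - y + y\<^sup>2 / 2) * (1 + y + y\<^sup>2 / 2)"
    by (simp add: field_simps power2_eq_square power4_eq_xxxx)
  finally have "exp (- y) \<le> 1 - y + y\<^sup>2 / 2" using pos by (simp only: mult_le_cancel_right_pos)
  then show ?thesis using lo by simp
qed

lemma norm_one_plus_ii_le: "norm (1 + \<i> * complex_of_real x) \<le> exp (x\<^sup>2 / 2)"
proof (rule power2_le_imp_le)
  have "(norm (1 + \<i> * complex_of_real x))\<^sup>2 = 1 + x\<^sup>2" by (simp add: cmod_power2)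
  also have "\<dots> \<le> exp (x\<^sup>2)" by (rule exp_ge_add_one_self)
  also have "\<dots> = (exp (x\<^sup>2 / 2))\<^sup>2" by (simp add: power2_eq_square flip: exp_add)
  finally show "(norm (1 + \<i> * complex_of_real x))\<^sup>2 \<le> (exp (x\<^sup>2 / 2))\<^sup>2" .
qed simp

text \<open>The exponential compensates the growth of \<open>1 + i x\<close>. Factors of norm at
  most one are what \<open>norm_prod_diff\<close> needs in order to bound the difference of two
  products by the sum of the differences of the factors.\<close>

lemma norm_McLeish_factor_le: "norm ((1 + \<i> * complex_of_real x) * complex_of_real (exp (- x\<^sup>2 / 2))) \<le> 1"
proof -
  have "norm ((1 + \<i> * complex_of_real x) * complex_of_real (exp (- x\<^sup>2 / 2)))
      \<le> exp (x\<^sup>2 / 2) * exp (- x\<^sup>2 / 2)"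
    unfolding norm_mult by (intro mult_mono norm_one_plus_ii_le) auto
  also have "\<dots> = 1" by (simp flip: exp_add)
  finally show ?thesis .
qed

text \<open>The two functions agree to second order. For \<open>\<bar>x\<bar> \<le> 1\<close> the
  three cubic error terms have coefficients 1/6, 1/2 and 1/4; for larger \<open>x\<close> each
  function has norm at most one.\<close>

lemma iexp_McLeish_approx:
  "norm (iexp x - (1 + \<i> * complex_of_real x) * complex_of_real (exp (- x\<^sup>2 / 2))) \<le> 2 * \<bar>x\<bar> ^ 3"
proof (cases "\<bar>x\<bar> \<le> 1")
  case True
  define r where "r = iexp x - (1 + \<i> * complex_of_real x - complex_of_real (x\<^sup>2 / 2))"
  define \<rho> where "\<rho> = exp (- x\<^sup>2 / 2) - (1 - x\<^sup>2 / 2)"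
  have "norm r \<le> \<bar>x\<bar> ^ 3 / 6"
    using iexp_approx1[of x 2]
    by (simp add: r_def numeral_2_eq_2 numeral_3_eq_3 power_mult_distrib fact_numeral algebra_simps)
  moreover have "\<bar>\<rho>\<bar> \<le> \<bar>x\<bar> ^ 3 / 8"
  proof -
    have "\<bar>\<rho>\<bar> \<le> (x\<^sup>2 / 2)\<^sup>2 / 2"
      unfolding \<rho>_def using abs_exp_minus_quadratic[of "x\<^sup>2 / 2"] by simp
    also have "\<dots> = \<bar>x\<bar> ^ 4 / 8" by (simp add: power_divide flip: power_mult)
    also have "\<dots> \<le> \<bar>x\<bar> ^ 3 / 8" using True by (intro divide_right_mono power_decreasing) auto
    finally show ?thesis .
  qed
  moreover have "norm (1 + \<i> * complex_of_real x) \<le> 2"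
    using norm_triangle_ineq[of 1 "\<i> * complex_of_real x"] True by (simp add: norm_mult)
  moreover have "iexp x - (1 + \<i> * complex_of_real x) * complex_of_real (exp (- x\<^sup>2 / 2))
     = r + \<i> * complex_of_real (x ^ 3 / 2) - (1 + \<i> * complex_of_real x) * complex_of_real \<rho>"
    by (simp add: r_def \<rho>_def algebra_simps power2_eq_square power3_eq_cube)
  ultimately show ?thesis
  proof -
    assume a: "norm r \<le> \<bar>x\<bar> ^ 3 / 6" "\<bar>\<rho>\<bar> \<le> \<bar>x\<bar> ^ 3 / 8" "norm (1 + \<i> * complex_of_real x) \<le> 2"
      "iexp x - (1 + \<i> * complex_of_real x) * complex_of_real (exp (- x\<^sup>2 / 2))
     = r + \<i> * complex_of_real (x ^ 3 / 2) - (1 + \<i> * complex_of_real x) * complex_of_real \<rho>"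
    have "norm (iexp x - (1 + \<i> * complex_of_real x) * complex_of_real (exp (- x\<^sup>2 / 2)))
       \<le> norm r + norm (\<i> * complex_of_real (x ^ 3 / 2)) + norm ((1 + \<i> * complex_of_real x) * complex_of_real \<rho>)"
      unfolding a(4) by (rule order_trans[OF norm_triangle_ineq4 add_right_mono[OF norm_triangle_ineq]])
    also have "norm (\<i> * complex_of_real (x ^ 3 / 2)) = \<bar>x\<bar> ^ 3 / 2"
      unfolding norm_mult norm_of_real by (simp add: power_abs)
    also have "norm ((1 + \<i> * complex_of_real x) * complex_of_real \<rho>) \<le> 2 * (\<bar>x\<bar> ^ 3 / 8)"
      unfolding norm_mult norm_of_real using a by (intro mult_mono) auto
    moreover have "0 \<le> \<bar>x\<bar> ^ 3" by simp
    ultimately show ?thesis using a(1) by linarith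
  qed
next
  case False
  have "norm (iexp x - (1 + \<i> * complex_of_real x) * complex_of_real (exp (- x\<^sup>2 / 2))) \<le> 1 + 1"
    by (rule order_trans[OF norm_triangle_ineq4 add_mono[OF _ norm_McLeish_factor_le]]) simp
  moreover have "1 \<le> \<bar>x\<bar> ^ 3" using False by (intro one_le_power) simp
  ultimately show ?thesis by linarith
qed

context measure_preserving begin

text \<open>The mean ergodic theorem for a single function: the squared norm of its averages is at
  most a term of order \<open>1 / n\<close> plus a Cesaro mean of absolute correlations.\<close>

lemma mean_square_ergodic:
  assumes w: "sq_integrable M w" and c: "correlation w \<longlonglongrightarrow> 0"
  shows "(\<lambda>n. l2norm M (birkhoff w n) / real n) \<longlonglongrightarrow> 0"
proof -
  define c0 where "c0 = (\<integral>x. (w x)\<^sup>2 \<partial>M)"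
  define b where "b n = (\<Sum>k<n. \<bar>correlation w (Suc k)\<bar>)" for n
  have le: "(l2norm M (birkhoff w n) / real n)\<^sup>2 \<le> c0 / real n + 2 * (b n / real n)" for n
  proof (cases "n = 0")
    case False
    have "c0 + 2 * (\<Sum>k<m. correlation w (Suc k)) \<le> c0 + 2 * b n" if "m < n" for m
    proof -
      have "(\<Sum>k<m. correlation w (Suc k)) \<le> (\<Sum>k<m. \<bar>correlation w (Suc k)\<bar>)"
        by (intro sum_mono) simp
      also have "\<dots> \<le> b n" unfolding b_def using that by (intro sum_mono2) auto
      finally show ?thesis by simp
    qed
    then have "(l2norm M (birkhoff w n))\<^sup>2 \<le> (\<Sum>m<n. c0 + 2 * b n)"
      unfolding birkhoff_second_moment[OF w] c0_def by (intro sum_mono) simp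
    then have "(l2norm M (birkhoff w n))\<^sup>2 \<le> real n * (c0 + 2 * b n)" by simp
    then show ?thesis using False by (simp add: power_divide field_simps power2_eq_square)
  qed simp
  have "(\<lambda>n. b n / real n) \<longlonglongrightarrow> 0"
    unfolding b_def by (intro Cesaro_mean tendsto_rabs_zero LIMSEQ_Suc[OF c])
  then have "(\<lambda>n. c0 / real n + 2 * (b n / real n)) \<longlonglongrightarrow> 0 + 2 * 0"
    by (intro tendsto_intros lim_const_over_n)
  then have lim: "(\<lambda>n. c0 / real n + 2 * (b n / real n)) \<longlonglongrightarrow> 0" by simp
  have "(\<lambda>n. (l2norm M (birkhoff w n) / real n)\<^sup>2) \<longlonglongrightarrow> 0"
    by (rule Lim_null_comparison[OF _ lim]) (use le in \<open>auto simp: always_eventually\<close>)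
  then have "(\<lambda>n. sqrt ((l2norm M (birkhoff w n) / real n)\<^sup>2)) \<longlonglongrightarrow> sqrt 0"
    by (rule tendsto_real_sqrt)
  then show ?thesis by simp
qed

definition McLeish_prod :: "('a \<Rightarrow> real) \<Rightarrow> real \<Rightarrow> nat \<Rightarrow> 'a \<Rightarrow> complex" where
  "McLeish_prod h s n x = (\<Prod>j<n. 1 + \<i> * complex_of_real (s * h ((T ^^ j) x)))"

lemma McLeish_prod_Suc:
  "McLeish_prod h s (Suc n) x = (1 + \<i> * complex_of_real (s * h x)) * McLeish_prod h s n (T x)"
  unfolding McLeish_prod_def prod.lessThan_Suc_shift by (simp add: funpow_swap1)

lemma McLeish_prod_measurable [measurable]:
  assumes [measurable]: "h \<in> borel_measurable M"
  shows "McLeish_prod h s n \<in> borel_measurable M"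
  unfolding McLeish_prod_def by measurable

text \<open>For \<open>s = t / sqrt n\<close> the bound is
  \<open>exp (t\<^sup>2 * K\<^sup>2 / 2)\<close>, independent of \<open>n\<close>: here the
  boundedness of \<open>h\<close> pays off.\<close>

lemma norm_McLeish_prod_le:
  assumes K: "\<And>x. x \<in> space M \<Longrightarrow> \<bar>h x\<bar> \<le> K" and x: "x \<in> space M"
  shows "norm (McLeish_prod h s n x) \<le> exp (real n * s\<^sup>2 * K\<^sup>2 / 2)"
proof -
  have "norm (McLeish_prod h s n x) = (\<Prod>j<n. norm (1 + \<i> * complex_of_real (s * h ((T ^^ j) x))))"
    by (simp add: McLeish_prod_def prod_norm)
  also have "\<dots> \<le> (\<Prod>j<n. exp (s\<^sup>2 * K\<^sup>2 / 2))"
  proof (intro prod_mono conjI)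
    fix j
    have "(s * h ((T ^^ j) x))\<^sup>2 \<le> s\<^sup>2 * K\<^sup>2"
      using K[OF Tn_space[OF x, of j]] unfolding power_mult_distrib
      by (intro mult_left_mono) (auto simp: abs_le_square_iff[symmetric])
    then show "norm (1 + \<i> * complex_of_real (s * h ((T ^^ j) x))) \<le> exp (s\<^sup>2 * K\<^sup>2 / 2)"
      by (intro order_trans[OF norm_one_plus_ii_le]) simp
  qed simp
  also have "\<dots> = exp (real n * (s\<^sup>2 * K\<^sup>2 / 2))"
    using exp_of_nat_mult[of n "s\<^sup>2 * K\<^sup>2 / 2"] by simp
  finally show ?thesis by (simp add: mult.assoc)
qed

lemma integrable_McLeish_prod:
  assumes "h \<in> borel_measurable M" "\<And>x. x \<in> space M \<Longrightarrow> \<bar>h x\<bar> \<le> K"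
  shows "integrable M (McLeish_prod h s n)"
  using assms norm_McLeish_prod_le[of h K]
  by (intro integrable_const_bound[of _ "exp (real n * s\<^sup>2 * K\<^sup>2 / 2)"] AE_I2) auto

text \<open>The martingale property is stated for real test functions, whereas the McLeish products
  are complex; real and imaginary parts are treated separately.\<close>

lemma mart_diff_complex:
  fixes \<phi> :: "'a \<Rightarrow> complex"
  assumes h: "is_mart_diff h" and [measurable]: "\<phi> \<in> borel_measurable M"
    and b: "\<And>x. x \<in> space M \<Longrightarrow> norm (\<phi> x) \<le> B"
  shows "integrable M (\<lambda>x. complex_of_real (h x) * \<phi> (T x))"
    "(\<integral>x. complex_of_real (h x) * \<phi> (T x) \<partial>M) = 0"
proof -
  have sh: "sq_integrable M h" using h by (simp add: is_mart_diff_def)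
  have [measurable]: "h \<in> borel_measurable M" using sh by (simp add: sq_integrable_def)
  show i: "integrable M (\<lambda>x. complex_of_real (h x) * \<phi> (T x))"
  proof (rule Bochner_Integration.integrable_bound)
    show "integrable M (\<lambda>x. B * h x)" using sq_integrable_imp_integrable[OF sh] by simp
    show "AE x in M. norm (complex_of_real (h x) * \<phi> (T x)) \<le> norm (B * h x)"
    proof (rule AE_I2)
      fix x assume "x \<in> space M"
      then have "norm (\<phi> (T x)) \<le> \<bar>B\<bar>" using b[of "T x"] Tn_space[of x 1] by fastforce
      then show "norm (complex_of_real (h x) * \<phi> (T x)) \<le> norm (B * h x)"
        by (simp add: norm_mult abs_mult mult.commute[of "\<bar>B\<bar>"] mult_left_mono)
    qed
  qed measurable
  have "sq_integrable M (\<lambda>x. Re (\<phi> x))"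
    by (rule sq_integrable_bounded[where K=B]) (auto intro: order_trans[OF abs_Re_le_cmod b])
  moreover have "sq_integrable M (\<lambda>x. Im (\<phi> x))"
    by (rule sq_integrable_bounded[where K=B]) (auto intro: order_trans[OF abs_Im_le_cmod b])
  ultimately have "(\<integral>x. h x * Re (\<phi> (T x)) \<partial>M) = 0" "(\<integral>x. h x * Im (\<phi> (T x)) \<partial>M) = 0"
    using h by (auto simp: is_mart_diff_def)
  then show "(\<integral>x. complex_of_real (h x) * \<phi> (T x) \<partial>M) = 0"
    using integral_Re[OF i] integral_Im[OF i] by (intro complex_eqI) simp_all
qed

text \<open>As time is reversed, it is the first factor that is split off: the other factors form a
  function of \<open>T x\<close>, to which \<open>h\<close> is orthogonal, so the first factor may
  be replaced by 1.\<close>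

lemma integral_McLeish_prod:
  assumes h: "is_mart_diff h" and K: "\<And>x. x \<in> space M \<Longrightarrow> \<bar>h x\<bar> \<le> K"
  shows "(\<integral>x. McLeish_prod h s n x \<partial>M) = 1"
proof (induction n)
  case 0
  then show ?case by (simp add: McLeish_prod_def prob_space)
next
  case (Suc n)
  have [measurable]: "h \<in> borel_measurable M" using h by (simp add: is_mart_diff_def sq_integrable_def)
  have md: "integrable M (\<lambda>x. complex_of_real (h x) * McLeish_prod h s n (T x))"
      "(\<integral>x. complex_of_real (h x) * McLeish_prod h s n (T x) \<partial>M) = 0"
    by (rule mart_diff_complex[OF h McLeish_prod_measurable norm_McLeish_prod_le[OF K]]; simp)+
  have i: "integrable M (McLeish_prod h s n)" using K by (intro integrable_McLeish_prod) auto
  have "(\<integral>x. McLeish_prod h s (Suc n) x \<partial>M)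
     = (\<integral>x. McLeish_prod h s n (T x) + \<i> * s * (complex_of_real (h x) * McLeish_prod h s n (T x)) \<partial>M)"
    unfolding McLeish_prod_Suc by (simp add: algebra_simps)
  also have "\<dots> = (\<integral>x. McLeish_prod h s n (T x) \<partial>M)
      + \<i> * s * (\<integral>x. complex_of_real (h x) * McLeish_prod h s n (T x) \<partial>M)"
    using integrable_Tn[OF i, of 1] md(1) by simp
  also have "\<dots> = (\<integral>x. McLeish_prod h s n x \<partial>M)"
    using md(2) integral_T[of "McLeish_prod h s n"] by simp
  finally show ?case using Suc by simp
qed

text \<open>McLeish's argument: \<open>exp (i x)\<close> is close to \<open>(1 + i x) exp (- x\<^sup>2 / 2)\<close>; the product of the
  factors \<open>1 + i x\<close> has mean one by the martingale property, and the product of the Gaussian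
  factors converges to a constant by the ergodic theorem for \<open>h\<^sup>2\<close>.\<close>

lemma mart_diff_clt:
  assumes h: "is_mart_diff h" and K: "\<And>x. x \<in> space M \<Longrightarrow> \<bar>h x\<bar> \<le> K"
    and mix: "correlation (\<lambda>x. (h x)\<^sup>2 - (l2norm M h)\<^sup>2) \<longlonglongrightarrow> 0"
  shows "(\<lambda>n. \<integral>x. iexp (t * (birkhoff h n x / sqrt (real n))) \<partial>M)
     \<longlonglongrightarrow> complex_of_real (exp (- t\<^sup>2 * (l2norm M h)\<^sup>2 / 2))"
proof -
  define s2 where "s2 = (l2norm M h)\<^sup>2"
  define w where "w x = (h x)\<^sup>2 - s2" for x
  define E where "E = exp (- t\<^sup>2 * s2 / 2)"
  \<comment> \<open>\<open>C\<close> is the uniform bound on the McLeish product times the factor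
    \<open>t\<^sup>2 / 2\<close> by which the exponents differ from Birkhoff averages;
    \<open>D / sqrt n\<close> will be the sum of \<open>n\<close> cubic errors
    \<open>2 * (\<bar>s\<bar> * K) ^ 3\<close> with \<open>s = t / sqrt n\<close>.\<close>
  define C where "C = exp (t\<^sup>2 * K\<^sup>2 / 2) * (t\<^sup>2 / 2)"
  define D where "D = 2 * (\<bar>t\<bar> ^ 3 * K ^ 3)"
  have [measurable]: "h \<in> borel_measurable M" using h by (simp add: is_mart_diff_def sq_integrable_def)
  have K0: "K \<ge> 0" using K not_empty by fastforce
  have s20: "s2 \<ge> 0" by (simp add: s2_def)
  have C0: "C \<ge> 0" by (simp add: C_def)
  have [measurable]: "w \<in> borel_measurable M" unfolding w_def by measurable
  have sw: "sq_integrable M w"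
  proof (rule sq_integrable_bounded)
    fix x assume "x \<in> space M"
    then have "\<bar>h x\<bar> \<le> K" by (rule K)
    then have "(h x)\<^sup>2 \<le> K\<^sup>2" using K0 by (simp add: abs_le_square_iff[symmetric])
    moreover have "0 \<le> (h x)\<^sup>2" by simp
    ultimately show "\<bar>w x\<bar> \<le> K\<^sup>2 + s2" using s20 unfolding w_def by linarith
  qed measurable
  have [measurable]: "birkhoff w n \<in> borel_measurable M" "birkhoff h n \<in> borel_measurable M" for n
    unfolding birkhoff_def by measurable
  have erg: "(\<lambda>n. l2norm M (birkhoff w n) / real n) \<longlonglongrightarrow> 0"
    using mix by (intro mean_square_ergodic[OF sw]) (simp add: w_def[abs_def] s2_def)
  have main: "norm ((\<integral>x. iexp (t * (birkhoff h n x / sqrt (real n))) \<partial>M) - complex_of_real E)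
      \<le> D / sqrt (real n) + C * (l2norm M (birkhoff w n) / real n)" if n: "n \<ge> 1" for n
  proof -
    define s where "s = t / sqrt (real n)"
    define X where "X = McLeish_prod h s n"
    have ns: "real n * s\<^sup>2 = t\<^sup>2" using n by (simp add: s_def power_divide)
    have [measurable]: "X \<in> borel_measurable M" unfolding X_def by measurable
    have iX: "integrable M X" unfolding X_def by (rule integrable_McLeish_prod[OF _ K]) simp
    have EX: "(\<integral>x. X x \<partial>M) = 1" unfolding X_def by (rule integral_McLeish_prod[OF h K])
    \<comment> \<open>Two replacements: each \<open>iexp (y j)\<close> by its McLeish factor, at the
      cost \<open>D / sqrt n\<close>, then the random factor \<open>exp (- Q)\<close> by the
      constant \<open>E\<close>, at a cost proportional to the Birkhoff average of the centred
      square \<open>w\<close>.\<close>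
    have pt: "norm (iexp (t * (birkhoff h n x / sqrt (real n))) - X x * complex_of_real E)
        \<le> D / sqrt (real n) + C * (\<bar>birkhoff w n x\<bar> / real n)" if x: "x \<in> space M" for x
    proof -
      define y where "y j = s * h ((T ^^ j) x)" for j
      define Q where "Q = (\<Sum>j<n. (y j)\<^sup>2 / 2)"
      have yK: "\<bar>y j\<bar> \<le> \<bar>s\<bar> * K" for j
        unfolding y_def abs_mult by (intro mult_left_mono K Tn_space x) simp
      have Q0: "Q \<ge> 0" unfolding Q_def by (intro sum_nonneg) simp
      have "t * (birkhoff h n x / sqrt (real n)) = (\<Sum>j<n. y j)"
        by (simp add: birkhoff_def y_def s_def sum_distrib_left sum_divide_distrib)
      then have e1: "iexp (t * (birkhoff h n x / sqrt (real n))) = (\<Prod>j<n. iexp (y j))"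
        by (simp add: sum_distrib_left exp_sum)
      have e2: "X x * complex_of_real (exp (- Q))
          = (\<Prod>j<n. (1 + \<i> * complex_of_real (y j)) * complex_of_real (exp (- (y j)\<^sup>2 / 2)))"
        by (simp add: X_def McLeish_prod_def y_def Q_def prod.distrib exp_sum flip: sum_negf of_real_prod)
      have "norm (iexp (t * (birkhoff h n x / sqrt (real n))) - X x * complex_of_real (exp (- Q)))
         \<le> (\<Sum>j<n. norm (iexp (y j) - (1 + \<i> * complex_of_real (y j)) * complex_of_real (exp (- (y j)\<^sup>2 / 2))))"
        unfolding e1 e2 using norm_McLeish_factor_le by (intro norm_prod_diff) auto
      also have "\<dots> \<le> (\<Sum>j<n. 2 * (\<bar>s\<bar> * K) ^ 3)"
        using yK by (intro sum_mono order_trans[OF iexp_McLeish_approx] mult_left_mono power_mono) auto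
      also have "\<dots> = D / sqrt (real n)"
      proof -
        have "real n * \<bar>s\<bar> ^ 3 = (real n * s\<^sup>2) * \<bar>s\<bar>" by (simp add: power3_eq_cube power2_eq_square)
        also have "\<dots> = \<bar>t\<bar> ^ 3 / sqrt (real n)"
          unfolding ns by (simp add: s_def abs_divide power3_eq_cube power2_eq_square)
        finally have "2 * K ^ 3 * (real n * \<bar>s\<bar> ^ 3) = D / sqrt (real n)" by (simp add: D_def)
        then show ?thesis by (simp add: power_mult_distrib mult_ac)
      qed
      finally have b1: "norm (iexp (t * (birkhoff h n x / sqrt (real n))) - X x * complex_of_real (exp (- Q)))
         \<le> D / sqrt (real n)" .
      have "norm (X x * complex_of_real (exp (- Q)) - X x * complex_of_real E)
          = norm (X x) * \<bar>exp (- Q) - E\<bar>"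
        by (simp flip: right_diff_distrib of_real_diff add: norm_mult)
      also have "\<dots> \<le> exp (t\<^sup>2 * K\<^sup>2 / 2) * \<bar>Q - t\<^sup>2 * s2 / 2\<bar>"
      proof (rule mult_mono)
        show "norm (X x) \<le> exp (t\<^sup>2 * K\<^sup>2 / 2)"
          using norm_McLeish_prod_le[of h K x s n] K x by (simp add: X_def ns)
        show "\<bar>exp (- Q) - E\<bar> \<le> \<bar>Q - t\<^sup>2 * s2 / 2\<bar>"
          using abs_exp_minus_diff_le[OF Q0, of "t\<^sup>2 * s2 / 2"] s20 by (simp add: E_def)
      qed auto
      also have "Q - t\<^sup>2 * s2 / 2 = (t\<^sup>2 / 2) * (birkhoff w n x / real n)"
      proof -
        have s2n: "s\<^sup>2 = t\<^sup>2 / real n" using ns n by (simp add: field_simps)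
        have Q: "Q = t\<^sup>2 / real n / 2 * (\<Sum>j<n. (h ((T ^^ j) x))\<^sup>2)"
          by (simp add: Q_def y_def power_mult_distrib sum_distrib_left sum_divide_distrib flip: s2n)
        have B: "birkhoff w n x = (\<Sum>j<n. (h ((T ^^ j) x))\<^sup>2) - real n * s2"
          by (simp add: birkhoff_def w_def sum_subtractf)
        show ?thesis unfolding Q B using n by (simp add: field_simps)
      qed
      also have "exp (t\<^sup>2 * K\<^sup>2 / 2) * \<bar>(t\<^sup>2 / 2) * (birkhoff w n x / real n)\<bar>
          = C * (\<bar>birkhoff w n x\<bar> / real n)"
        by (simp add: C_def abs_mult)
      finally show ?thesis
        using b1 norm_triangle_ineq[of "iexp (t * (birkhoff h n x / sqrt (real n))) - X x * complex_of_real (exp (- Q))"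
            "X x * complex_of_real (exp (- Q)) - X x * complex_of_real E"] by simp
    qed
    have ie: "integrable M (\<lambda>x. iexp (t * (birkhoff h n x / sqrt (real n))))"
      by (intro integrable_iexp) measurable
    have sb: "sq_integrable M (birkhoff w n)" by (rule sq_integrable_birkhoff[OF sw])
    \<comment> \<open>As \<open>X\<close> has mean one, \<open>E\<close> is the integral of
      \<open>X * E\<close>.\<close>
    have "(\<integral>x. iexp (t * (birkhoff h n x / sqrt (real n))) \<partial>M) - complex_of_real E
        = (\<integral>x. iexp (t * (birkhoff h n x / sqrt (real n))) - X x * complex_of_real E \<partial>M)"
      using ie iX EX by simp
    also have "norm \<dots> \<le> (\<integral>x. norm (iexp (t * (birkhoff h n x / sqrt (real n))) - X x * complex_of_real E) \<partial>M)"
      by (rule integral_norm_bound)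
    also have "\<dots> \<le> (\<integral>x. D / sqrt (real n) + C * (\<bar>birkhoff w n x\<bar> / real n) \<partial>M)"
      using ie iX sq_integrable_imp_integrable[OF sb] pt
      by (intro integral_mono integrable_norm) auto
    also have "\<dots> = D / sqrt (real n) + C * ((\<integral>x. \<bar>birkhoff w n x\<bar> \<partial>M) / real n)"
      using sq_integrable_imp_integrable[OF sb] by (simp add: prob_space)
    also have "\<dots> \<le> D / sqrt (real n) + C * (l2norm M (birkhoff w n) / real n)"
      using C0 by (intro add_left_mono mult_left_mono divide_right_mono integral_abs_le_l2norm sb) auto
    finally show ?thesis .
  qed
  have "(\<lambda>n. D / sqrt (real n)) \<longlonglongrightarrow> 0"
    by (intro tendsto_divide_0[OF tendsto_const] filterlim_at_top_imp_at_infinity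
        filterlim_compose[OF sqrt_at_top] filterlim_real_sequentially)
  then have lim: "(\<lambda>n. D / sqrt (real n) + C * (l2norm M (birkhoff w n) / real n)) \<longlonglongrightarrow> 0"
    using tendsto_add[OF _ tendsto_mult_left[OF erg, of C]] by fastforce
  have "(\<lambda>n. (\<integral>x. iexp (t * (birkhoff h n x / sqrt (real n))) \<partial>M) - complex_of_real E) \<longlonglongrightarrow> 0"
    by (rule Lim_null_comparison[OF _ lim]) (use main in \<open>auto simp: eventually_sequentially\<close>)
  then show ?thesis unfolding E_def s2_def by (rule LIM_zero_cancel)
qed

end

subsection \<open>Passing to the limit in the martingale approximation\<close>

lemma norm_iexp_diff_le: "norm (iexp a - iexp b) \<le> \<bar>a - b\<bar>"
proof -
  have "iexp a - iexp b = iexp b * (iexp (a - b) - 1)"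
    by (simp add: right_diff_distrib of_real_diff flip: exp_add)
  then have "norm (iexp a - iexp b) = norm (iexp (a - b) - 1)" by (simp add: norm_mult)
  also have "\<dots> \<le> \<bar>a - b\<bar>" using iexp_approx1[of "a - b" 0] by simp
  finally show ?thesis .
qed

context measure_preserving begin

text \<open>\<open>iexp\<close> is 1-Lipschitz, and on a probability space the
  \<open>L\<^sup>1\<close> norm is at most the \<open>L\<^sup>2\<close> norm.\<close>

lemma norm_integral_iexp_diff_le:
  assumes f: "sq_integrable M f" and g: "sq_integrable M g"
  shows "norm ((\<integral>x. iexp (f x) \<partial>M) - (\<integral>x. iexp (g x) \<partial>M)) \<le> l2norm M (\<lambda>x. f x - g x)"
proof -
  have [measurable]: "f \<in> borel_measurable M" "g \<in> borel_measurable M"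
    using f g by (auto simp: sq_integrable_def)
  have i: "integrable M (\<lambda>x. iexp (f x))" "integrable M (\<lambda>x. iexp (g x))"
    by (auto intro: integrable_iexp)
  note d = sq_integrable_diff[OF f g]
  have "norm ((\<integral>x. iexp (f x) \<partial>M) - (\<integral>x. iexp (g x) \<partial>M)) = norm (\<integral>x. iexp (f x) - iexp (g x) \<partial>M)"
    using i by simp
  also have "\<dots> \<le> (\<integral>x. norm (iexp (f x) - iexp (g x)) \<partial>M)" by (rule integral_norm_bound)
  also have "\<dots> \<le> (\<integral>x. \<bar>f x - g x\<bar> \<partial>M)"
    using i sq_integrable_imp_integrable[OF d] norm_iexp_diff_le
    by (intro integral_mono) auto
  also have "\<dots> \<le> l2norm M (\<lambda>x. f x - g x)" by (rule integral_abs_le_l2norm[OF d])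
  finally show ?thesis .
qed

lemma summable_correlation:
  assumes f: "sq_integrable M f" and w: "summable w"
    and bound: "\<And>n \<phi>. sq_integrable M \<phi> \<Longrightarrow> \<bar>\<integral>x. f x * \<phi> ((T ^^ n) x) \<partial>M\<bar> \<le> w n * l2norm M \<phi>"
  shows "summable (correlation f)"
proof (rule summable_comparison_test)
  show "summable (\<lambda>n. w n * l2norm M f)" using w by (rule summable_mult2)
  show "\<exists>N. \<forall>n\<ge>N. norm (correlation f n) \<le> w n * l2norm M f"
    using bound[OF f] by (auto simp: correlation_def)
qed

text \<open>The expression is a limit of normalised second moments.\<close>

lemma birkhoff_variance_nonneg:
  assumes f: "sq_integrable M f" and s: "summable (correlation f)"
  shows "0 \<le> - (\<integral>x. (f x)\<^sup>2 \<partial>M) + 2 * (\<Sum>n. correlation f n)"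
  by (rule tendsto_lowerbound[OF birkhoff_second_moment_limit[OF f s]]) auto

lemma mult_sqrt_div_sqrt_le: "c * sqrt (real n) / sqrt (real n) \<le> \<bar>c\<bar>"
  by (cases "n = 0") auto

text \<open>The martingale differences \<open>h m\<close> approximate \<open>f\<close> with
  asymptotic error \<open>1 / (m + 1)\<close>. The normalised martingale sums have the same norm for
  every \<open>n \<ge> 1\<close>, while those of \<open>f\<close> have norms tending to
  \<open>sqrt s2\<close>; so the norms of the \<open>h m\<close> tend to \<open>sqrt s2\<close>, and
  the limits in \<open>n\<close> and \<open>m\<close> may be combined.\<close>

lemma birkhoff_characteristic_limit:
  assumes f: "sq_integrable M f" and w: "summable w"
    and bound: "\<And>n \<phi>. sq_integrable M \<phi> \<Longrightarrow> \<bar>\<integral>x. f x * \<phi> ((T ^^ n) x) \<partial>M\<bar> \<le> w n * l2norm M \<phi>"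
    and w0: "\<And>n. 0 \<le> w n"
    and mix: "\<And>u K. u \<in> borel_measurable M \<Longrightarrow> \<forall>x\<in>space M. \<bar>u x\<bar> \<le> K
        \<Longrightarrow> (\<integral>x. u x \<partial>M) = 0 \<Longrightarrow> correlation u \<longlonglongrightarrow> 0"
    and s2: "s2 = - (\<integral>x. (f x)\<^sup>2 \<partial>M) + 2 * (\<Sum>n. correlation f n)"
  shows "(\<lambda>n. \<integral>x. iexp (t * (birkhoff f n x / sqrt (real n))) \<partial>M)
     \<longlonglongrightarrow> complex_of_real (exp (- t\<^sup>2 * s2 / 2))"
proof -
  have sc: "summable (correlation f)" by (rule summable_correlation[OF f w bound])
  have s20: "s2 \<ge> 0" unfolding s2 by (rule birkhoff_variance_nonneg[OF f sc])
  have nf: "(\<lambda>n. l2norm M (birkhoff f n) / sqrt (real n)) \<longlonglongrightarrow> sqrt s2"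
    using tendsto_real_sqrt[OF birkhoff_second_moment_limit[OF f sc]]
    by (simp add: s2 real_sqrt_divide)
  have "\<exists>h K C. is_mart_diff h \<and> (\<forall>x\<in>space M. \<bar>h x\<bar> \<le> K) \<and>
     (\<forall>n. l2norm M (\<lambda>x. birkhoff f n x - birkhoff h n x) \<le> C + (1 / real (Suc m)) * sqrt (real n))" for m
    by (rule martingale_approximation[OF f w bound w0]) auto
  then obtain h K C where h: "\<And>m. is_mart_diff (h m)" and K: "\<And>m x. x \<in> space M \<Longrightarrow> \<bar>h m x\<bar> \<le> K m"
    and approx: "\<And>m n. l2norm M (\<lambda>x. birkhoff f n x - birkhoff (h m) n x) \<le> C m + (1 / real (Suc m)) * sqrt (real n)"
    by metis
  have sh: "sq_integrable M (h m)" for m using h by (simp add: is_mart_diff_def)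
  have nearby: "l2norm M (\<lambda>x. birkhoff f n x - birkhoff (h m) n x) / sqrt (real n)
      \<le> C m / sqrt (real n) + 1 / real (Suc m)" for m n
    using divide_right_mono[OF approx[of n m], of "sqrt (real n)"] mult_sqrt_div_sqrt_le[of "1 / real (Suc m)" n]
    by (simp add: add_divide_distrib)
  have C_lim: "(\<lambda>n. C m / sqrt (real n)) \<longlonglongrightarrow> 0" for m
    by (intro tendsto_divide_0[OF tendsto_const] filterlim_at_top_imp_at_infinity
        filterlim_compose[OF sqrt_at_top] filterlim_real_sequentially)
  have close: "\<bar>sqrt s2 - l2norm M (h m)\<bar> \<le> 1 / real (Suc m)" for m
  proof (rule tendsto_le[OF sequentially_bot])
    show "(\<lambda>n. C m / sqrt (real n) + 1 / real (Suc m)) \<longlonglongrightarrow> 1 / real (Suc m)"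
      using tendsto_add[OF C_lim tendsto_const] by fastforce
    show "(\<lambda>n. \<bar>l2norm M (birkhoff f n) / sqrt (real n) - l2norm M (h m)\<bar>) \<longlonglongrightarrow> \<bar>sqrt s2 - l2norm M (h m)\<bar>"
      by (intro tendsto_intros nf)
    have "\<bar>l2norm M (birkhoff f n) / sqrt (real n) - l2norm M (h m)\<bar> \<le> C m / sqrt (real n) + 1 / real (Suc m)"
      if n: "n \<ge> 1" for n
    proof -
      have "l2norm M (birkhoff f n) / sqrt (real n) - l2norm M (h m)
         = (l2norm M (birkhoff f n) - l2norm M (birkhoff (h m) n)) / sqrt (real n)"
        using n by (simp add: mart_diff_birkhoff[OF h] field_simps)
      then have "\<bar>l2norm M (birkhoff f n) / sqrt (real n) - l2norm M (h m)\<bar>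
         \<le> l2norm M (\<lambda>x. birkhoff f n x - birkhoff (h m) n x) / sqrt (real n)"
        using l2norm_diff_triangle[OF sq_integrable_birkhoff[OF f] sq_integrable_birkhoff[OF sh], of n m n]
        by (simp add: abs_divide divide_right_mono)
      then show ?thesis by (rule order_trans[OF _ nearby])
    qed
    then show "\<forall>\<^sub>F n in sequentially. \<bar>l2norm M (birkhoff f n) / sqrt (real n) - l2norm M (h m)\<bar>
        \<le> C m / sqrt (real n) + 1 / real (Suc m)"
      by (auto simp: eventually_sequentially)
  qed
  have inv0: "(\<lambda>m. 1 / real (Suc m)) \<longlonglongrightarrow> 0"
    using LIMSEQ_inverse_real_of_nat by (simp add: inverse_eq_divide)
  have "(\<lambda>m. l2norm M (h m) - sqrt s2) \<longlonglongrightarrow> 0"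
    by (rule Lim_null_comparison[OF _ inv0]) (use close in \<open>auto simp: abs_minus_commute\<close>)
  then have "(\<lambda>m. l2norm M (h m)) \<longlonglongrightarrow> sqrt s2" by (rule LIM_zero_cancel)
  then have "(\<lambda>m. exp (- t\<^sup>2 * (l2norm M (h m))\<^sup>2 / 2)) \<longlonglongrightarrow> exp (- t\<^sup>2 * (sqrt s2)\<^sup>2 / 2)"
    by (intro tendsto_intros) auto
  then have e_lim: "(\<lambda>m. exp (- t\<^sup>2 * (l2norm M (h m))\<^sup>2 / 2)) \<longlonglongrightarrow> exp (- t\<^sup>2 * s2 / 2)"
    using s20 by simp
  show ?thesis
  proof (rule LIMSEQ_I)
    \<comment> \<open>Four errors of size \<open>r / 4\<close>: the change of variance, the parts
      \<open>1 / (m + 1)\<close> and \<open>C m / sqrt n\<close> of the approximation error, and the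
      central limit theorem for \<open>h m\<close>. First \<open>m\<close> is fixed, then
      \<open>n\<close> is taken large.\<close>
    fix r :: real assume r: "r > 0"
    have "\<forall>\<^sub>F m in sequentially. \<bar>exp (- t\<^sup>2 * (l2norm M (h m))\<^sup>2 / 2) - exp (- t\<^sup>2 * s2 / 2)\<bar> < r / 4"
      using tendstoD[OF e_lim, of "r/4"] r by (simp add: dist_real_def)
    moreover have "\<forall>\<^sub>F m in sequentially. \<bar>t\<bar> * (1 / real (Suc m)) < r / 4"
      using order_tendstoD(2)[OF tendsto_mult_left[OF inv0, of "\<bar>t\<bar>"], of "r/4"] r by simp
    ultimately have "\<forall>\<^sub>F m in sequentially. \<bar>exp (- t\<^sup>2 * (l2norm M (h m))\<^sup>2 / 2) - exp (- t\<^sup>2 * s2 / 2)\<bar> < r / 4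
        \<and> \<bar>t\<bar> * (1 / real (Suc m)) < r / 4" by (rule eventually_conj)
    then obtain m where m1: "\<bar>exp (- t\<^sup>2 * (l2norm M (h m))\<^sup>2 / 2) - exp (- t\<^sup>2 * s2 / 2)\<bar> < r / 4"
      and m2: "\<bar>t\<bar> * (1 / real (Suc m)) < r / 4" by (auto simp: eventually_sequentially)
    \<comment> \<open>The centred square of \<open>h m\<close> is bounded because \<open>h m\<close>
      is, so \<open>mix\<close> applies to it.\<close>
    define u where "u x = (h m x)\<^sup>2 - (l2norm M (h m))\<^sup>2" for x
    have [measurable]: "h m \<in> borel_measurable M" using sh by (simp add: sq_integrable_def)
    have "correlation u \<longlonglongrightarrow> 0"
    proof (rule mix)
      show "u \<in> borel_measurable M" unfolding u_def by measurable
      show "(\<integral>x. u x \<partial>M) = 0"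
        using sh[of m] unfolding u_def by (simp add: l2norm_power2 sq_integrable_def prob_space)
      have "\<bar>u x\<bar> \<le> (K m)\<^sup>2 + (l2norm M (h m))\<^sup>2" if "x \<in> space M" for x
      proof -
        have "\<bar>h m x\<bar> \<le> \<bar>K m\<bar>" using K[OF that, of m] by linarith
        then have "(h m x)\<^sup>2 \<le> (K m)\<^sup>2" by (simp add: abs_le_square_iff)
        moreover have "0 \<le> (h m x)\<^sup>2" "0 \<le> (l2norm M (h m))\<^sup>2" by auto
        ultimately show ?thesis unfolding u_def by linarith
      qed
      then show "\<forall>x\<in>space M. \<bar>u x\<bar> \<le> (K m)\<^sup>2 + (l2norm M (h m))\<^sup>2" by blast
    qed
    then have clt: "(\<lambda>n. \<integral>x. iexp (t * (birkhoff (h m) n x / sqrt (real n))) \<partial>M)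
        \<longlonglongrightarrow> complex_of_real (exp (- t\<^sup>2 * (l2norm M (h m))\<^sup>2 / 2))"
      unfolding u_def by (intro mart_diff_clt[OF h K])
    have "\<forall>\<^sub>F n in sequentially. \<bar>t\<bar> * (C m / sqrt (real n)) < r / 4"
      using order_tendstoD(2)[OF tendsto_mult_left[OF C_lim, of "\<bar>t\<bar>"], of "r/4"] r by simp
    moreover have "\<forall>\<^sub>F n in sequentially. norm ((\<integral>x. iexp (t * (birkhoff (h m) n x / sqrt (real n))) \<partial>M)
        - complex_of_real (exp (- t\<^sup>2 * (l2norm M (h m))\<^sup>2 / 2))) < r / 4"
      using tendstoD[OF clt, of "r/4"] r by (simp add: dist_norm)
    ultimately have "\<forall>\<^sub>F n in sequentially. norm ((\<integral>x. iexp (t * (birkhoff f n x / sqrt (real n))) \<partial>M)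
        - complex_of_real (exp (- t\<^sup>2 * s2 / 2))) < r"
    proof eventually_elim
      case (elim n)
      let ?F = "\<integral>x. iexp (t * (birkhoff f n x / sqrt (real n))) \<partial>M"
      let ?H = "\<integral>x. iexp (t * (birkhoff (h m) n x / sqrt (real n))) \<partial>M"
      have sqf: "sq_integrable M (\<lambda>x. t * (birkhoff g n x / sqrt (real n)))" if "sq_integrable M g" for g
        using sq_integrable_cmult[OF sq_integrable_birkhoff[OF that, of n], of "t / sqrt (real n)"] by simp
      have "norm (?F - ?H) \<le> l2norm M (\<lambda>x. t * (birkhoff f n x / sqrt (real n)) - t * (birkhoff (h m) n x / sqrt (real n)))"
        by (rule norm_integral_iexp_diff_le[OF sqf[OF f] sqf[OF sh]])
      also have "(\<lambda>x. t * (birkhoff f n x / sqrt (real n)) - t * (birkhoff (h m) n x / sqrt (real n)))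
         = (\<lambda>x. t / sqrt (real n) * (birkhoff f n x - birkhoff (h m) n x))"
        by (auto simp: right_diff_distrib)
      also have "l2norm M (\<lambda>x. t / sqrt (real n) * (birkhoff f n x - birkhoff (h m) n x))
          = \<bar>t\<bar> * (l2norm M (\<lambda>x. birkhoff f n x - birkhoff (h m) n x) / sqrt (real n))"
        unfolding l2norm_cmult by (simp add: abs_divide)
      also have "\<dots> \<le> \<bar>t\<bar> * (C m / sqrt (real n) + 1 / real (Suc m))"
        using nearby by (intro mult_left_mono) auto
      finally have a: "norm (?F - ?H) < r / 4 + r / 4" using elim(1) m2 unfolding distrib_left by linarith
      have b: "norm (complex_of_real (exp (- t\<^sup>2 * (l2norm M (h m))\<^sup>2 / 2)) - complex_of_real (exp (- t\<^sup>2 * s2 / 2))) < r / 4"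
        using m1 by (simp only: norm_of_real flip: of_real_diff)
      show ?case
        using norm_triangle_lt[OF add_strict_mono[OF norm_triangle_lt[OF add_strict_mono[OF a elim(2)]] b]]
        by simp
    qed
    then show "\<exists>no. \<forall>n\<ge>no. norm ((\<integral>x. iexp (t * (birkhoff f n x / sqrt (real n))) \<partial>M)
        - complex_of_real (exp (- t\<^sup>2 * s2 / 2))) < r" by (simp add: eventually_sequentially)
  qed
qed

end

section \<open>Centered Gaussian laws and the abstract central limit theorem\<close>

lemma centered_gaussian_scaled_std_normal:
  assumes "s > 0"
  shows "density lborel (normal_density 0 s) = distr std_normal_distribution borel (\<lambda>x. s * x)"
proof -
  interpret std: prob_space std_normal_distribution by (rule prob_space_normal_density) simp
  have "distributed std_normal_distribution lborel (\<lambda>x. x) std_normal_density"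
    unfolding distributed_def
    by (auto intro!: measure_eqI simp: emeasure_distr distr_id2)
  from std.normal_density_affine[OF this, of s 0] assms
  have "distributed std_normal_distribution lborel (\<lambda>x. s * x) (normal_density 0 s)" by simp
  then have "distr std_normal_distribution lborel (\<lambda>x. s * x) = density lborel (normal_density 0 s)"
    unfolding distributed_def by simp
  moreover have "distr std_normal_distribution lborel (\<lambda>x. s * x) = distr std_normal_distribution borel (\<lambda>x. s * x)"
    by (rule distr_cong) auto
  ultimately show ?thesis by simp
qed

lemma real_distribution_centered_gaussian:
  assumes "s2 \<ge> 0" shows "real_distribution (centered_gaussian s2)"
proof (cases "s2 = 0")
  case True
  then show ?thesis
    by (auto simp: centered_gaussian_def real_distribution_def real_distribution_axioms_def
        intro!: prob_space_return)
next
  case False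
  then show ?thesis using assms
    by (auto simp: centered_gaussian_def real_distribution_def real_distribution_axioms_def
        intro!: prob_space_normal_density)
qed

lemma char_centered_gaussian:
  assumes "s2 \<ge> 0" shows "char (centered_gaussian s2) t = complex_of_real (exp (- t\<^sup>2 * s2 / 2))"
proof (cases "s2 = 0")
  case True
  then show ?thesis by (simp add: centered_gaussian_def char_def integral_return)
next
  case False
  then have s: "sqrt s2 > 0" using assms by simp
  have "char (centered_gaussian s2) t = (\<integral>x. iexp (t * (sqrt s2 * x)) \<partial>std_normal_distribution)"
    using False centered_gaussian_scaled_std_normal[OF s]
    by (simp add: centered_gaussian_def char_def integral_distr)
  also have "\<dots> = char std_normal_distribution (t * sqrt s2)" by (simp add: char_def mult.assoc)
  also have "\<dots> = complex_of_real (exp (- t\<^sup>2 * s2 / 2))"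
    using assms by (simp add: char_std_normal_distribution power_mult_distrib)
  finally show ?thesis .
qed

text \<open>The torus will enter through two hypotheses: \<open>bound\<close>, a summable estimate
  against all square-integrable test functions, and \<open>mix\<close>, decay without a rate for
  bounded functions of mean zero, which is applied to centred squares of bounded martingale
  differences.\<close>

theorem (in measure_preserving) birkhoff_clt:
  assumes f: "sq_integrable M f" and w: "summable w" "\<And>n. 0 \<le> w n"
    and bound: "\<And>n \<phi>. sq_integrable M \<phi> \<Longrightarrow> \<bar>\<integral>x. f x * \<phi> ((T ^^ n) x) \<partial>M\<bar> \<le> w n * l2norm M \<phi>"
    and mix: "\<And>u K. u \<in> borel_measurable M \<Longrightarrow> \<forall>x\<in>space M. \<bar>u x\<bar> \<le> K
        \<Longrightarrow> (\<integral>x. u x \<partial>M) = 0 \<Longrightarrow> correlation u \<longlonglongrightarrow> 0"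
    and s2: "s2 = - (\<integral>x. (f x)\<^sup>2 \<partial>M) + 2 * (\<Sum>n. correlation f n)"
  shows "summable (correlation f)" "s2 \<ge> 0"
    "weak_conv_m (\<lambda>n. distr M borel (\<lambda>x. birkhoff f n x / sqrt (real n))) (centered_gaussian s2)"
proof -
  show sc: "summable (correlation f)" by (rule summable_correlation[OF f w(1) bound])
  show s20: "s2 \<ge> 0" unfolding s2 by (rule birkhoff_variance_nonneg[OF f sc])
  have [measurable]: "birkhoff f n \<in> borel_measurable M" for n
    using sq_integrable_birkhoff[OF f] by (simp add: sq_integrable_def)
  show "weak_conv_m (\<lambda>n. distr M borel (\<lambda>x. birkhoff f n x / sqrt (real n))) (centered_gaussian s2)"
  proof (rule levy_continuity)
    show "real_distribution (distr M borel (\<lambda>x. birkhoff f n x / sqrt (real n)))" for n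
      by (rule real_distribution_distr) measurable
    show "real_distribution (centered_gaussian s2)" by (rule real_distribution_centered_gaussian[OF s20])
    fix t
    have "char (distr M borel (\<lambda>x. birkhoff f n x / sqrt (real n))) t
        = (\<integral>x. iexp (t * (birkhoff f n x / sqrt (real n))) \<partial>M)" for n
      unfolding char_def by (rule integral_distr) measurable
    moreover have "(\<lambda>n. \<integral>x. iexp (t * (birkhoff f n x / sqrt (real n))) \<partial>M)
        \<longlonglongrightarrow> complex_of_real (exp (- t\<^sup>2 * s2 / 2))"
      by (rule birkhoff_characteristic_limit[OF f w(1) bound w(2) mix s2])
    ultimately show "(\<lambda>n. char (distr M borel (\<lambda>x. birkhoff f n x / sqrt (real n))) t)
        \<longlonglongrightarrow> char (centered_gaussian s2) t"
      by (simp only: char_centered_gaussian[OF s20])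
  qed
qed

subsection \<open>Decay of inverse powers of an expanding matrix\<close>

lemma norm_smult_cvec: "norm (c *s (v :: complex ^ 'n)) = cmod c * norm v"
  by (simp add: norm_vec_def L2_set_right_distrib norm_mult)

text \<open>Constant and rate may depend on the vector; they become uniform only later, over the
  vectors of a basis.\<close>

definition geometric_decay :: "(complex ^ 'n \<Rightarrow> complex ^ 'n) \<Rightarrow> complex ^ 'n \<Rightarrow> bool" where
  "geometric_decay b v \<longleftrightarrow> (\<exists>C r. 0 < r \<and> r < 1 \<and> (\<forall>n. norm ((b ^^ n) v) \<le> C * r ^ n))"

lemma geometric_decay_mono:
  assumes "0 < r" "r \<le> s" "\<And>n. norm ((b ^^ n) v) \<le> C * r ^ n"
  shows "norm ((b ^^ n) v) \<le> C * s ^ n"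
proof -
  have "0 \<le> C" using order_trans[OF norm_ge_zero assms(3)[of 0]] by simp
  then have "C * r ^ n \<le> C * s ^ n" using assms by (intro mult_left_mono power_mono) auto
  then show ?thesis using assms(3)[of n] by linarith
qed

text \<open>With \<open>x n = b^n v\<close> the relation \<open>a v = m v + w\<close> becomes
  \<open>x (n + 1) = (x n - b^(n+1) w) / m\<close>, a contraction with a geometrically decaying perturbation.\<close>

lemma geometric_decay_step:
  fixes a b :: "complex ^ 'n \<Rightarrow> complex ^ 'n"
  assumes ba: "\<And>v. b (a v) = v" and bs: "\<And>c v. b (c *s v) = c *s b v" and bd: "\<And>v w. b (v - w) = b v - b w"
    and m: "cmod m > 1" and w: "geometric_decay b (a v - m *s v)"
  shows "geometric_decay b v"
proof -
  define w' where "w' = a v - m *s v"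
  obtain C r where r: "0 < r" "r < 1" and C: "\<And>n. norm ((b ^^ n) w') \<le> C * r ^ n"
    using w unfolding geometric_decay_def w'_def by blast
  define q where "q = 1 / cmod m"
  have q: "0 < q" "q < 1" using m less_trans[OF zero_less_one m] by (auto simp: q_def divide_less_eq)
  \<comment> \<open>\<open>s\<close> must exceed \<open>q\<close> strictly, even if \<open>r\<close>
    does not, so that the perturbation can be absorbed in the induction.\<close>
  define s where "s = max r ((1 + q) / 2)"
  have s: "0 < s" "s < 1" "q < s" using r q by (auto simp: s_def max_def)
  have Cs: "norm ((b ^^ n) w') \<le> C * s ^ n" for n
    by (rule geometric_decay_mono[OF r(1) _ C]) (simp add: s_def)
  have C0: "0 \<le> C" using order_trans[OF norm_ge_zero C[of 0]] by simp
  have bn_s: "(b ^^ n) (c *s u) = c *s (b ^^ n) u" for n c u by (induction n) (auto simp: bs)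
  have bn_d: "(b ^^ n) (u - u') = (b ^^ n) u - (b ^^ n) u'" for n u u' by (induction n) (auto simp: bd)
  have m0: "m \<noteq> 0" using m by auto
  have rec: "(b ^^ Suc n) v = (1 / m) *s ((b ^^ n) v - (b ^^ Suc n) w')" for n
  proof -
    have "(b ^^ Suc n) w' = (b ^^ Suc n) (a v) - m *s (b ^^ Suc n) v"
      unfolding w'_def by (simp only: bn_d bn_s)
    also have "(b ^^ Suc n) (a v) = (b ^^ n) v" unfolding funpow_Suc_right by (simp add: ba)
    finally have "(b ^^ n) v - (b ^^ Suc n) w' = m *s (b ^^ Suc n) v" by simp
    then show ?thesis using m0 by (simp add: vector_smult_assoc)
  qed
  \<comment> \<open>\<open>norm v \<le> D\<close> starts the induction, and
    \<open>C / (s - q) \<le> D\<close> amounts to \<open>q * D + C \<le> D * s\<close>, its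
    step.\<close>
  define D where "D = max (norm v) (C / (s - q))"
  have D0: "0 \<le> D" by (simp add: D_def le_max_iff_disj)
  have "norm ((b ^^ n) v) \<le> D * s ^ n" for n
  proof (induction n)
    case 0 then show ?case by (simp add: D_def)
  next
    case (Suc n)
    have "norm ((b ^^ Suc n) v) = q * norm ((b ^^ n) v - (b ^^ Suc n) w')"
      unfolding rec norm_smult_cvec by (simp add: q_def norm_divide)
    also have "\<dots> \<le> q * (D * s ^ n + C * s ^ Suc n)"
      using q Suc Cs[of "Suc n"] norm_triangle_ineq4[of "(b ^^ n) v" "(b ^^ Suc n) w'"]
      by (intro mult_left_mono) linarith+
    also have "\<dots> \<le> q * (D * s ^ n) + C * s ^ n"
    proof -
      have "q * (C * s ^ Suc n) = (q * s) * (C * s ^ n)" by simp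
      also have "\<dots> \<le> 1 * (C * s ^ n)"
        using q s C0 by (intro mult_right_mono mult_le_one) auto
      finally show ?thesis by (simp add: distrib_left)
    qed
    also have "\<dots> = (q * D + C) * s ^ n" by (simp add: algebra_simps)
    also have "\<dots> \<le> (D * s) * s ^ n"
    proof (rule mult_right_mono)
      have "C / (s - q) \<le> D" by (simp add: D_def)
      then have "C \<le> D * (s - q)" using s by (simp add: pos_divide_le_eq)
      then show "q * D + C \<le> D * s" by (simp add: algebra_simps)
    qed (use s in simp)
    finally show ?case by (simp add: mult.assoc)
  qed
  then show ?thesis unfolding geometric_decay_def using s by blast
qed

text \<open>For \<open>N\<close> at least the degree this is \<open>p(a)\<close> applied to
  \<open>v\<close>. The summation bound is kept apart from \<open>p\<close>, so that splitting off a
  linear factor just lowers it by one.\<close>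

definition poly_act :: "(complex ^ 'n \<Rightarrow> complex ^ 'n) \<Rightarrow> nat \<Rightarrow> complex poly \<Rightarrow> complex ^ 'n \<Rightarrow> complex ^ 'n" where
  "poly_act a N p v = (\<Sum>k\<le>N. coeff p k *s (a ^^ k) v)"

lemma poly_act_linear_factor:
  fixes a :: "complex ^ 'n \<Rightarrow> complex ^ 'n"
  assumes p: "p = [:- m, 1:] * q" and N: "degree q \<le> N"
  shows "poly_act a (Suc N) p v = poly_act a N q (a v) - m *s poly_act a N q v"
proof -
  have c: "coeff p k = (case k of 0 \<Rightarrow> 0 | Suc j \<Rightarrow> coeff q j) - m * coeff q k" for k
    by (simp add: p coeff_pCons split: nat.split)
  have z: "coeff q (Suc N) = 0" using N by (intro coeff_eq_0) simp
  have "poly_act a (Suc N) p v = (\<Sum>k\<le>Suc N. (case k of 0 \<Rightarrow> 0 | Suc j \<Rightarrow> coeff q j) *s (a ^^ k) v)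
      - m *s (\<Sum>k\<le>Suc N. coeff q k *s (a ^^ k) v)"
    unfolding poly_act_def c vec.scale_sum_right
    by (simp only: vec.scale_left_diff_distrib sum_subtractf vec.scale_scale)
  also have "(\<Sum>k\<le>Suc N. (case k of 0 \<Rightarrow> 0 | Suc j \<Rightarrow> coeff q j) *s (a ^^ k) v) = poly_act a N q (a v)"
    unfolding poly_act_def sum.atMost_Suc_shift by (simp add: funpow_swap1)
  also have "(\<Sum>k\<le>Suc N. coeff q k *s (a ^^ k) v) = poly_act a N q v"
    by (simp add: poly_act_def z)
  finally show ?thesis .
qed

text \<open>Stands in for the Jordan form: induction on the degree, with a root \<open>m\<close>
  split off as \<open>p = (x - m) q\<close>. If \<open>cmod m > 1\<close>, then \<open>q\<close>
  annihilates \<open>A v - m v\<close>, which therefore decays, and so does \<open>v\<close>.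
  Otherwise \<open>m\<close> is no eigenvalue, so the vector \<open>q(A) v\<close>, on which
  \<open>A\<close> acts as multiplication by \<open>m\<close>, is zero and \<open>q\<close> already
  annihilates \<open>v\<close>.\<close>

lemma annihilated_geometric_decay:
  fixes A B :: "complex ^ 'n ^ 'n"
  assumes BA: "B ** A = mat 1" and ev: "\<And>m v. v \<noteq> 0 \<Longrightarrow> A *v v = m *s v \<Longrightarrow> cmod m > 1"
    and "degree p = N" "p \<noteq> 0" "poly_act ((*v) A) N p v = 0"
  shows "geometric_decay ((*v) B) v"
  using assms(3-)
proof (induction N arbitrary: p v)
  case 0
  then obtain c where "p = [:c:]" "c \<noteq> 0" using degree_eq_zeroE by (metis pCons_0_0)
  then have "v = 0" using 0 by (simp add: poly_act_def)
  then have "((*v) B ^^ n) v = 0" for n by (induction n) auto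
  then show ?case unfolding geometric_decay_def by (intro exI[of _ 0] exI[of _ "1/2"]) auto
next
  case (Suc N)
  let ?a = "(*v) A"
  have "\<not> constant (poly p)" using Suc.prems by (simp add: constant_degree)
  then obtain m where "poly p m = 0" using fundamental_theorem_of_algebra by blast
  then obtain q where q: "p = [:- m, 1:] * q" unfolding poly_eq_0_iff_dvd by (elim dvdE)
  have q0: "q \<noteq> 0" using Suc.prems q by auto
  have dq: "degree q = N" using Suc.prems(1) q0 unfolding q by (subst (asm) degree_mult_eq) auto
  have an: "(?a ^^ k) (u - m *s u') = (?a ^^ k) u - m *s (?a ^^ k) u'" for k u u'
    by (induction k) (auto simp: matrix_vector_mult_diff_distrib vector_scalar_commute)
  have act0: "poly_act ?a N q (?a v) - m *s poly_act ?a N q v = 0"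
    using poly_act_linear_factor[OF q, of N ?a v] dq Suc.prems by simp
  show ?case
  proof (cases "cmod m > 1")
    case True
    have "poly_act ?a N q (?a v - m *s v) = 0"
      using act0 unfolding poly_act_def an
      by (simp add: vec.scale_right_diff_distrib sum_subtractf vec.scale_sum_right vec.scale_scale mult.commute)
    then have w: "geometric_decay ((*v) B) (?a v - m *s v)" using Suc.IH dq q0 by blast
    show ?thesis
    proof (rule geometric_decay_step[where a="?a" and b="(*v) B" and m=m, OF _ _ _ True w])
      show "B *v (A *v v) = v" for v using BA by (simp add: matrix_vector_mul_assoc)
    qed (auto simp: vector_scalar_commute matrix_vector_mult_diff_distrib)
  next
    case False
    define u where "u = poly_act ?a N q v"
    have "A *v u = poly_act ?a N q (?a v)"
      unfolding u_def poly_act_def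
      by (simp add: vec.linear_sum[OF matrix_vector_mul_linear_gen] vector_scalar_commute funpow_swap1)
    then have "A *v u = m *s u" using act0 by (simp add: u_def)
    then have "u = 0" using ev False by blast
    then show ?thesis using Suc.IH dq q0 unfolding u_def by blast
  qed
qed

text \<open>The iterates of \<open>v\<close> up to exponent \<open>D\<close>, the real dimension,
  are \<open>D + 1\<close> vectors and hence linearly dependent. Dependence is a property of sets,
  so a repetition among them is treated apart and gives the polynomial
  \<open>x^i - x^j\<close>.\<close>

lemma annihilating_poly_exists:
  fixes a :: "complex ^ 'n \<Rightarrow> complex ^ 'n"
  obtains p N where "degree p = N" "p \<noteq> 0" "poly_act a N p v = 0"
proof -
  define D where "D = DIM(complex ^ 'n)"
  have "\<exists>c :: nat \<Rightarrow> complex. (\<exists>k\<le>D. c k \<noteq> 0) \<and> (\<Sum>k\<le>D. c k *s (a ^^ k) v) = 0"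
  proof (cases "inj_on (\<lambda>k. (a ^^ k) v) {..D}")
    case True
    define S where "S = (\<lambda>k. (a ^^ k) v) ` {..D}"
    have "card S = Suc D" unfolding S_def using True by (simp add: card_image)
    then have "dependent S" by (intro dependent_biggerset) (auto simp: D_def S_def)
    then obtain u where u: "\<exists>x\<in>S. u x \<noteq> 0" "(\<Sum>x\<in>S. u x *\<^sub>R x) = 0"
      using dependent_finite[of S] by (auto simp: S_def)
    have "(\<Sum>k\<le>D. u ((a ^^ k) v) *\<^sub>R (a ^^ k) v) = 0"
      using u(2) unfolding S_def by (simp add: sum.reindex[OF True])
    moreover have "r *\<^sub>R (x :: complex ^ 'n) = complex_of_real r *s x" for r x
      unfolding vec_eq_iff vector_scaleR_component vector_smult_component
      by (simp add: scaleR_conv_of_real)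
    ultimately have "(\<Sum>k\<le>D. complex_of_real (u ((a ^^ k) v)) *s (a ^^ k) v) = 0" by simp
    then show ?thesis using u(1) unfolding S_def
      by (intro exI[of _ "\<lambda>k. complex_of_real (u ((a ^^ k) v))"]) auto
  next
    case False
    then obtain i j where ij: "i \<le> D" "j \<le> D" "i \<noteq> j" "(a ^^ i) v = (a ^^ j) v"
      unfolding inj_on_def by auto
    define c :: "nat \<Rightarrow> complex" where "c k = (if k = i then 1 else 0) - (if k = j then 1 else 0)" for k
    have "(\<Sum>k\<le>D. c k *s (a ^^ k) v) = (\<Sum>k\<le>D. if k = i then (a ^^ k) v else 0) - (\<Sum>k\<le>D. if k = j then (a ^^ k) v else 0)"
      unfolding sum_subtractf[symmetric] by (intro sum.cong) (auto simp: c_def)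
    also have "\<dots> = 0" using ij by simp
    finally show ?thesis using ij by (intro exI[of _ c]) (auto simp: c_def)
  qed
  then obtain c k where c: "k \<le> D" "c k \<noteq> 0" "(\<Sum>k\<le>D. c k *s (a ^^ k) v) = (0 :: complex ^ 'n)" by blast
  define p where "p = (\<Sum>k\<le>D. monom (c k) k)"
  have co: "coeff p k = (if k \<le> D then c k else 0)" for k
    by (simp add: p_def coeff_sum)
  have "p \<noteq> 0" using c co by (metis coeff_0)
  moreover have "degree p \<le> D" by (rule degree_le) (simp add: co)
  then have "poly_act a (degree p) p v = (\<Sum>k\<le>D. coeff p k *s (a ^^ k) v)"
    unfolding poly_act_def by (intro sum.mono_neutral_left) (auto simp: coeff_eq_0)
  then have "poly_act a (degree p) p v = 0" using c(3) by (simp add: co)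
  ultimately show thesis using that by blast
qed

section \<open>Passage from complex to real matrices\<close>

definition complex_vec :: "real ^ 'n \<Rightarrow> complex ^ 'n" where
  "complex_vec v = (\<chi> i. complex_of_real (v $ i))"

definition complex_mat :: "real ^ 'n ^ 'n \<Rightarrow> complex ^ 'n ^ 'n" where
  "complex_mat A = (\<chi> i j. complex_of_real (A $ i $ j))"

lemma norm_complex_vec: "norm (complex_vec v) = norm v"
  by (simp add: complex_vec_def norm_vec_def)

lemma complex_mat_vec: "complex_mat A *v complex_vec v = complex_vec (A *v v)"
  by (simp add: complex_vec_def complex_mat_def matrix_vector_mult_def vec_eq_iff)

lemma complex_mat_mult: "complex_mat A ** complex_mat B = complex_mat (A ** B)"
  by (simp add: complex_mat_def matrix_matrix_mult_def vec_eq_iff)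

text \<open>A nonzero vector in the kernel would be an eigenvector for the eigenvalue 0.\<close>

lemma expanding_invertible:
  fixes A :: "real ^ 'd ^ 'd"
  assumes "expanding A" shows "invertible A"
proof -
  have "x = 0" if "A *v x = 0" for x
  proof (rule ccontr)
    assume "x \<noteq> 0"
    then have "complex_vec x \<noteq> 0" by (auto simp: complex_vec_def vec_eq_iff)
    moreover have "complex_mat A *v complex_vec x = 0 *s complex_vec x"
      unfolding complex_mat_vec that by (simp add: complex_vec_def vec_eq_iff)
    ultimately have "complex_eigenvalue A 0"
      unfolding complex_eigenvalue_def complex_mat_def by blast
    then show False using assms by (auto simp: expanding_def)
  qed
  then show ?thesis by (simp add: invertible_left_inverse matrix_left_invertible_ker)
qed

text \<open>The finitely many basis vectors decay at least at the slowest of their rates, and points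
  of the cube are combinations of them with coefficients in the unit interval.\<close>

lemma expanding_inverse_decay:
  fixes A :: "real ^ 'd ^ 'd"
  assumes A: "expanding A" and B: "B ** A = mat 1"
  obtains C r where "0 < C" "0 < r" "r < 1"
    "\<And>n u. u \<in> unit_cube \<Longrightarrow> norm (((*v) B ^^ n) u) \<le> C * r ^ n"
proof -
  from B have BA: "complex_mat B ** complex_mat A = mat 1"
    unfolding complex_mat_mult by (simp add: complex_mat_def mat_def vec_eq_iff)
  have ev: "cmod m > 1" if "v \<noteq> 0" "complex_mat A *v v = m *s v" for m v
    using A that unfolding expanding_def complex_eigenvalue_def complex_mat_def by blast
  have pow: "((*v) (complex_mat B) ^^ n) (complex_vec u) = complex_vec (((*v) B ^^ n) u)" for n u
    by (induction n) (auto simp: complex_mat_vec)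
  have "\<exists>C r. 0 < r \<and> r < 1 \<and> (\<forall>n. norm (((*v) B ^^ n) u) \<le> C * r ^ n)" for u
  proof -
    obtain p N where p: "degree p = N" "p \<noteq> 0" "poly_act ((*v) (complex_mat A)) N p (complex_vec u) = 0"
      by (rule annihilating_poly_exists)
    have "geometric_decay ((*v) (complex_mat B)) (complex_vec u)"
      by (rule annihilated_geometric_decay[OF BA _ p]) (rule ev)
    then show ?thesis
      unfolding geometric_decay_def pow norm_complex_vec by blast
  qed
  then obtain C r where r: "\<And>u. 0 < r u" "\<And>u. r u < 1"
    and C: "\<And>u n. norm (((*v) B ^^ n) u) \<le> C u * r u ^ n" by metis
  define e :: "'d \<Rightarrow> real ^ 'd" where "e i = axis i 1" for i
  define s where "s = Max (range (\<lambda>i. r (e i)))"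
  have rs: "r (e i) \<le> s" for i unfolding s_def by (intro Max_ge) auto
  have "s \<in> range (\<lambda>i. r (e i))" unfolding s_def by (intro Max_in) auto
  then have s: "0 < s" "s < 1" using r by auto
  have C0: "0 \<le> C u" for u using order_trans[OF norm_ge_zero C[of 0 u]] by simp
  have Bn_sum: "((*v) B ^^ n) (\<Sum>i\<in>UNIV. (u $ i) *\<^sub>R e i) = (\<Sum>i\<in>UNIV. (u $ i) *\<^sub>R ((*v) B ^^ n) (e i))" for n and u :: "real ^ 'd"
    by (induction n) (auto simp: linear_sum[OF matrix_vector_mul_linear] matrix_vector_mult_scaleR)
  \<comment> \<open>The summand 1 keeps the constant strictly positive, as the geometric scales in
    the Dini argument require.\<close>
  have "norm (((*v) B ^^ n) u) \<le> (1 + (\<Sum>i\<in>UNIV. C (e i))) * s ^ n" if u: "u \<in> unit_cube" for n u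
  proof -
    have "u = (\<Sum>i\<in>UNIV. (u $ i) *\<^sub>R e i)"
      by (simp add: vec_eq_iff e_def axis_def if_distrib cong: if_cong)
    then have "norm (((*v) B ^^ n) u) = norm (\<Sum>i\<in>UNIV. (u $ i) *\<^sub>R ((*v) B ^^ n) (e i))"
      using Bn_sum[of n u] by simp
    also have "\<dots> \<le> (\<Sum>i\<in>UNIV. C (e i) * s ^ n)"
    proof (rule sum_norm_le)
      fix i
      have "norm ((u $ i) *\<^sub>R ((*v) B ^^ n) (e i)) \<le> 1 * (C (e i) * r (e i) ^ n)"
        using u C[of n "e i"] unfolding norm_scaleR by (intro mult_mono) (auto simp: unit_cube_def intro: less_imp_le)
      also have "\<dots> \<le> C (e i) * s ^ n"
        using r[of "e i"] C0 rs by (simp add: mult_left_mono power_mono)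
      finally show "norm ((u $ i) *\<^sub>R ((*v) B ^^ n) (e i)) \<le> C (e i) * s ^ n" .
    qed
    also have "\<dots> \<le> (1 + (\<Sum>i\<in>UNIV. C (e i))) * s ^ n" unfolding distrib_right sum_distrib_right using s by simp
    finally show ?thesis .
  qed
  moreover have "0 < 1 + (\<Sum>i\<in>UNIV. C (e i))" using C0 by (simp add: add_pos_nonneg sum_nonneg)
  ultimately show thesis using s that by blast
qed

subsection \<open>Translations and endomorphisms of the torus\<close>

lemma vec_nth_borel_measurable [measurable]: "(\<lambda>x :: real ^ 'd. x $ i) \<in> borel_measurable borel"
  by (intro borel_measurable_continuous_onI continuous_intros)

lemma matrix_vector_borel_measurable [measurable]:
  "(\<lambda>x :: real ^ 'd. (A :: real ^ 'd ^ 'd) *v x) \<in> borel_measurable borel"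
  by (intro borel_measurable_continuous_onI linear_continuous_on matrix_vector_mul_bounded_linear)

lemma unit_cube_borel [measurable]: "unit_cube \<in> sets borel"
  unfolding unit_cube_def by measurable

definition frac_vec :: "real ^ 'd \<Rightarrow> real ^ 'd" where
  "frac_vec x = (\<chi> i. frac (x $ i))"

definition floor_vec :: "real ^ 'd \<Rightarrow> real ^ 'd" where
  "floor_vec x = (\<chi> i. of_int \<lfloor>x $ i\<rfloor>)"

lemma frac_vec_eq: "frac_vec x = x - floor_vec x"
  by (simp add: frac_vec_def floor_vec_def vec_eq_iff frac_def)

lemma frac_vec_in_cube: "frac_vec x \<in> unit_cube"
  by (auto simp: frac_vec_def unit_cube_def frac_lt_1)

lemma frac_vec_cube: "x \<in> unit_cube \<Longrightarrow> frac_vec x = x"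
  by (simp add: frac_vec_def unit_cube_def vec_eq_iff frac_eq)

lemma int_vec_floor: "int_vec (floor_vec x)"
  by (simp add: int_vec_def floor_vec_def)

lemma frac_vec_add_int: "int_vec k \<Longrightarrow> frac_vec (x + k) = frac_vec x"
proof -
  assume k: "int_vec k"
  have "frac (x $ i + k $ i) = frac (x $ i)" for i
  proof -
    obtain z where "k $ i = of_int z" using k unfolding int_vec_def by (blast elim: Ints_cases)
    then show ?thesis by (simp add: frac_def)
  qed
  then show "frac_vec (x + k) = frac_vec x" by (simp add: frac_vec_def vec_eq_iff)
qed

text \<open>Tiling of space by integer translates of the half-open cube, in the form that shows a
  sum of indicators over all translates to be 1.\<close>

lemma int_vec_diff_cube:
  assumes "int_vec k" shows "x - k \<in> unit_cube \<longleftrightarrow> k = floor_vec x"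
proof
  assume x: "x - k \<in> unit_cube"
  have "x - k = frac_vec (x - k)" using frac_vec_cube[OF x] by simp
  also have "\<dots> = frac_vec x" using frac_vec_add_int[OF assms, of "x - k"] by simp
  finally show "k = floor_vec x" by (simp add: frac_vec_eq)
next
  assume "k = floor_vec x"
  then show "x - k \<in> unit_cube" using frac_vec_in_cube[of x] by (simp add: frac_vec_eq)
qed

lemma int_vec_minus: "int_vec k \<Longrightarrow> int_vec (- k)"
  by (simp add: int_vec_def)

lemma int_vec_matrix: "integral_matrix A \<Longrightarrow> int_vec k \<Longrightarrow> int_vec (A *v k)"
  unfolding int_vec_def integral_matrix_def matrix_vector_mult_def
  by (auto intro!: Ints_sum Ints_mult)

lemma countable_int_vec: "countable {k :: real ^ 'd. int_vec k}"
proof -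
  have "{k :: real ^ 'd. int_vec k} \<subseteq> range (\<lambda>z :: int ^ 'd. \<chi> i. of_int (z $ i))"
  proof
    fix k :: "real ^ 'd" assume "k \<in> {k. int_vec k}"
    then have "k = (\<chi> i. of_int ((\<chi> i. \<lfloor>k $ i\<rfloor>) $ i))" by (simp add: int_vec_def vec_eq_iff)
    then show "k \<in> range (\<lambda>z :: int ^ 'd. \<chi> i. of_int (z $ i))" by blast
  qed
  then show ?thesis by (rule countable_subset) simp
qed

lemma frac_vec_measurable [measurable]: "frac_vec \<in> borel_measurable borel"
  unfolding borel_measurable_euclidean_space[of frac_vec]
proof
  fix b :: "real ^ 'a" assume "b \<in> Basis"
  then obtain i where b: "b = axis i 1" by (auto simp: Basis_vec_def)
  show "(\<lambda>x. frac_vec x \<bullet> b) \<in> borel_measurable borel"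
    unfolding b frac_vec_def frac_def by (simp add: inner_axis)
qed

lemma space_haar_torus [simp]: "space haar_torus = unit_cube"
  by (simp add: haar_torus_def space_restrict_space)

lemma borel_measurable_haar: "f \<in> measurable borel N \<Longrightarrow> f \<in> measurable haar_torus N"
  unfolding haar_torus_def by (rule measurable_restrict_space1) simp

lemma ident_measurable_haar: "(\<lambda>x. x) \<in> measurable haar_torus borel"
  by (rule borel_measurable_haar) simp

lemma translate_measurable_haar [measurable]: "(\<lambda>x. x + v) \<in> measurable haar_torus borel"
  by (rule borel_measurable_haar) simp

lemma affine_pair_measurable_haar [measurable]:
  "(\<lambda>(x, u). (A :: real ^ 'd ^ 'd) *v x + u) \<in> measurable (haar_torus \<Otimes>\<^sub>M haar_torus) borel"
proof -
  have "fst \<in> measurable (haar_torus \<Otimes>\<^sub>M haar_torus) (borel :: (real ^ 'd) measure)"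
    by (rule measurable_compose[OF measurable_fst ident_measurable_haar])
  moreover have "snd \<in> measurable (haar_torus \<Otimes>\<^sub>M haar_torus) (borel :: (real ^ 'd) measure)"
    by (rule measurable_compose[OF measurable_snd ident_measurable_haar])
  ultimately show ?thesis
    unfolding split_beta by (intro borel_measurable_add measurable_compose[OF _ matrix_vector_borel_measurable])
qed

lemma frac_vec_measurable_haar [measurable]: "frac_vec \<in> measurable borel haar_torus"
proof -
  have "frac_vec \<in> measurable borel (restrict_space lborel unit_cube)"
    by (rule measurable_restrict_space2) (auto simp: frac_vec_in_cube)
  then show ?thesis by (simp only: haar_torus_def)
qed

lemma nn_integral_haar:
  "(\<integral>\<^sup>+x. f x \<partial>haar_torus) = (\<integral>\<^sup>+x. f x * indicator unit_cube x \<partial>lborel)"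
  unfolding haar_torus_def by (rule nn_integral_restrict_space) simp

lemma unit_cube_bounds:
  "box 0 One \<subseteq> (unit_cube :: (real ^ 'd) set)" "(unit_cube :: (real ^ 'd) set) \<subseteq> cbox 0 One"
proof -
  have one: "(One :: real ^ 'd) $ i = 1" for i
  proof -
    have "axis i 1 \<in> (Basis :: (real ^ 'd) set)" by (auto simp: Basis_vec_def)
    then show ?thesis unfolding cart_eq_inner_axis by (simp add: inner_sum_left inner_Basis)
  qed
  show "box 0 One \<subseteq> (unit_cube :: (real ^ 'd) set)"
    by (auto simp: unit_cube_def mem_box_cart one[unfolded sum_component] intro: less_imp_le)
  show "(unit_cube :: (real ^ 'd) set) \<subseteq> cbox 0 One"
    by (auto simp: unit_cube_def mem_box_cart one[unfolded sum_component] ) (meson less_imp_le)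
qed

lemma prob_space_haar: "prob_space (haar_torus :: (real ^ 'd) measure)"
proof
  have "emeasure lborel (unit_cube :: (real ^ 'd) set) \<le> emeasure lborel (cbox 0 (One :: real ^ 'd))"
    by (intro emeasure_mono unit_cube_bounds) simp
  also have "\<dots> = 1" by (subst emeasure_lborel_cbox) auto
  finally have le: "emeasure lborel (unit_cube :: (real ^ 'd) set) \<le> 1" .
  have "1 = emeasure lborel (box 0 (One :: real ^ 'd))" by (subst emeasure_lborel_box) auto
  also have "\<dots> \<le> emeasure lborel (unit_cube :: (real ^ 'd) set)"
    by (intro emeasure_mono unit_cube_bounds) simp
  finally have "emeasure lborel (unit_cube :: (real ^ 'd) set) = 1" using le by simp
  then show "emeasure (haar_torus :: (real ^ 'd) measure) (space haar_torus) = 1"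
    unfolding space_haar_torus by (simp add: haar_torus_def emeasure_restrict_space)
qed

text \<open>The faces of the cube, where reduction modulo 1 jumps, form a null set.\<close>

lemma AE_haar_interior: "AE x in (haar_torus :: (real ^ 'd) measure). x \<in> box 0 One"
proof -
  have "negligible (cbox 0 One - box 0 (One :: real ^ 'd))" by (rule negligible_frontier_interval)
  then have "AE x in lebesgue. x \<notin> cbox 0 One - box 0 (One :: real ^ 'd)"
    by (intro AE_not_in) (simp add: negligible_iff_null_sets)
  then have "AE x in lborel. x \<notin> cbox 0 One - box 0 (One :: real ^ 'd)"
    by (simp only: AE_completion_iff)
  then have "AE x in lborel. x \<in> unit_cube \<longrightarrow> x \<in> box 0 (One :: real ^ 'd)"
    by eventually_elim (use unit_cube_bounds in auto)
  then show ?thesis unfolding haar_torus_def by (subst AE_restrict_space_iff) auto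
qed

lemma nn_integral_lborel_translate:
  fixes f :: "real ^ 'd \<Rightarrow> ennreal"
  assumes [measurable]: "f \<in> borel_measurable borel"
  shows "(\<integral>\<^sup>+x. f (x + v) \<partial>lborel) = (\<integral>\<^sup>+x. f x \<partial>lborel)"
proof -
  have "(\<integral>\<^sup>+x. f x \<partial>lborel) = (\<integral>\<^sup>+x. f x \<partial>distr lborel borel ((+) v))"
    by (simp only: lborel_distr_plus)
  also have "\<dots> = (\<integral>\<^sup>+x. f (v + x) \<partial>lborel)" by (rule nn_integral_distr) auto
  finally show ?thesis by (simp add: add.commute)
qed

text \<open>A change of fundamental domain. Inserting the partition of unity formed by the
  \<open>c (x - k)\<close>, shifting by \<open>k\<close> and using the periodicity of
  \<open>g\<close> exchanges the translated cube for the unit cube; nonnegativity permits every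
  exchange of sum and integral.\<close>

lemma nn_integral_haar_translate:
  fixes g :: "real ^ 'd \<Rightarrow> ennreal"
  assumes [measurable]: "g \<in> borel_measurable borel" and per: "\<And>x k. int_vec k \<Longrightarrow> g (x + k) = g x"
  shows "(\<integral>\<^sup>+x. g (x + v) \<partial>haar_torus) = (\<integral>\<^sup>+x. g x \<partial>haar_torus)"
proof -
  define Z where "Z = {k :: real ^ 'd. int_vec k}"
  define c where "c = (indicator unit_cube :: real ^ 'd \<Rightarrow> ennreal)"
  have [measurable]: "c \<in> borel_measurable borel" unfolding c_def by measurable
  have Z: "countable Z" unfolding Z_def by (rule countable_int_vec)
  have one: "(\<integral>\<^sup>+k. c (y - k) \<partial>count_space Z) = 1" for y
  proof -
    have "(\<integral>\<^sup>+k. c (y - k) \<partial>count_space Z) = (\<integral>\<^sup>+k. indicator {floor_vec y} k \<partial>count_space Z)"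
      by (intro nn_integral_cong) (auto simp: c_def Z_def indicator_def int_vec_diff_cube)
    also have "\<dots> = emeasure (count_space Z) {floor_vec y}"
      by (rule nn_integral_indicator) (simp add: Z_def int_vec_floor)
    also have "\<dots> = 1" by (simp add: Z_def int_vec_floor emeasure_count_space)
    finally show ?thesis .
  qed
  have one': "(\<integral>\<^sup>+k. c (y + k) \<partial>count_space Z) = 1" for y
  proof -
    have "(\<integral>\<^sup>+k. c (y + k) \<partial>count_space Z) = (\<integral>\<^sup>+k. indicator {- floor_vec y} k \<partial>count_space Z)"
    proof (intro nn_integral_cong)
      fix k assume "k \<in> space (count_space Z)"
      then have "y - (- k) \<in> unit_cube \<longleftrightarrow> - k = floor_vec y"
        by (intro int_vec_diff_cube int_vec_minus) (simp add: Z_def)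
      moreover have "- k = floor_vec y \<longleftrightarrow> k = - floor_vec y" by (metis minus_minus)
      ultimately show "c (y + k) = indicator {- floor_vec y} k"
        by (simp add: c_def indicator_def)
    qed
    also have "\<dots> = emeasure (count_space Z) {- floor_vec y}"
      by (rule nn_integral_indicator) (simp add: Z_def int_vec_floor int_vec_minus)
    also have "\<dots> = 1" by (simp add: Z_def int_vec_floor int_vec_minus emeasure_count_space)
    finally show ?thesis .
  qed
  have "(\<integral>\<^sup>+x. g (x + v) \<partial>haar_torus) = (\<integral>\<^sup>+x. g (x + v) * c (x + v - v) \<partial>lborel)"
    by (simp add: nn_integral_haar c_def)
  also have "\<dots> = (\<integral>\<^sup>+x. g x * c (x - v) \<partial>lborel)"
    by (rule nn_integral_lborel_translate[of "\<lambda>x. g x * c (x - v)"]) measurable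
  also have "\<dots> = (\<integral>\<^sup>+x. \<integral>\<^sup>+k. g x * c (x - v) * c (x - k) \<partial>count_space Z \<partial>lborel)"
    by (simp add: nn_integral_cmult one)
  also have "\<dots> = (\<integral>\<^sup>+k. \<integral>\<^sup>+x. g x * c (x - v) * c (x - k) \<partial>lborel \<partial>count_space Z)"
    by (rule nn_integral_count_space_nn_integral[OF Z]) measurable
  also have "\<dots> = (\<integral>\<^sup>+k. \<integral>\<^sup>+x. g x * c (x - v + k) * c x \<partial>lborel \<partial>count_space Z)"
  proof (rule nn_integral_cong)
    fix k assume "k \<in> space (count_space Z)"
    then have k: "int_vec k" by (simp add: Z_def)
    have "(\<integral>\<^sup>+x. g x * c (x - v) * c (x - k) \<partial>lborel)
        = (\<integral>\<^sup>+x. g (x + k) * c (x + k - v) * c (x + k - k) \<partial>lborel)"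
      by (rule nn_integral_lborel_translate[symmetric, of "\<lambda>x. g x * c (x - v) * c (x - k)"]) measurable
    also have "\<dots> = (\<integral>\<^sup>+x. g x * c (x - v + k) * c x \<partial>lborel)"
      by (simp add: per[OF k] algebra_simps)
    finally show "(\<integral>\<^sup>+x. g x * c (x - v) * c (x - k) \<partial>lborel) = (\<integral>\<^sup>+x. g x * c (x - v + k) * c x \<partial>lborel)" .
  qed
  also have "\<dots> = (\<integral>\<^sup>+x. \<integral>\<^sup>+k. g x * c (x - v + k) * c x \<partial>count_space Z \<partial>lborel)"
    by (rule nn_integral_count_space_nn_integral[OF Z, symmetric]) measurable
  also have "\<dots> = (\<integral>\<^sup>+x. g x * c x \<partial>lborel)"
    by (simp add: nn_integral_cmult nn_integral_multc one')
  finally show ?thesis by (simp add: nn_integral_haar c_def)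
qed

lemma distr_haar_eqI:
  assumes [measurable]: "S \<in> measurable haar_torus haar_torus"
    and eq: "\<And>g. g \<in> borel_measurable haar_torus \<Longrightarrow>
      (\<integral>\<^sup>+x. g (S x) \<partial>haar_torus) = (\<integral>\<^sup>+x. (g x :: ennreal) \<partial>haar_torus)"
  shows "distr haar_torus haar_torus S = haar_torus"
proof (rule measure_eqI)
  fix B assume "B \<in> sets (distr haar_torus haar_torus S)"
  then have [measurable]: "B \<in> sets haar_torus" by simp
  have "emeasure (distr haar_torus haar_torus S) B = (\<integral>\<^sup>+x. indicator B x \<partial>distr haar_torus haar_torus S)"
    by simp
  also have "\<dots> = (\<integral>\<^sup>+x. indicator B (S x) \<partial>haar_torus)" by (rule nn_integral_distr) auto
  also have "\<dots> = (\<integral>\<^sup>+x. indicator B x \<partial>haar_torus)" by (rule eq) simp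
  finally show "emeasure (distr haar_torus haar_torus S) B = emeasure haar_torus B" by simp
qed simp

lemma nn_integral_haar_frac_vec:
  "(\<integral>\<^sup>+x. g (frac_vec x) \<partial>haar_torus) = (\<integral>\<^sup>+x. g x \<partial>haar_torus)"
  by (rule nn_integral_cong) (simp add: frac_vec_cube)

lemma distr_haar_translate:
  "distr haar_torus haar_torus (\<lambda>x. frac_vec (x + v)) = haar_torus"
proof (rule distr_haar_eqI)
  fix g :: "real ^ 'a \<Rightarrow> ennreal" assume [measurable]: "g \<in> borel_measurable haar_torus"
  have "(\<integral>\<^sup>+x. g (frac_vec (x + v)) \<partial>haar_torus) = (\<integral>\<^sup>+x. g (frac_vec x) \<partial>haar_torus)"
    by (rule nn_integral_haar_translate) (auto simp: frac_vec_add_int)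
  then show "(\<integral>\<^sup>+x. g (frac_vec (x + v)) \<partial>haar_torus) = (\<integral>\<^sup>+x. g x \<partial>haar_torus)"
    by (simp only: nn_integral_haar_frac_vec)
qed (rule measurable_compose[OF translate_measurable_haar frac_vec_measurable_haar])

lemma periodic_frac_vec: "periodic_Zd h \<Longrightarrow> h (frac_vec x) = h x"
  unfolding periodic_Zd_def frac_vec_eq
  using int_vec_minus[OF int_vec_floor[of x]] by (metis diff_conv_add_uminus)

lemma integral_haar_translate:
  assumes [measurable]: "h \<in> borel_measurable borel" and per: "periodic_Zd h"
  shows "(\<integral>x. h (x + v) \<partial>haar_torus) = (\<integral>x. h x \<partial>haar_torus)"
proof -
  have "(\<integral>x. h x \<partial>haar_torus) = (\<integral>x. h x \<partial>distr haar_torus haar_torus (\<lambda>x. frac_vec (x + v)))"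
    by (simp only: distr_haar_translate)
  also have "\<dots> = (\<integral>x. h (frac_vec (x + v)) \<partial>haar_torus)"
    by (rule integral_distr[OF measurable_compose[OF translate_measurable_haar frac_vec_measurable_haar]
          borel_measurable_haar[OF assms(1)]])
  finally show ?thesis by (simp add: periodic_frac_vec[OF per])
qed

lemma integrable_haar_translate:
  assumes [measurable]: "h \<in> borel_measurable borel" and per: "periodic_Zd h"
    and i: "integrable haar_torus h"
  shows "integrable haar_torus (\<lambda>x. h (x + v))"
proof -
  have "integrable (distr haar_torus haar_torus (\<lambda>x. frac_vec (x + v))) h"
    using i by (simp only: distr_haar_translate)
  then have "integrable haar_torus (\<lambda>x. h (frac_vec (x + v)))"
    using integrable_distr_eq[OF measurable_compose[OF translate_measurable_haar frac_vec_measurable_haar]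
          borel_measurable_haar[OF assms(1)]] by blast
  then show ?thesis by (simp add: periodic_frac_vec[OF per])
qed

text \<open>Averaging over translations by \<open>A\<^sup>-\<^sup>1 u\<close> with \<open>u\<close> uniform in the cube replaces \<open>G (A x)\<close> by
  \<open>G (A x + u)\<close>, so that no count of preimages is needed.\<close>

lemma distr_haar_matrix:
  fixes A :: "real ^ 'd ^ 'd"
  assumes A: "integral_matrix A" and B: "A ** B = mat 1"
  shows "distr haar_torus haar_torus (\<lambda>x. frac_vec (A *v x)) = haar_torus"
proof (rule distr_haar_eqI)
  interpret H: prob_space "haar_torus :: (real ^ 'd) measure" by (rule prob_space_haar)
  interpret P: pair_prob_space "haar_torus :: (real ^ 'd) measure" "haar_torus :: (real ^ 'd) measure" ..
  fix g :: "real ^ 'd \<Rightarrow> ennreal" assume [measurable]: "g \<in> borel_measurable haar_torus"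
  define G where "G x = g (frac_vec x)" for x
  have [measurable]: "G \<in> borel_measurable borel" unfolding G_def by measurable
  have per: "G (x + k) = G x" if "int_vec k" for x k using that by (simp add: G_def frac_vec_add_int)
  have shift: "(\<integral>\<^sup>+x. G (A *v x + u) \<partial>haar_torus) = (\<integral>\<^sup>+x. G (A *v x) \<partial>haar_torus)" for u
  proof -
    have AB: "A *v (B *v u) = u" using B by (simp add: matrix_vector_mul_assoc)
    have "(\<integral>\<^sup>+x. G (A *v (x + B *v u)) \<partial>haar_torus) = (\<integral>\<^sup>+x. G (A *v x) \<partial>haar_torus)"
      by (rule nn_integral_haar_translate)
         (auto simp: matrix_vector_right_distrib per int_vec_matrix[OF A])
    then show ?thesis by (simp add: matrix_vector_right_distrib AB)
  qed
  have "(\<integral>\<^sup>+x. G (A *v x) \<partial>haar_torus) = (\<integral>\<^sup>+u. (\<integral>\<^sup>+x. G (A *v x + u) \<partial>haar_torus) \<partial>(haar_torus :: (real ^ 'd) measure))"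
    by (simp add: shift H.emeasure_space_1[simplified])
  also have "\<dots> = (\<integral>\<^sup>+x. (\<integral>\<^sup>+u. G (A *v x + u) \<partial>haar_torus) \<partial>(haar_torus :: (real ^ 'd) measure))"
  proof (rule P.Fubini')
    show "(\<lambda>(x, u). G (A *v x + u)) \<in> borel_measurable (haar_torus \<Otimes>\<^sub>M haar_torus)"
      using measurable_compose[OF affine_pair_measurable_haar[of A] \<open>G \<in> borel_measurable borel\<close>]
      by (simp add: split_beta)
  qed
  also have "\<dots> = (\<integral>\<^sup>+x. (\<integral>\<^sup>+u. G u \<partial>haar_torus) \<partial>(haar_torus :: (real ^ 'd) measure))"
  proof (rule nn_integral_cong)
    fix x :: "real ^ 'd"
    have "(\<integral>\<^sup>+u. G (u + A *v x) \<partial>haar_torus) = (\<integral>\<^sup>+u. G u \<partial>haar_torus)"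
      by (rule nn_integral_haar_translate) (auto simp: per)
    then show "(\<integral>\<^sup>+u. G (A *v x + u) \<partial>haar_torus) = (\<integral>\<^sup>+u. G u \<partial>haar_torus)"
      by (simp only: add.commute)
  qed
  also have "\<dots> = (\<integral>\<^sup>+u. G u \<partial>haar_torus)" by (simp add: H.emeasure_space_1[simplified])
  finally show "(\<integral>\<^sup>+x. g (frac_vec (A *v x)) \<partial>haar_torus) = (\<integral>\<^sup>+x. g x \<partial>haar_torus)"
    unfolding G_def by (simp only: nn_integral_haar_frac_vec)
qed (rule measurable_compose[OF borel_measurable_haar[OF matrix_vector_borel_measurable] frac_vec_measurable_haar])

subsection \<open>The modulus of continuity\<close>

definition torus_map :: "real ^ 'd ^ 'd \<Rightarrow> real ^ 'd \<Rightarrow> real ^ 'd" where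
  "torus_map A x = frac_vec (A *v x)"

lemma torus_map_measurable: "torus_map A \<in> measurable haar_torus haar_torus"
  unfolding torus_map_def
  by (rule measurable_compose[OF borel_measurable_haar[OF matrix_vector_borel_measurable] frac_vec_measurable_haar])

lemma funpow_matrix_add: "((*v) (A :: real ^ 'd ^ 'd) ^^ n) (x + y) = ((*v) A ^^ n) x + ((*v) A ^^ n) (y :: real ^ 'd)"
  by (induction n) (auto simp: matrix_vector_right_distrib)

lemma funpow_matrix_inverse:
  fixes A B :: "real ^ 'd ^ 'd"
  assumes "A ** B = mat 1" shows "((*v) A ^^ n) (((*v) B ^^ n) u) = u"
proof (induction n arbitrary: u)
  case (Suc n)
  have "((*v) A ^^ Suc n) (((*v) B ^^ Suc n) u) = ((*v) A ^^ n) (A *v (B *v (((*v) B ^^ n) u)))"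
    by (simp add: funpow_swap1)
  also have "A *v (B *v (((*v) B ^^ n) u)) = ((*v) B ^^ n) u"
    using assms by (simp add: matrix_vector_mul_assoc)
  finally show ?case using Suc by simp
qed simp

lemma int_vec_funpow_matrix:
  "integral_matrix A \<Longrightarrow> int_vec k \<Longrightarrow> int_vec (((*v) (A :: real ^ 'd ^ 'd) ^^ n) k)"
  by (induction n) (auto intro: int_vec_matrix)

lemma funpow_matrix_measurable [measurable]: "((*v) (A :: real ^ 'd ^ 'd) ^^ n) \<in> borel_measurable borel"
  by (induction n) (auto intro: measurable_comp[OF _ matrix_vector_borel_measurable])

text \<open>Reducing modulo 1 at every step or only once at the end makes no difference, since
  \<open>A\<close> maps integer vectors to integer vectors.\<close>

lemma funpow_torus_map:
  fixes A :: "real ^ 'd ^ 'd"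
  assumes A: "integral_matrix A" and x: "x \<in> unit_cube"
  shows "(torus_map A ^^ n) x = frac_vec (((*v) A ^^ n) x)"
proof (induction n)
  case 0 then show ?case using x by (simp add: frac_vec_cube)
next
  case (Suc n)
  let ?y = "((*v) A ^^ n) x"
  have "A *v ?y = A *v frac_vec ?y + A *v floor_vec ?y"
    by (simp add: frac_vec_eq flip: matrix_vector_right_distrib)
  then have "frac_vec (A *v ?y) = frac_vec (A *v frac_vec ?y)"
    using frac_vec_add_int[OF int_vec_matrix[OF A int_vec_floor]] by metis
  then show ?case using Suc by (simp add: torus_map_def)
qed

text \<open>Translation preserves the norm of a periodic function. The resulting bound makes the
  supremum in \<open>L2_modulus\<close> one of a bounded set, so that it really dominates its
  members.\<close>

lemma L2_modulus_bdd:
  assumes [measurable]: "f \<in> borel_measurable borel" and per: "periodic_Zd f" and sq: "sq_integrable haar_torus f"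
  shows "sq_integrable haar_torus (\<lambda>x. f (x + v))"
    "l2norm haar_torus (\<lambda>x. f (x + v) - f x) \<le> 2 * l2norm haar_torus f"
proof -
  have p2: "periodic_Zd (\<lambda>x. (f x)\<^sup>2)" using per by (simp add: periodic_Zd_def)
  have "integrable haar_torus (\<lambda>x. (f (x + v))\<^sup>2)"
    using integrable_haar_translate[OF _ p2] sq by (simp add: sq_integrable_def)
  then show sv: "sq_integrable haar_torus (\<lambda>x. f (x + v))"
    using measurable_compose[OF translate_measurable_haar assms(1)] by (simp add: sq_integrable_def)
  have "l2norm haar_torus (\<lambda>x. f (x + v)) = l2norm haar_torus f"
    unfolding l2norm_def using integral_haar_translate[OF _ p2, of v] by simp
  then show "l2norm haar_torus (\<lambda>x. f (x + v) - f x) \<le> 2 * l2norm haar_torus f"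
    using l2norm_diff_le[OF sv sq] by simp
qed

lemma l2norm_le_L2_modulus:
  assumes f: "f \<in> borel_measurable borel" "periodic_Zd f" "sq_integrable haar_torus f" and v: "norm v \<le> \<delta>"
  shows "l2norm haar_torus (\<lambda>x. f (x + v) - f x) \<le> L2_modulus f \<delta>"
  unfolding L2_modulus_def l2norm_def
proof (rule cSUP_upper)
  show "v \<in> cball 0 \<delta>" using v by simp
  show "bdd_above ((\<lambda>v. sqrt (\<integral>x. (f (x + v) - f x)\<^sup>2 \<partial>haar_torus)) ` cball 0 \<delta>)"
    using L2_modulus_bdd(2)[OF f] unfolding l2norm_def by (intro bdd_aboveI2) auto
qed

lemma L2_modulus_nonneg:
  assumes f: "f \<in> borel_measurable borel" "periodic_Zd f" "sq_integrable haar_torus f" and \<delta>: "0 \<le> \<delta>"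
  shows "0 \<le> L2_modulus f \<delta>"
  by (rule order_trans[OF l2norm_nonneg l2norm_le_L2_modulus[OF f, of 0]]) (use \<delta> in simp)

lemma L2_modulus_mono:
  fixes f :: "real ^ 'd \<Rightarrow> real"
  assumes f: "f \<in> borel_measurable borel" "periodic_Zd f" "sq_integrable haar_torus f"
    and \<delta>: "0 \<le> \<delta>" "\<delta> \<le> \<epsilon>"
  shows "L2_modulus f \<delta> \<le> L2_modulus f \<epsilon>"
  unfolding L2_modulus_def[of f \<delta>]
proof (rule cSUP_least)
  show "cball 0 \<delta> \<noteq> ({} :: (real ^ 'd) set)" using \<delta> by simp
  fix v :: "real ^ 'd" assume "v \<in> cball 0 \<delta>"
  then show "sqrt (\<integral>x. (f (x + v) - f x)\<^sup>2 \<partial>haar_torus) \<le> L2_modulus f \<epsilon>"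
    using l2norm_le_L2_modulus[OF f, of v \<epsilon>] \<delta> by (simp add: l2norm_def)
qed

text \<open>On the block from \<open>s (Suc n)\<close> to \<open>s n\<close> the integrand is at
  least \<open>W (s (Suc n)) / s n\<close>, and the block has length \<open>(1 - r) * s n\<close>,
  so it contributes at least \<open>(1 - r) * W (s (Suc n))\<close>. The blocks are disjoint, and
  the choice of \<open>N\<close> places them inside the unit interval.\<close>

lemma summable_of_dini:
  fixes W :: "real \<Rightarrow> real"
  assumes W0: "\<And>t. 0 \<le> t \<Longrightarrow> 0 \<le> W t" and mono: "\<And>s t. 0 \<le> s \<Longrightarrow> s \<le> t \<Longrightarrow> W s \<le> W t"
    and dini: "(\<integral>\<^sup>+ t \<in> {0<..<1}. ennreal (W t / t) \<partial>lborel) < \<infinity>"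
    and C: "0 < C" and r: "0 < r" "r < 1"
  shows "summable (\<lambda>n. W (C * r ^ n))"
proof -
  have "(\<lambda>n. C * r ^ n) \<longlonglongrightarrow> C * 0"
    by (intro tendsto_intros LIMSEQ_realpow_zero) (use r in auto)
  then have "\<forall>\<^sub>F n in sequentially. C * r ^ n < 1" by (intro order_tendstoD(2)) auto
  then obtain N where N: "C * r ^ N < 1" by (auto simp: eventually_sequentially)
  define s where "s n = C * r ^ (N + n)" for n
  have s0: "0 < s n" for n using C r by (simp add: s_def)
  have sS: "s (Suc n) = r * s n" for n by (simp add: s_def)
  have sle: "s (Suc n) \<le> s n" for n using r s0[of n] by (simp add: sS)
  have s1: "s n \<le> s 0" for n by (rule lift_Suc_antimono_le[of s]) (auto simp: sle)
  define F where "F t = ennreal (W t / t) * indicator {0<..<1} t" for t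
  define c where "c n = W (s (Suc n)) / s n" for n
  have c0: "0 \<le> c n" for n unfolding c_def using W0 s0 by (simp add: less_imp_le)
  \<comment> \<open>The indicator on the right confines the sum to the blocks already used; the next
    block lies to their left, so at most one summand is nonzero at any \<open>t\<close>.\<close>
  have pt: "(\<Sum>n<m. ennreal (c n) * indicator {s (Suc n)..<s n} t) \<le> F t * indicator {s m..<s 0} t" for m t
  proof (induction m)
    case (Suc m)
    consider "t < s (Suc m)" | "s (Suc m) \<le> t" "t < s m" | "s m \<le> t" by linarith
    then show ?case
    proof cases
      case 1
      then have "t < s m" using sle[of m] by linarith
      then show ?thesis using Suc 1 by (simp add: indicator_def)
    next
      case 2
      have t: "0 < t" "t < 1" "t < s 0" using 2 s0[of "Suc m"] s1[of m] N by (auto simp: s_def)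
      have "c m \<le> W t / t"
        unfolding c_def using mono[OF less_imp_le[OF s0] 2(1)] W0[of "s (Suc m)"] s0[of "Suc m"] 2 t
        by (intro frac_le) auto
      then have "ennreal (c m) \<le> F t" using t by (simp add: F_def ennreal_leI)
      then show ?thesis using Suc 2 t by (simp add: indicator_def)
    next
      case 3
      then show ?thesis using Suc sle[of m] by (auto simp: indicator_def)
    qed
  qed simp
  have part: "ennreal (\<Sum>n<m. (1 - r) * W (s (Suc n))) \<le> (\<integral>\<^sup>+t. F t \<partial>lborel)" for m
  proof -
    have "ennreal (\<Sum>n<m. (1 - r) * W (s (Suc n))) = (\<Sum>n<m. ennreal ((1 - r) * W (s (Suc n))))"
      using W0[OF less_imp_le[OF s0]] r by (subst sum_ennreal) auto
    also have "\<dots> = (\<Sum>n<m. ennreal (c n) * ennreal (s n - s (Suc n)))"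
    proof (rule sum.cong)
      fix n
      have "(1 - r) * W (s (Suc n)) = c n * (s n - s (Suc n))"
        using s0[of n] by (simp add: c_def sS[of n] field_simps)
      then show "ennreal ((1 - r) * W (s (Suc n))) = ennreal (c n) * ennreal (s n - s (Suc n))"
        using c0[of n] by (simp add: ennreal_mult')
    qed simp
    also have "\<dots> = (\<Sum>n<m. \<integral>\<^sup>+t. ennreal (c n) * indicator {s (Suc n)..<s n} t \<partial>lborel)"
      using sle by (simp add: nn_integral_cmult)
    also have "\<dots> = (\<integral>\<^sup>+t. (\<Sum>n<m. ennreal (c n) * indicator {s (Suc n)..<s n} t) \<partial>lborel)"
      by (rule nn_integral_sum[symmetric]) simp
    also have "\<dots> \<le> (\<integral>\<^sup>+t. F t \<partial>lborel)"
    proof (rule nn_integral_mono)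
      fix t
      have "F t * indicator {s m..<s 0} t \<le> F t" by (simp add: indicator_def)
      then show "(\<Sum>n<m. ennreal (c n) * indicator {s (Suc n)..<s n} t) \<le> F t" by (rule order_trans[OF pt])
    qed
    finally show ?thesis .
  qed
  have fin: "(\<integral>\<^sup>+t. F t \<partial>lborel) < \<infinity>" using dini by (simp add: F_def)
  define L where "L = enn2real (\<integral>\<^sup>+t. F t \<partial>lborel)"
  have "(\<Sum>n<m. (1 - r) * W (s (Suc n))) \<le> L" for m
  proof -
    have "0 \<le> (\<Sum>n<m. (1 - r) * W (s (Suc n)))"
      using W0[OF less_imp_le[OF s0]] r by (intro sum_nonneg) auto
    then show ?thesis using enn2real_mono[OF part[of m]] fin by (simp add: L_def)
  qed
  then have "summable (\<lambda>n. (1 - r) * W (s (Suc n)))"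
    using W0[OF less_imp_le[OF s0]] r by (intro summableI_nonneg_bounded[where x=L]) auto
  then have "summable (\<lambda>n. W (s (Suc n)))" using r by (simp add: summable_cmult_iff)
  \<comment> \<open>The lower end of the first block is \<open>s 1\<close>, hence the shift by
    \<open>Suc N\<close>.\<close>
  then have "summable (\<lambda>n. W (C * r ^ (n + Suc N)))" by (simp add: s_def add.commute)
  then show ?thesis by (rule summable_iff_shift[of "\<lambda>n. W (C * r ^ n)" "Suc N", THEN iffD1])
qed

subsection \<open>Correlations on the torus\<close>

text \<open>A measurable function is almost everywhere a limit of continuous functions; clipping
  these at level \<open>K\<close> makes dominated convergence applicable.\<close>

lemma continuous_L1_approximation:
  fixes f :: "real ^ 'd \<Rightarrow> real"
  assumes f: "f \<in> borel_measurable borel" and K: "\<And>x. \<bar>f x\<bar> \<le> K" and e: "e > 0"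
  shows "\<exists>c. continuous_on UNIV c \<and> (\<forall>x. \<bar>c x\<bar> \<le> K) \<and> (\<integral>x. \<bar>f x - c x\<bar> \<partial>haar_torus) < e"
proof -
  interpret H: prob_space "haar_torus :: (real ^ 'd) measure" by (rule prob_space_haar)
  have "f \<in> borel_measurable lebesgue" using f by (simp add: measurable_completion)
  then have "f measurable_on UNIV" by (intro lebesgue_measurable_imp_measurable_on_real) auto
  then obtain N g where N: "negligible N" and g: "\<And>n. continuous_on UNIV (g n)"
    and lim: "\<And>x. x \<notin> N \<Longrightarrow> (\<lambda>n. g n x) \<longlonglongrightarrow> f x"
    unfolding measurable_on_def by auto
  define c where "c n x = max (- K) (min K (g n x))" for n :: nat and x
  have cc: "continuous_on UNIV (c n)" for n unfolding c_def by (intro continuous_intros g)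
  have K0: "0 \<le> K" using K[of 0] by linarith
  have cK: "\<bar>c n x\<bar> \<le> K" for n x using K0 by (auto simp: c_def)
  have cm: "c n \<in> borel_measurable borel" for n using cc by (rule borel_measurable_continuous_onI)
  have "AE x in lebesgue. x \<notin> N" using N by (intro AE_not_in) (simp add: negligible_iff_null_sets)
  then have "AE x in lborel. x \<notin> N" by (simp only: AE_completion_iff)
  then have ae: "AE x in haar_torus. x \<notin> N"
    unfolding haar_torus_def by (subst AE_restrict_space_iff) (auto elim: eventually_mono)
  have "(\<lambda>n. \<integral>x. \<bar>f x - c n x\<bar> \<partial>haar_torus) \<longlonglongrightarrow> (\<integral>x. 0 \<partial>(haar_torus :: (real ^ 'd) measure))"
  proof (rule integral_dominated_convergence)
    show "(\<lambda>x. \<bar>f x - c n x\<bar>) \<in> borel_measurable haar_torus" for n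
      by (rule borel_measurable_haar) (use f cm in measurable)
    show "integrable haar_torus (\<lambda>x :: real ^ 'd. 2 * K)" by simp
    show "AE x in haar_torus. norm \<bar>f x - c n x\<bar> \<le> 2 * K" for n
    proof (rule AE_I2)
      fix x show "norm \<bar>f x - c n x\<bar> \<le> 2 * K" using K[of x] cK[of n x] by (simp add: abs_le_iff)
    qed
    show "AE x in haar_torus. (\<lambda>n. \<bar>f x - c n x\<bar>) \<longlonglongrightarrow> 0"
      using ae
    proof eventually_elim
      case (elim x)
      have "(\<lambda>n. \<bar>f x - c n x\<bar>) \<longlonglongrightarrow> \<bar>f x - max (- K) (min K (f x))\<bar>"
        unfolding c_def by (intro tendsto_intros lim elim)
      moreover have "max (- K) (min K (f x)) = f x" using K[of x] by (simp add: abs_le_iff max_def min_def)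
      ultimately show ?case by simp
    qed
  qed simp
  then have "\<forall>\<^sub>F n in sequentially. (\<integral>x. \<bar>f x - c n x\<bar> \<partial>haar_torus) < e"
    using e by (intro order_tendstoD(2)) auto
  then obtain n where "(\<integral>x. \<bar>f x - c n x\<bar> \<partial>haar_torus) < e" by (auto simp: eventually_sequentially)
  then show ?thesis using cc cK by blast
qed

text \<open>A three-epsilon argument with a continuous approximant, periodized to \<open>p\<close>
  so that its distance to \<open>f\<close> is translation invariant. \<open>p\<close> may jump
  across the faces of the cube, but these are a null set, and an interior point stays in the cube
  under small translations.\<close>

lemma L1_translation_continuity:
  fixes f :: "real ^ 'd \<Rightarrow> real"
  assumes f: "f \<in> borel_measurable borel" and per: "periodic_Zd f" and K: "\<And>x. \<bar>f x\<bar> \<le> K"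
    and v: "v \<longlonglongrightarrow> 0"
  shows "(\<lambda>n. \<integral>x. \<bar>f (x + v n) - f x\<bar> \<partial>haar_torus) \<longlonglongrightarrow> 0"
proof (rule LIMSEQ_I)
  fix r :: real assume r: "r > 0"
  interpret H: prob_space "haar_torus :: (real ^ 'd) measure" by (rule prob_space_haar)
  have "r / 3 > 0" using r by simp
  from continuous_L1_approximation[OF f K this]
  obtain c where c: "continuous_on UNIV c" "\<And>x. \<bar>c x\<bar> \<le> K"
    and fc: "(\<integral>x. \<bar>f x - c x\<bar> \<partial>haar_torus) < r / 3" by blast
  define p where "p x = c (frac_vec x)" for x
  have [measurable]: "c \<in> borel_measurable borel" using c(1) by (rule borel_measurable_continuous_onI)
  have [measurable]: "p \<in> borel_measurable borel" unfolding p_def by measurable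
  note f [measurable]
  have pp: "periodic_Zd p" by (simp add: periodic_Zd_def p_def frac_vec_add_int)
  have pK: "\<bar>p x\<bar> \<le> K" for x using c(2) by (simp add: p_def)
  have int: "integrable haar_torus h" if "h \<in> borel_measurable borel" "\<And>x. \<bar>h x\<bar> \<le> 2 * K" for h :: "real ^ 'd \<Rightarrow> real"
    using that borel_measurable_haar[OF that(1)] by (intro H.integrable_const_bound[of _ "2 * K"]) auto
  have two: "\<bar>\<bar>a - b\<bar>\<bar> \<le> 2 * K" if "\<bar>a\<bar> \<le> K" "\<bar>b\<bar> \<le> K" for a b :: real using that by linarith
  have i0: "integrable haar_torus (\<lambda>x. \<bar>g x - h x\<bar>)"
    if [measurable]: "g \<in> borel_measurable borel" "h \<in> borel_measurable borel"
      and "\<And>x. \<bar>g x\<bar> \<le> K" "\<And>x. \<bar>h x\<bar> \<le> K" for g h :: "real ^ 'd \<Rightarrow> real"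
  proof (rule int)
    show "(\<lambda>x. \<bar>g x - h x\<bar>) \<in> borel_measurable borel" by measurable
    show "\<bar>\<bar>g x - h x\<bar>\<bar> \<le> 2 * K" for x by (rule two[OF that(3,4)])
  qed
  have fp: "(\<integral>x. \<bar>f x - p x\<bar> \<partial>haar_torus) < r / 3"
  proof -
    have "(\<integral>x. \<bar>f x - p x\<bar> \<partial>haar_torus) = (\<integral>x. \<bar>f x - c x\<bar> \<partial>haar_torus)"
      by (rule Bochner_Integration.integral_cong) (auto simp: p_def frac_vec_cube)
    then show ?thesis using fc by simp
  qed
  have mid: "(\<lambda>n. \<integral>x. \<bar>p (x + v n) - p x\<bar> \<partial>haar_torus) \<longlonglongrightarrow> (\<integral>x. 0 \<partial>(haar_torus :: (real ^ 'd) measure))"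
  proof (rule integral_dominated_convergence)
    show "(\<lambda>x. \<bar>p (x + v n) - p x\<bar>) \<in> borel_measurable haar_torus" for n
      by (rule borel_measurable_haar) measurable
    show "integrable haar_torus (\<lambda>x :: real ^ 'd. 2 * K)" by simp
    show "AE x in haar_torus. norm \<bar>p (x + v n) - p x\<bar> \<le> 2 * K" for n
      using two[OF pK pK] by simp
    show "AE x in haar_torus. (\<lambda>n. \<bar>p (x + v n) - p x\<bar>) \<longlonglongrightarrow> 0"
      using AE_haar_interior
    proof eventually_elim
      case (elim x)
      have xv: "(\<lambda>n. x + v n) \<longlonglongrightarrow> x" using tendsto_add[OF tendsto_const v, of x] by simp
      have "\<forall>\<^sub>F n in sequentially. x + v n \<in> box 0 One"
        using topological_tendstoD[OF xv open_box elim] .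
      then have ev: "\<forall>\<^sub>F n in sequentially. c (x + v n) = p (x + v n)"
        by eventually_elim (use unit_cube_bounds(1) in \<open>auto simp: p_def frac_vec_cube\<close>)
      have "isCont c x" using c(1) by (simp add: continuous_on_eq_continuous_at)
      then have "(\<lambda>n. c (x + v n)) \<longlonglongrightarrow> c x" using xv by (rule isCont_tendsto_compose)
      then have "(\<lambda>n. p (x + v n)) \<longlonglongrightarrow> c x" using ev by (rule Lim_transform_eventually)
      moreover have "c x = p x" using elim unit_cube_bounds(1) by (auto simp: p_def frac_vec_cube)
      ultimately have "(\<lambda>n. \<bar>p (x + v n) - p x\<bar>) \<longlonglongrightarrow> \<bar>p x - p x\<bar>" by (intro tendsto_intros) simp
      then show ?case by simp
    qed
  qed simp
  then have "\<forall>\<^sub>F n in sequentially. (\<integral>x. \<bar>p (x + v n) - p x\<bar> \<partial>haar_torus) < r / 3"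
    using r by (intro order_tendstoD(2)) auto
  then have "\<forall>\<^sub>F n in sequentially. norm ((\<integral>x. \<bar>f (x + v n) - f x\<bar> \<partial>haar_torus) - 0) < r"
  proof eventually_elim
    case (elim n)
    have perd: "periodic_Zd (\<lambda>x. \<bar>f x - p x\<bar>)" using per pp by (simp add: periodic_Zd_def)
    have sh: "(\<integral>x. \<bar>f (x + v n) - p (x + v n)\<bar> \<partial>haar_torus) = (\<integral>x. \<bar>f x - p x\<bar> \<partial>haar_torus)"
      by (rule integral_haar_translate[OF _ perd]) measurable
    have fv: "(\<lambda>x. f (x + v n)) \<in> borel_measurable borel"
      and pv: "(\<lambda>x. p (x + v n)) \<in> borel_measurable borel" and pm: "p \<in> borel_measurable borel"
      by measurable
    have i: "integrable haar_torus (\<lambda>x. \<bar>f (x + v n) - p (x + v n)\<bar>)" "integrable haar_torus (\<lambda>x. \<bar>p (x + v n) - p x\<bar>)"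
      "integrable haar_torus (\<lambda>x. \<bar>f x - p x\<bar>)" "integrable haar_torus (\<lambda>x. \<bar>f (x + v n) - f x\<bar>)"
      by (rule i0[OF fv pv K pK] i0[OF pv pm pK pK] i0[OF f pm K pK] i0[OF fv f K K])+
    have "(\<integral>x. \<bar>f (x + v n) - f x\<bar> \<partial>haar_torus)
       \<le> (\<integral>x. \<bar>f (x + v n) - p (x + v n)\<bar> + \<bar>p (x + v n) - p x\<bar> + \<bar>f x - p x\<bar> \<partial>haar_torus)"
      by (rule integral_mono) (use i in \<open>auto intro: Bochner_Integration.integrable_add\<close>)
    also have "\<dots> = (\<integral>x. \<bar>f x - p x\<bar> \<partial>haar_torus) + (\<integral>x. \<bar>p (x + v n) - p x\<bar> \<partial>haar_torus) + (\<integral>x. \<bar>f x - p x\<bar> \<partial>haar_torus)"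
      using i sh by simp
    also have "\<dots> < r" using elim fp by linarith
    finally show ?case by simp
  qed
  then show "\<exists>no. \<forall>n\<ge>no. norm ((\<integral>x. \<bar>f (x + v n) - f x\<bar> \<partial>haar_torus) - 0) < r"
    by (simp only: eventually_sequentially)
qed

section \<open>Correlations under an endomorphism of the torus\<close>

locale torus_endo =
  fixes A B :: "real ^ 'd ^ 'd"
  assumes integral_A: "integral_matrix A" and AB: "A ** B = mat 1"
begin

abbreviation a where "a n \<equiv> (*v) A ^^ n"
abbreviation b where "b n \<equiv> (*v) B ^^ n"

sublocale measure_preserving "haar_torus :: (real ^ 'd) measure" "torus_map A"
proof -
  interpret H: prob_space "haar_torus :: (real ^ 'd) measure" by (rule prob_space_haar)
  show "measure_preserving (haar_torus :: (real ^ 'd) measure) (torus_map A)"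
  proof
    show "torus_map A \<in> measurable haar_torus haar_torus" by (rule torus_map_measurable)
    show "distr haar_torus haar_torus (torus_map A) = haar_torus"
      unfolding torus_map_def by (rule distr_haar_matrix[OF integral_A AB])
  qed
qed

definition shifted_corr :: "(real ^ 'd \<Rightarrow> real) \<Rightarrow> (real ^ 'd \<Rightarrow> real) \<Rightarrow> nat \<Rightarrow> real ^ 'd \<Rightarrow> real" where
  "shifted_corr f \<phi> n u = (\<integral>x. f x * \<phi> (frac_vec (a n x + u)) \<partial>haar_torus)"

lemma target_translate:
  fixes \<phi> :: "real ^ 'd \<Rightarrow> real"
  assumes \<phi>: "integrable haar_torus \<phi>"
  shows "integrable haar_torus (\<lambda>u. \<phi> (frac_vec (z + u)))"
    "(\<integral>u. \<phi> (frac_vec (z + u)) \<partial>haar_torus) = (\<integral>x. \<phi> x \<partial>haar_torus)"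
proof -
  have m: "\<phi> \<in> borel_measurable haar_torus" using \<phi> by simp
  have m1: "(\<lambda>x. frac_vec (x + z)) \<in> measurable haar_torus haar_torus"
    by (rule measurable_compose[OF translate_measurable_haar frac_vec_measurable_haar])
  have "integrable (distr haar_torus haar_torus (\<lambda>x. frac_vec (x + z))) \<phi>"
    using \<phi> by (simp only: distr_haar_translate)
  then show "integrable haar_torus (\<lambda>u. \<phi> (frac_vec (z + u)))"
    using integrable_distr_eq[OF m1 m] by (simp add: add.commute)
  show "(\<integral>u. \<phi> (frac_vec (z + u)) \<partial>haar_torus) = (\<integral>x. \<phi> x \<partial>haar_torus)"
    using integral_distr[OF m1 m] by (simp add: distr_haar_translate add.commute)
qed

text \<open>For fixed \<open>x\<close>, letting \<open>u\<close> run through the cube only rotates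
  the torus, so the inner integral over \<open>u\<close> is the mean of \<open>\<phi>\<close>
  whatever \<open>x\<close> is; Fubini then separates the two means.\<close>

lemma shifted_corr_average:
  fixes f \<phi> :: "real ^ 'd \<Rightarrow> real"
  assumes f: "f \<in> borel_measurable borel" "integrable haar_torus f" and \<phi>: "integrable haar_torus \<phi>"
  shows "integrable haar_torus (shifted_corr f \<phi> n)"
    "(\<integral>u. shifted_corr f \<phi> n u \<partial>haar_torus) = (\<integral>x. f x \<partial>haar_torus) * (\<integral>x. \<phi> x \<partial>haar_torus)"
proof -
  interpret P: pair_prob_space "haar_torus :: (real ^ 'd) measure" "haar_torus :: (real ^ 'd) measure" ..
  have m: "\<phi> \<in> borel_measurable haar_torus" using \<phi> by simp
  have fst: "fst \<in> measurable (haar_torus \<Otimes>\<^sub>M haar_torus) (borel :: (real ^ 'd) measure)"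
    by (rule measurable_compose[OF measurable_fst ident_measurable_haar])
  have snd: "snd \<in> measurable (haar_torus \<Otimes>\<^sub>M haar_torus) (borel :: (real ^ 'd) measure)"
    by (rule measurable_compose[OF measurable_snd ident_measurable_haar])
  have "(\<lambda>p. a n (fst p) + snd p) \<in> measurable (haar_torus \<Otimes>\<^sub>M haar_torus) borel"
    by (intro borel_measurable_add measurable_compose[OF fst funpow_matrix_measurable] snd)
  from measurable_compose[OF measurable_compose[OF this frac_vec_measurable_haar] m]
  have "(\<lambda>p. \<phi> (frac_vec (a n (fst p) + snd p))) \<in> borel_measurable (haar_torus \<Otimes>\<^sub>M haar_torus)" .
  then have meas: "(\<lambda>(x, u). f x * \<phi> (frac_vec (a n x + u))) \<in> borel_measurable (haar_torus \<Otimes>\<^sub>M haar_torus)"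
    unfolding split_beta by (rule borel_measurable_times[OF measurable_compose[OF fst f(1)]])
  have abs: "integrable haar_torus (\<lambda>x. \<bar>\<phi> x\<bar>)" using \<phi> by simp
  have int: "integrable (haar_torus \<Otimes>\<^sub>M haar_torus) (\<lambda>(x, u). f x * \<phi> (frac_vec (a n x + u)))"
  proof (rule P.Fubini_integrable[OF meas])
    have "(\<integral>u. norm (f x * \<phi> (frac_vec (a n x + u))) \<partial>haar_torus) = \<bar>f x\<bar> * (\<integral>x. \<bar>\<phi> x\<bar> \<partial>haar_torus)" for x
      using target_translate(2)[OF abs, of "a n x"] by (simp add: abs_mult)
    then show "integrable haar_torus (\<lambda>x. \<integral>u. norm (case (x, u) of (x, u) \<Rightarrow> f x * \<phi> (frac_vec (a n x + u))) \<partial>haar_torus)"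
      using f(2) by simp
    show "AE x in haar_torus. integrable haar_torus (\<lambda>u. case (x, u) of (x, u) \<Rightarrow> f x * \<phi> (frac_vec (a n x + u)))"
      using target_translate(1)[OF \<phi>] by simp
  qed
  show "integrable haar_torus (shifted_corr f \<phi> n)"
    unfolding shifted_corr_def using P.integrable_snd[OF int] .
  have "(\<integral>u. shifted_corr f \<phi> n u \<partial>haar_torus)
      = (\<integral>x. (\<integral>u. f x * \<phi> (frac_vec (a n x + u)) \<partial>haar_torus) \<partial>haar_torus)"
    unfolding shifted_corr_def by (rule P.Fubini_integral[OF int])
  also have "\<dots> = (\<integral>x. f x \<partial>haar_torus) * (\<integral>x. \<phi> x \<partial>haar_torus)"
    using target_translate(2)[OF \<phi>] by simp
  finally show "(\<integral>u. shifted_corr f \<phi> n u \<partial>haar_torus) = (\<integral>x. f x \<partial>haar_torus) * (\<integral>x. \<phi> x \<partial>haar_torus)" .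
qed

text \<open>The affine map \<open>x \<mapsto> a n x + u\<close> is, modulo 1, the translation by
  \<open>b n u\<close> followed by the \<open>n\<close>-th power of the torus map, and both preserve
  the measure.\<close>

lemma target_sq_integrable:
  assumes \<phi>: "sq_integrable haar_torus \<phi>"
  shows "sq_integrable haar_torus (\<lambda>x. \<phi> (frac_vec (a n x + u)))"
    "l2norm haar_torus (\<lambda>x. \<phi> (frac_vec (a n x + u))) = l2norm haar_torus \<phi>"
proof -
  define S where "S x = (torus_map A ^^ n) (frac_vec (x + b n u))" for x
  have S: "S x = frac_vec (a n x + u)" for x
  proof -
    have "S x = frac_vec (a n (frac_vec (x + b n u)))"
      unfolding S_def by (rule funpow_torus_map[OF integral_A frac_vec_in_cube])
    also have "a n (frac_vec (x + b n u)) + a n (floor_vec (x + b n u)) = a n (x + b n u)"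
      by (simp add: frac_vec_eq flip: funpow_matrix_add)
    then have "frac_vec (a n (frac_vec (x + b n u))) = frac_vec (a n (x + b n u))"
      using frac_vec_add_int[OF int_vec_funpow_matrix[OF integral_A int_vec_floor]] by metis
    also have "a n (x + b n u) = a n x + u"
      by (simp add: funpow_matrix_add funpow_matrix_inverse[OF AB])
    finally show ?thesis .
  qed
  have m: "\<phi> \<in> borel_measurable haar_torus" "integrable haar_torus (\<lambda>x. (\<phi> x)\<^sup>2)"
    using \<phi> by (auto simp: sq_integrable_def)
  have m1: "(\<lambda>x. frac_vec (x + b n u)) \<in> measurable haar_torus haar_torus"
    by (rule measurable_compose[OF translate_measurable_haar frac_vec_measurable_haar])
  have Sm: "S \<in> measurable haar_torus haar_torus"
    unfolding S_def by (rule measurable_compose[OF m1 Tn_measurable])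
  have "distr haar_torus haar_torus S
      = distr (distr haar_torus haar_torus (\<lambda>x. frac_vec (x + b n u))) haar_torus (torus_map A ^^ n)"
    by (subst distr_distr[OF Tn_measurable m1]) (simp add: S_def[abs_def] o_def)
  then have d: "distr haar_torus haar_torus S = haar_torus" by (simp add: distr_haar_translate distr_Tn)
  have "integrable (distr haar_torus haar_torus S) (\<lambda>x. (\<phi> x)\<^sup>2)" unfolding d by (rule m(2))
  then have "integrable haar_torus (\<lambda>x. (\<phi> (S x))\<^sup>2)"
    using integrable_distr_eq[OF Sm, of "\<lambda>x. (\<phi> x)\<^sup>2"] m(1) by simp
  then show "sq_integrable haar_torus (\<lambda>x. \<phi> (frac_vec (a n x + u)))"
    using measurable_compose[OF Sm m(1)] by (simp add: sq_integrable_def S)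
  have "(\<integral>x. (\<phi> x)\<^sup>2 \<partial>distr haar_torus haar_torus S) = (\<integral>x. (\<phi> (S x))\<^sup>2 \<partial>haar_torus)"
    by (rule integral_distr[OF Sm]) (use m(1) in simp)
  then show "l2norm haar_torus (\<lambda>x. \<phi> (frac_vec (a n x + u))) = l2norm haar_torus \<phi>"
    by (simp add: l2norm_def d S)
qed

text \<open>Translating \<open>x\<close> by \<open>b n u\<close> moves \<open>a n x\<close> by
  exactly \<open>u\<close>, so only the factor \<open>f\<close> sees the small shift.\<close>

lemma corr_eq_shifted:
  fixes f \<phi> :: "real ^ 'd \<Rightarrow> real"
  assumes f: "f \<in> borel_measurable borel" "periodic_Zd f" "sq_integrable haar_torus f"
    and \<phi>: "sq_integrable haar_torus \<phi>"
  shows "(\<integral>x. f x * \<phi> ((torus_map A ^^ n) x) \<partial>haar_torus) - shifted_corr f \<phi> n u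
    = (\<integral>x. (f (x + b n u) - f x) * \<phi> (frac_vec (a n x + u)) \<partial>haar_torus)"
proof -
  have m: "\<phi> \<in> borel_measurable haar_torus" using \<phi> by (simp add: sq_integrable_def)
  define h where "h x = f x * \<phi> (frac_vec (a n x))" for x
  have hm: "h \<in> borel_measurable borel" unfolding h_def
    by (intro borel_measurable_times f(1)
        measurable_compose[OF measurable_compose[OF funpow_matrix_measurable frac_vec_measurable_haar] m])
  have hp: "periodic_Zd h"
    using f(2) by (simp add: periodic_Zd_def h_def funpow_matrix_add frac_vec_add_int int_vec_funpow_matrix[OF integral_A])
  have "(\<integral>x. f x * \<phi> ((torus_map A ^^ n) x) \<partial>haar_torus) = (\<integral>x. h x \<partial>haar_torus)"
    by (rule Bochner_Integration.integral_cong) (auto simp: h_def funpow_torus_map[OF integral_A])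
  also have "\<dots> = (\<integral>x. h (x + b n u) \<partial>haar_torus)"
    by (rule integral_haar_translate[OF hm hp, symmetric])
  also have "\<dots> = (\<integral>x. f (x + b n u) * \<phi> (frac_vec (a n x + u)) \<partial>haar_torus)"
    by (simp add: h_def funpow_matrix_add funpow_matrix_inverse[OF AB])
  finally have J: "(\<integral>x. f x * \<phi> ((torus_map A ^^ n) x) \<partial>haar_torus)
      = (\<integral>x. f (x + b n u) * \<phi> (frac_vec (a n x + u)) \<partial>haar_torus)" .
  show ?thesis unfolding J shifted_corr_def left_diff_distrib
    by (rule Bochner_Integration.integral_diff[symmetric])
       (intro integrable_mult_sq_integrable L2_modulus_bdd(1)[OF f] f(3) target_sq_integrable(1)[OF \<phi>])+
qed

text \<open>The Cauchy-Schwarz estimate is uniform in \<open>u\<close>, and the average of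
  \<open>shifted_corr f \<phi> n u\<close> over \<open>u\<close> is zero since \<open>f\<close> has
  mean zero.\<close>

lemma correlation_bound:
  fixes f \<phi> :: "real ^ 'd \<Rightarrow> real"
  assumes f: "f \<in> borel_measurable borel" "periodic_Zd f" "sq_integrable haar_torus f"
    and mean: "(\<integral>x. f x \<partial>haar_torus) = 0" and \<phi>: "sq_integrable haar_torus \<phi>"
    and \<delta>: "\<And>u. u \<in> unit_cube \<Longrightarrow> norm (b n u) \<le> \<delta>"
  shows "\<bar>\<integral>x. f x * \<phi> ((torus_map A ^^ n) x) \<partial>haar_torus\<bar> \<le> L2_modulus f \<delta> * l2norm haar_torus \<phi>"
proof -
  define J where "J = (\<integral>x. f x * \<phi> ((torus_map A ^^ n) x) \<partial>haar_torus)"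
  have le: "\<bar>J - shifted_corr f \<phi> n u\<bar> \<le> L2_modulus f \<delta> * l2norm haar_torus \<phi>" if u: "u \<in> unit_cube" for u
  proof -
    have "\<bar>J - shifted_corr f \<phi> n u\<bar>
        \<le> l2norm haar_torus (\<lambda>x. f (x + b n u) - f x) * l2norm haar_torus (\<lambda>x. \<phi> (frac_vec (a n x + u)))"
      unfolding J_def corr_eq_shifted[OF f \<phi>]
      by (intro Cauchy_Schwarz_l2 sq_integrable_diff L2_modulus_bdd(1)[OF f] f(3) target_sq_integrable(1)[OF \<phi>])
    also have "\<dots> \<le> L2_modulus f \<delta> * l2norm haar_torus \<phi>"
      unfolding target_sq_integrable(2)[OF \<phi>]
      by (intro mult_right_mono l2norm_le_L2_modulus[OF f] \<delta> u) simp
    finally show ?thesis .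
  qed
  note av = shifted_corr_average[OF f(1) sq_integrable_imp_integrable[OF f(3)] sq_integrable_imp_integrable[OF \<phi>], of n]
  have "J = (\<integral>u. J - shifted_corr f \<phi> n u \<partial>haar_torus)"
    using av mean prob_space by simp
  then have "\<bar>J\<bar> \<le> (\<integral>u. \<bar>J - shifted_corr f \<phi> n u\<bar> \<partial>haar_torus)"
    using integral_abs_bound[of haar_torus "\<lambda>u. J - shifted_corr f \<phi> n u"] by simp
  also have "\<dots> \<le> (\<integral>u. L2_modulus f \<delta> * l2norm haar_torus \<phi> \<partial>(haar_torus :: (real ^ 'd) measure))"
    using le av(1) by (intro integral_mono integrable_abs Bochner_Integration.integrable_diff) auto
  also have "\<dots> = L2_modulus f \<delta> * l2norm haar_torus \<phi>" using prob_space by simp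
  finally show ?thesis by (simp add: J_def)
qed

text \<open>The same averaging with the norms redistributed: the test function is bounded, so the
  \<open>L\<^sup>1\<close> translation error suffices. It tends to zero for each \<open>u\<close>,
  and dominated convergence in \<open>u\<close> takes the place of a rate.\<close>

lemma correlation_decay_bounded:
  fixes w :: "real ^ 'd \<Rightarrow> real"
  assumes w: "w \<in> borel_measurable haar_torus" and K: "\<And>x. x \<in> unit_cube \<Longrightarrow> \<bar>w x\<bar> \<le> K"
    and mean: "(\<integral>x. w x \<partial>haar_torus) = 0"
    and b0: "\<And>u. u \<in> unit_cube \<Longrightarrow> (\<lambda>n. b n u) \<longlonglongrightarrow> 0"
  shows "correlation w \<longlonglongrightarrow> 0"
proof -
  \<comment> \<open>\<open>w\<close> is controlled only on the cube; its periodic extension has the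
    same integrals and can be translated.\<close>
  define f where "f x = w (frac_vec x)" for x
  have fm: "f \<in> borel_measurable borel" unfolding f_def
    by (rule measurable_compose[OF frac_vec_measurable_haar w])
  have fp: "periodic_Zd f" by (simp add: periodic_Zd_def f_def frac_vec_add_int)
  have fK: "\<bar>f x\<bar> \<le> K" for x unfolding f_def by (rule K[OF frac_vec_in_cube])
  have K0: "0 \<le> K" using fK[of 0] by linarith
  have sw: "sq_integrable haar_torus w" using w K by (intro sq_integrable_bounded) auto
  have sf: "sq_integrable haar_torus f"
    using borel_measurable_haar[OF fm] fK by (intro sq_integrable_bounded) auto
  have fw: "(\<integral>x. f x * g x \<partial>haar_torus) = (\<integral>x. w x * g x \<partial>haar_torus)" for g
    by (rule Bochner_Integration.integral_cong) (auto simp: f_def frac_vec_cube)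
  define J where "J n = (\<integral>x. f x * w ((torus_map A ^^ n) x) \<partial>haar_torus)" for n
  note av = shifted_corr_average[OF fm sq_integrable_imp_integrable[OF sf] sq_integrable_imp_integrable[OF sw]]
  have fint: "integrable haar_torus (\<lambda>x. \<bar>f (x + v) - f x\<bar>)" for v
    by (intro integrable_abs sq_integrable_imp_integrable sq_integrable_diff L2_modulus_bdd(1)[OF fm fp sf] sf)
  have le: "\<bar>J n - shifted_corr f w n u\<bar> \<le> K * (\<integral>x. \<bar>f (x + b n u) - f x\<bar> \<partial>haar_torus)" for n u
  proof -
    have pr: "integrable haar_torus (\<lambda>x. (f (x + b n u) - f x) * w (frac_vec (a n x + u)))"
      by (intro integrable_mult_sq_integrable sq_integrable_diff L2_modulus_bdd(1)[OF fm fp sf] sf target_sq_integrable(1)[OF sw])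
    have "\<bar>J n - shifted_corr f w n u\<bar> \<le> (\<integral>x. \<bar>(f (x + b n u) - f x) * w (frac_vec (a n x + u))\<bar> \<partial>haar_torus)"
      unfolding J_def corr_eq_shifted[OF fm fp sf sw] by (rule integral_abs_bound)
    also have "\<dots> \<le> (\<integral>x. K * \<bar>f (x + b n u) - f x\<bar> \<partial>haar_torus)"
    proof (rule integral_mono)
      show "integrable haar_torus (\<lambda>x. \<bar>(f (x + b n u) - f x) * w (frac_vec (a n x + u))\<bar>)"
        using pr by (rule integrable_abs)
      show "integrable haar_torus (\<lambda>x. K * \<bar>f (x + b n u) - f x\<bar>)"
        using fint by (rule integrable_mult_right)
      fix x
      show "\<bar>(f (x + b n u) - f x) * w (frac_vec (a n x + u))\<bar> \<le> K * \<bar>f (x + b n u) - f x\<bar>"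
        using K[OF frac_vec_in_cube] unfolding abs_mult by (subst mult.commute) (intro mult_right_mono; simp)
    qed
    finally show ?thesis by simp
  qed
  have "(\<lambda>n. \<integral>u. J n - shifted_corr f w n u \<partial>haar_torus) \<longlonglongrightarrow> (\<integral>u. 0 \<partial>(haar_torus :: (real ^ 'd) measure))"
  proof (rule integral_dominated_convergence)
    show "(\<lambda>u. J n - shifted_corr f w n u) \<in> borel_measurable haar_torus" for n
      using av(1)[of n] by (intro borel_measurable_diff borel_measurable_const borel_measurable_integrable)
    show "integrable haar_torus (\<lambda>u :: real ^ 'd. K * (2 * K))" by simp
    show "AE u in haar_torus. norm (J n - shifted_corr f w n u) \<le> K * (2 * K)" for n
    proof (rule AE_I2)
      fix u :: "real ^ 'd"
      have "(\<integral>x. \<bar>f (x + b n u) - f x\<bar> \<partial>haar_torus) \<le> (\<integral>x. 2 * K \<partial>(haar_torus :: (real ^ 'd) measure))"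
      proof (rule integral_mono[OF fint])
        fix x show "\<bar>f (x + b n u) - f x\<bar> \<le> 2 * K" using fK[of "x + b n u"] fK[of x] by linarith
      qed simp
      also have "\<dots> = 2 * K" using prob_space by simp
      finally have "K * (\<integral>x. \<bar>f (x + b n u) - f x\<bar> \<partial>haar_torus) \<le> K * (2 * K)" using K0 by (rule mult_left_mono)
      then show "norm (J n - shifted_corr f w n u) \<le> K * (2 * K)" using le[of n u] by simp
    qed
    show "AE u in haar_torus. (\<lambda>n. J n - shifted_corr f w n u) \<longlonglongrightarrow> 0"
    proof (rule AE_I2)
      fix u :: "real ^ 'd" assume "u \<in> space haar_torus"
      then have "(\<lambda>n. b n u) \<longlonglongrightarrow> 0" by (intro b0) simp
      from tendsto_mult_left[OF L1_translation_continuity[OF fm fp fK this], of K]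
      have lim: "(\<lambda>n. K * (\<integral>x. \<bar>f (x + b n u) - f x\<bar> \<partial>haar_torus)) \<longlonglongrightarrow> 0" by simp
      show "(\<lambda>n. J n - shifted_corr f w n u) \<longlonglongrightarrow> 0"
        by (rule Lim_null_comparison[OF _ lim]) (use le in \<open>auto simp: always_eventually\<close>)
    qed
  qed simp
  moreover have "(\<integral>u. J n - shifted_corr f w n u \<partial>haar_torus) = correlation w n" for n
    using av[of n] mean prob_space by (simp add: J_def correlation_def fw)
  ultimately show ?thesis by simp
qed

end

theorem theorem3:
  fixes A :: "real ^ 'd ^ 'd" and f :: "real ^ 'd \<Rightarrow> real"
  assumes "integral_matrix A" and "expanding A"
    and "periodic_Zd f"
    and "f \<in> borel_measurable lborel"
    and "integrable haar_torus (\<lambda>x. (f x)\<^sup>2)"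
    and "(\<integral>x. f x \<partial>haar_torus) = 0"
    and "(\<integral>\<^sup>+ t \<in> {0<..<1}. ennreal (L2_modulus f t / t) \<partial>lborel) < \<infinity>"
  shows "summable (\<lambda>n. \<integral>x. f x * f (((\<lambda>y. A *v y) ^^ n) x) \<partial>haar_torus)
    \<and> (let \<sigma>2 = - (\<integral>x. (f x)\<^sup>2 \<partial>haar_torus)
              + 2 * (\<Sum>n. \<integral>x. f x * f (((\<lambda>y. A *v y) ^^ n) x) \<partial>haar_torus)
       in \<sigma>2 \<ge> 0 \<and>
          weak_conv_m
            (\<lambda>n. distr haar_torus borel
                 (\<lambda>x. (\<Sum>j<n. f (((\<lambda>y. A *v y) ^^ j) x)) / sqrt (real n)))
            (centered_gaussian \<sigma>2))"
proof -
  obtain B where B: "A ** B = mat 1" "B ** A = mat 1"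
    using expanding_invertible[OF assms(2)] unfolding invertible_def by blast
  interpret torus_endo A B by (unfold_locales) (rule assms(1) B(1))+
  obtain C r where C: "0 < C" and r: "0 < r" "r < 1"
    and decay: "\<And>n u. u \<in> unit_cube \<Longrightarrow> norm (b n u) \<le> C * r ^ n"
    using expanding_inverse_decay[OF assms(2) B(2)] by metis
  have fm: "f \<in> borel_measurable borel" using assms(4) by simp
  have sf: "sq_integrable haar_torus f"
    using borel_measurable_haar[OF fm] assms(5) by (simp add: sq_integrable_def)
  note f = fm assms(3) sf
  \<comment> \<open>The radius \<open>C * r ^ n\<close> bounds \<open>b n u\<close> for all
    \<open>u\<close> in the cube at once, so \<open>w n\<close> dominates every shift used in the
    averaging.\<close>
  define w where "w n = L2_modulus f (C * r ^ n)" for n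
  have w0: "0 \<le> w n" for n
    unfolding w_def using C r by (intro L2_modulus_nonneg[OF f]) simp
  have w: "summable w"
    unfolding w_def
    by (rule summable_of_dini[OF L2_modulus_nonneg[OF f] L2_modulus_mono[OF f] assms(7) C r])
  have b0: "(\<lambda>n. b n u) \<longlonglongrightarrow> 0" if u: "u \<in> unit_cube" for u
  proof -
    have "(\<lambda>n. C * r ^ n) \<longlonglongrightarrow> C * 0" by (intro tendsto_intros LIMSEQ_realpow_zero) (use r in auto)
    then have lim: "(\<lambda>n. C * r ^ n) \<longlonglongrightarrow> 0" by simp
    show ?thesis by (rule Lim_null_comparison[OF _ lim]) (use decay[OF u] in \<open>auto simp: always_eventually\<close>)
  qed
  have bound: "\<bar>\<integral>x. f x * \<phi> ((torus_map A ^^ n) x) \<partial>haar_torus\<bar> \<le> w n * l2norm haar_torus \<phi>"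
    if "sq_integrable haar_torus \<phi>" for n \<phi>
    unfolding w_def by (rule correlation_bound[OF f assms(6) that decay])
  have mix: "correlation u \<longlonglongrightarrow> 0"
    if "u \<in> borel_measurable haar_torus" "\<forall>x\<in>space haar_torus. \<bar>u x\<bar> \<le> K" "(\<integral>x. u x \<partial>haar_torus) = 0" for u K
    by (rule correlation_decay_bounded[OF that(1) _ that(3) b0]) (use that(2) in auto)
  \<comment> \<open>By periodicity of \<open>f\<close> the iterates of the torus map may be replaced
    by those of \<open>A\<close> itself; this identifies the abstract correlations and laws with the
    stated ones.\<close>
  have fT: "f ((torus_map A ^^ n) x) = f (a n x)" if "x \<in> unit_cube" for n x
    by (simp add: funpow_torus_map[OF assms(1) that] periodic_frac_vec[OF assms(3)])
  have cor: "correlation f = (\<lambda>n. \<integral>x. f x * f (a n x) \<partial>haar_torus)"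
    unfolding correlation_def by (intro ext Bochner_Integration.integral_cong) (auto simp: fT)
  have bir: "distr haar_torus borel (\<lambda>x. birkhoff f n x / sqrt (real n))
      = distr haar_torus borel (\<lambda>x. (\<Sum>j<n. f (a j x)) / sqrt (real n))" for n
    by (rule distr_cong) (auto simp: birkhoff_def fT)
  have "summable (correlation f)"
    and "0 \<le> - (\<integral>x. (f x)\<^sup>2 \<partial>haar_torus) + 2 * (\<Sum>n. correlation f n)"
    and "weak_conv_m (\<lambda>n. distr haar_torus borel (\<lambda>x. birkhoff f n x / sqrt (real n)))
      (centered_gaussian (- (\<integral>x. (f x)\<^sup>2 \<partial>haar_torus) + 2 * (\<Sum>n. correlation f n)))"
    by (rule birkhoff_clt[OF sf w w0 bound mix refl]; assumption)+
  then show ?thesis unfolding bir cor Let_def by blast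
qed

end
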